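(* Let $d\in\{2,3,\dots\}$, $\omega\in(\frac d2-1,+\infty)$, and let $K_\omega\in(0,+\infty)$ be any constant such that $$\frac{1}{(2\pi)^{d/2}}\sqrt{\sup_{k\in\mathbb{Z}^d_0}\mathcal{K}_\omega(k)}\le K_\omega,\qquad \mathcal{K}_\omega(k):=\sum_{h\in\mathbb{Z}^d\setminus\{0,k\}}\frac{1}{|h|^{2\omega}|k-h|^2}.$$ Let $v\in\mathbb{H}^1_{\Sigma 0}(\mathbb{T}^d)$ and $w\in\mathbb{H}^1_0(\mathbb{T}^d)$. Then: (i) the product $v\cdot\partial w$ (whose components $(v\cdot\partial w)^r=\sum_{s=1}^dv^s\partial_sw^r$ are well defined and belong to $L^1$) satisfies $$v\cdot\partial w\in\mathbb{H}^{-\omega}_0(\mathbb{T}^d),\qquad \|v\cdot\partial w\|_{-\omega}\le K_\omega\|v\|_1\|w\|_1 ;$$ (ii) one has $$\mathfrak{L}(v\cdot\partial w)\in\mathbb{H}^{-\omega}_{\Sigma 0}(\mathbb{T}^d),\qquad \|\mathfrak{L}(v\cdot\partial w)\|_{-\omega}\le K_\omega\|v\|_1\|w\|_1 .$$ (Consequently the bilinear map $\mathbb{H}^1_{\Sigma 0}\times\mathbb{H}^1_{\Sigma 0}\to\mathbb{H}^{-\omega}_{\Sigma 0}$, $(v,w)\mapsto-\mathfrak{L}(v\cdot\partial w)$, is well defined and continuous, with the bound $\|\mathfrak{L}(v\cdot\partial w)\|_{-\omega}\le K_\omega\|v\|_1\|w\|_1$.)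
   Context: $\mathbb{T}^d:=(\mathbb{R}/2\pi\mathbb{Z})^d$, $\mathbb{Z}^d_0:=\mathbb{Z}^d\setminus\{0\}$, and $e_k(x):=(2\pi)^{-d/2}e^{ik\cdot x}$ for $k\in\mathbb{Z}^d$. A vector field is a $d$-tuple $v=(v^1,\dots,v^d)$ of real (periodic) distributions on $\mathbb{T}^d$; its Fourier coefficients are $v_k=(\langle v^r,e_{-k}\rangle)_{r=1,\dots,d}\in\mathbb{C}^d$, so that $v=\sum_{k\in\mathbb{Z}^d}v_ke_k$ and $\overline{v_k}=v_{-k}$. For $c\in\mathbb{C}^d$, $|c|$ is the standard Hermitian norm, and $a\cdot b=\sum_r a^rb^r$. For $n\in\mathbb{R}$, $\mathbb{H}^n_0(\mathbb{T}^d)$ is the space of vector fields $v$ with zero mean ($v_0=0$) and $\sum_{k\in\mathbb{Z}^d_0}|k|^{2n}|v_k|^2<+\infty$, with the Hilbert norm $\|v\|_n:=\big(\sum_{k\in\mathbb{Z}^d_0}|k|^{2n}|v_k|^2\big)^{1/2}$. $\mathbb{H}^n_{\Sigma 0}(\mathbb{T}^d)$ is its closed subspace of divergence free elements ($k\cdot v_k=0$ for all $k$), with the same norm. The Leray projection is $\mathfrak{L}v:=\sum_{k\in\mathbb{Z}^d}(\mathfrak{L}_kv_k)e_k$, with $\mathfrak{L}_0c=c$ and $\mathfrak{L}_kc=c-\frac{k\cdot c}{|k|^2}k$ for $k\ne0$. It is part of the paper's results that $\sup_{k\in\mathbb{Z}^d_0}\mathcal{K}_\omega(k)<+\infty$ for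 $\omega>\frac d2-1$, so such constants $K_\omega$ exist. *)

theory Defs
  imports "HOL-Analysis.Analysis"
begin

text \<open>
  The dimension is \<open>d = CARD('d)\<close>. Functions on the torus are functions on \<open>real ^ 'd\<close> that are
  \<open>2 pi\<close>-periodic in each coordinate; functions defined up to null sets are given on the
  fundamental cell, and integrals over the torus are integrals over that cell.
\<close>

definition cell :: "(real ^ 'd) set" where
  "cell = cbox 0 (\<chi> i. 2 * pi)"

definition partial :: "'d \<Rightarrow> (real ^ 'd \<Rightarrow> complex) \<Rightarrow> real ^ 'd \<Rightarrow> complex" where
  "partial i \<phi> x = frechet_derivative \<phi> (at x) (axis i 1)"

primrec partials :: "'d list \<Rightarrow> (real ^ 'd \<Rightarrow> complex) \<Rightarrow> real ^ 'd \<Rightarrow> complex" where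
  "partials [] \<phi> = \<phi>"
| "partials (i # is) \<phi> = partial i (partials is \<phi>)"

text \<open>If all iterated partial derivatives are differentiable, they are all continuous, so the first
  condition below is smoothness.\<close>

definition test_fun :: "(real ^ 'd \<Rightarrow> complex) \<Rightarrow> bool" where
  "test_fun \<phi> \<longleftrightarrow>
     (\<forall>is x. partials is \<phi> differentiable (at x)) \<and>
     (\<forall>x i. \<phi> (x + (2 * pi) *\<^sub>R axis i 1) = \<phi> x)"

text \<open>
  Distributions are functionals on test functions. They are represented by total functions of which
  only the values on test functions matter. Continuity is continuity for the Frechet topology
  given by the suprema of all derivatives.
\<close>

type_synonym 'd functional = "(real ^ 'd \<Rightarrow> complex) \<Rightarrow> complex"

definition distribution :: "'d::finite functional \<Rightarrow> bool" where
  "distribution u \<longleftrightarrow>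
     (\<forall>\<phi> \<psi>. test_fun \<phi> \<longrightarrow> test_fun \<psi> \<longrightarrow> u (\<lambda>x. \<phi> x + \<psi> x) = u \<phi> + u \<psi>) \<and>
     (\<forall>c \<phi>. test_fun \<phi> \<longrightarrow> u (\<lambda>x. c * \<phi> x) = c * u \<phi>) \<and>
     (\<exists>C N. \<forall>\<phi>. test_fun \<phi> \<longrightarrow>
        norm (u \<phi>) \<le> C * (\<Sum>is | length is \<le> N. SUP x. norm (partials is \<phi> x)))"

definition real_distribution :: "'d::finite functional \<Rightarrow> bool" where
  "real_distribution u \<longleftrightarrow>
     distribution u \<and> (\<forall>\<phi>. test_fun \<phi> \<longrightarrow> u (\<lambda>x. cnj (\<phi> x)) = cnj (u \<phi>))"

definition dist_partial :: "'d \<Rightarrow> 'd::finite functional \<Rightarrow> 'd::finite functional" where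
  "dist_partial s u = (\<lambda>\<phi>. - u (partial s \<phi>))"

definition of_function :: "(real ^ 'd \<Rightarrow> real) \<Rightarrow> 'd::finite functional" where
  "of_function f = (\<lambda>\<phi>. LINT x:cell|lebesgue. complex_of_real (f x) * \<phi> x)"

text \<open>\<open>represents f u\<close>: the functional \<open>u\<close> is (identified with) the \<open>L\<^sup>1\<close> function \<open>f\<close>.\<close>

definition represents :: "(real ^ 'd \<Rightarrow> real) \<Rightarrow> 'd::finite functional \<Rightarrow> bool" where
  "represents f u \<longleftrightarrow>
     f absolutely_integrable_on cell \<and> (\<forall>\<phi>. test_fun \<phi> \<longrightarrow> u \<phi> = of_function f \<phi>)"

definition function_of :: "'d::finite functional \<Rightarrow> real ^ 'd \<Rightarrow> real" where
  "function_of u = (SOME f. represents f u)"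

definition lnorm :: "int ^ 'd \<Rightarrow> real" where
  "lnorm k = norm (\<chi> i. real_of_int (k $ i))"

definition fourier_basis :: "int ^ 'd \<Rightarrow> real ^ 'd \<Rightarrow> complex" where
  "fourier_basis k x =
     complex_of_real ((2 * pi) powr (- real CARD('d) / 2)) *
     exp (\<i> * complex_of_real (\<Sum>r\<in>UNIV. real_of_int (k $ r) * x $ r))"

type_synonym 'd vfield = "'d functional ^ 'd"

definition vector_field :: "'d::finite vfield \<Rightarrow> bool" where
  "vector_field v \<longleftrightarrow> (\<forall>r. real_distribution (v $ r))"

definition fcoeff :: "'d::finite vfield \<Rightarrow> int ^ 'd \<Rightarrow> complex ^ 'd" where
  "fcoeff v k = (\<chi> r. (v $ r) (fourier_basis (- k)))"

text \<open>The product \<open>k \<cdot> c\<close> is bilinear; the library's inner product on \<open>complex ^ 'd\<close> is the real part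
  of the Hermitian one, so it cannot be used here.\<close>

definition ldot :: "int ^ 'd \<Rightarrow> complex ^ 'd \<Rightarrow> complex" where
  "ldot k c = (\<Sum>r\<in>UNIV. of_int (k $ r) * c $ r)"

definition H0 :: "real \<Rightarrow> 'd::finite vfield set" where
  "H0 n = {v. vector_field v \<and> fcoeff v 0 = 0 \<and>
     (\<lambda>k. lnorm k powr (2 * n) * (norm (fcoeff v k))\<^sup>2) summable_on (UNIV - {0})}"

definition Hnorm :: "real \<Rightarrow> 'd::finite vfield \<Rightarrow> real" where
  "Hnorm n v =
     sqrt (\<Sum>\<^sub>\<infinity>k\<in>UNIV - {0}. lnorm k powr (2 * n) * (norm (fcoeff v k))\<^sup>2)"

definition HSigma0 :: "real \<Rightarrow> 'd::finite vfield set" where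
  "HSigma0 n = {v \<in> H0 n. \<forall>k. ldot k (fcoeff v k) = 0}"

definition leray_coeff :: "int ^ 'd \<Rightarrow> complex ^ 'd \<Rightarrow> complex ^ 'd" where
  "leray_coeff k c =
     (if k = 0 then c
      else c - (ldot k c / complex_of_real ((lnorm k)\<^sup>2)) *s (\<chi> r. of_int (k $ r)))"

text \<open>The series \<open>\<Sum>k. (L\<^sub>k v\<^sub>k) e\<^sub>k\<close> is taken in the sense of distributions: the integral is the pairing
  of \<open>e\<^sub>k\<close> with the test function.\<close>

definition leray :: "'d::finite vfield \<Rightarrow> 'd::finite vfield" where
  "leray v = (\<chi> r. (\<lambda>\<phi>. (\<Sum>\<^sub>\<infinity>k. leray_coeff k (fcoeff v k) $ r *
                            (LINT x:cell|lebesgue. fourier_basis k x * \<phi> x))))"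

text \<open>\<open>v \<cdot> \<partial>w\<close> is the pointwise product of the functions \<open>v\<^sup>s\<close> and \<open>\<partial>\<^sub>s w\<^sup>r\<close>, summed over \<open>s\<close>
  and regarded again as a distribution; it is meaningful if these distributions are functions and
  the products are integrable.\<close>

definition advection :: "'d::finite vfield \<Rightarrow> 'd::finite vfield \<Rightarrow> 'd::finite vfield" where
  "advection v w = (\<chi> r. of_function
     (\<lambda>x. \<Sum>s\<in>UNIV. function_of (v $ s) x * function_of (dist_partial s (w $ r)) x))"

definition advection_well_defined :: "'d::finite vfield \<Rightarrow> 'd::finite vfield \<Rightarrow> bool" where
  "advection_well_defined v w \<longleftrightarrow>
     (\<forall>s. \<exists>f. represents f (v $ s)) \<and>
     (\<forall>r s. \<exists>g. represents g (dist_partial s (w $ r))) \<and>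
     (\<forall>r f g. (\<forall>s. represents (f s) (v $ s)) \<longrightarrow>
              (\<forall>s. represents (g s) (dist_partial s (w $ r))) \<longrightarrow>
        (\<forall>s. (\<lambda>x. f s x * g s x) absolutely_integrable_on cell) \<and>
        represents (\<lambda>x. \<Sum>s\<in>UNIV. f s x * g s x) (advection v w $ r))"

definition lin_comb :: "real \<Rightarrow> 'd::finite vfield \<Rightarrow> real \<Rightarrow> 'd::finite vfield \<Rightarrow> 'd::finite vfield" where
  "lin_comb a v b w = (\<chi> r. (\<lambda>\<phi>. complex_of_real a * (v $ r) \<phi> + complex_of_real b * (w $ r) \<phi>))"

definition same_field :: "'d::finite vfield \<Rightarrow> 'd::finite vfield \<Rightarrow> bool" where
  "same_field v w \<longleftrightarrow> (\<forall>r \<phi>. test_fun \<phi> \<longrightarrow> (v $ r) \<phi> = (w $ r) \<phi>)"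

definition ns_bilinear :: "'d::finite vfield \<Rightarrow> 'd::finite vfield \<Rightarrow> 'd::finite vfield" where
  "ns_bilinear v w = (\<chi> r. (\<lambda>\<phi>. - (leray (advection v w) $ r) \<phi>))"

definition Kfun :: "real \<Rightarrow> int ^ 'd \<Rightarrow> real" where
  "Kfun \<omega> k =
     (\<Sum>\<^sub>\<infinity>h\<in>UNIV - {0, k}. 1 / (lnorm h powr (2 * \<omega>) * (lnorm (k - h))\<^sup>2))"

end

theory Submission
  imports Defs
begin

text \<open>
  Everything is reduced to Fourier coefficients. A distribution on the torus is determined by its
  values on the exponentials, because the Fourier series of a test function converges together with
  all derivatives (\<open>distribution_fourier_series\<close>). If these values are square-summable, the
  distribution is a square-integrable function, and its representative is unique up to null sets:
  existence is the theorem of Riesz and Fischer, uniqueness is the completeness of the exponentials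
  in \<open>L\<^sup>1\<close> (\<open>null_coeffs_AE_0\<close>). This applies to the components of \<open>v\<close> and to the first
  derivatives of the components of \<open>w\<close>, so that the products \<open>v\<^sup>s \<partial>\<^sub>s w\<^sup>r\<close> are integrable.

  By Parseval's identity the coefficients of the product are given by a convolution,
  \[ (v \cdot \partial w)_k = i (2 \pi)^{-d/2} \sum_h (v_h \cdot (k - h)) w_{k - h} , \]
  which vanishes for \<open>k = 0\<close> since \<open>h \<cdot> v\<^sub>h = 0\<close>. In norm it is at most
  \<open>(2\<pi>)\<^sup>-\<^sup>d\<^sup>/\<^sup>2\<close> times the convolution of \<open>a\<^sub>h = \<bar>v\<^sub>h\<bar>\<close> with \<open>b\<^sub>l = \<bar>l\<bar> \<bar>w\<^sub>l\<bar>\<close>. The inequality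
  \[ \sum_k |k|^{-2\omega} \Big( \sum_h a_h b_{k-h} \Big)^2 \le
     \sup_l K_\omega(l) \; \sum_h |h|^2 a_h^2 \; \sum_l b_l^2 \]
  (\<open>convolution_inequality\<close>), where the kernel is summed in the output frequency at a fixed
  frequency \<open>l\<close> of \<open>w\<close>, is the claimed bound. The supremum is finite because
  \<open>1 / (\<bar>h\<bar>\<^sup>2\<^sup>\<omega> \<bar>k - h\<bar>\<^sup>2)\<close> is at most \<open>\<bar>h\<bar>\<^sup>-\<^sup>p + \<bar>k - h\<bar>\<^sup>-\<^sup>p\<close> with
  \<open>p = 2\<omega> + 2 > d\<close>.

  The Leray projection acts on each coefficient as an orthogonal projection, which preserves the
  bound. The coefficients of the product are bounded, so the projected series is again a
  distribution. Bilinearity holds for the representing functions and passes to the coefficients;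
  continuity follows from bilinearity and the bound.
\<close>

section \<open>The torus as a finite measure space\<close>

definition torus :: "(real ^ 'd::finite) measure" where
  "torus = lebesgue_on cell"

lemma cell_lmeasurable [simp]: "cell \<in> lmeasurable" "cell \<in> sets lebesgue"
  unfolding cell_def by auto

lemma mem_cell: "x \<in> cell \<longleftrightarrow> (\<forall>i. 0 \<le> x $ i \<and> x $ i \<le> 2 * pi)"
  unfolding cell_def by (simp add: mem_box_cart)

lemma space_torus [simp]: "space torus = cell"
  unfolding torus_def by simp

lemma torus_set_integral: "(LINT x:cell|lebesgue. f x) = (\<integral>x. f x \<partial>torus)"
  for f :: "real ^ 'd::finite \<Rightarrow> 'b::{banach, second_countable_topology}"
  unfolding torus_def set_lebesgue_integral_def by (subst integral_restrict_space) auto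

lemma torus_integrable_iff: "integrable torus f \<longleftrightarrow> f absolutely_integrable_on cell"
  for f :: "real ^ 'd::finite \<Rightarrow> 'b::{banach, second_countable_topology}"
  unfolding torus_def set_integrable_def by (subst integrable_restrict_space) auto

lemma torus_integral_eq: "integrable torus f \<Longrightarrow> (\<integral>x. f x \<partial>torus) = integral cell f"
  for f :: "real ^ 'd::finite \<Rightarrow> 'b::euclidean_space"
  using set_lebesgue_integral_eq_integral(2)[of cell f]
  by (simp add: torus_set_integral torus_integrable_iff)

lemma emeasure_torus_finite: "emeasure torus (space torus) < \<infinity>"
  using emeasure_lborel_cbox_finite
  by (simp add: torus_def emeasure_restrict_space cell_def flip: infinity_ennreal_def)

lemma measure_torus: "measure (torus :: (real ^ 'd::finite) measure) cell = (2 * pi) ^ CARD('d)"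
proof -
  have "measure (torus :: (real ^ 'd) measure) cell = measure lebesgue (cell :: (real ^ 'd) set)"
    unfolding torus_def by (simp add: measure_restrict_space)
  also have "\<dots> = (2 * pi) ^ CARD('d)"
    unfolding cell_def by (simp add: content_cbox_if_cart interval_ne_empty_cart not_less)
  finally show ?thesis .
qed

interpretation torus: finite_measure torus
  by standard (use emeasure_torus_finite in \<open>simp add: less_top\<close>)

lemma measurable_torus_continuous:
  fixes f :: "real ^ 'd::finite \<Rightarrow> 'b::euclidean_space"
  assumes "continuous_on UNIV f"
  shows "f \<in> borel_measurable torus"
  unfolding torus_def
  by (rule continuous_imp_measurable_on_sets_lebesgue) (use assms continuous_on_subset in auto)

lemma integrable_torus_mult:
  fixes f g :: "real ^ 'd::finite \<Rightarrow> complex"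
  assumes "integrable torus f" "g \<in> borel_measurable torus" "\<And>x. norm (g x) \<le> B"
  shows "integrable torus (\<lambda>x. f x * g x)"
proof (rule Bochner_Integration.integrable_bound)
  show "integrable torus (\<lambda>x. B * norm (f x))" using assms(1) by simp
  show "AE x in torus. norm (f x * g x) \<le> norm (B * norm (f x))"
  proof (rule AE_I2)
    fix x
    have "norm (f x * g x) \<le> B * norm (f x)"
      unfolding norm_mult mult.commute[of B] by (rule mult_left_mono[OF assms(3)]) simp
    thus "norm (f x * g x) \<le> norm (B * norm (f x))" by simp
  qed
qed (use assms in simp)

definition periodic :: "(real ^ 'd \<Rightarrow> 'b) \<Rightarrow> bool" where
  "periodic \<phi> \<longleftrightarrow> (\<forall>x i. \<phi> (x + (2 * pi) *\<^sub>R axis i 1) = \<phi> x)"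

lemma periodic_int_axis:
  fixes \<phi> :: "real ^ 'd::finite \<Rightarrow> 'b"
  assumes "periodic \<phi>"
  shows "\<phi> (x + (2 * pi * real_of_int n) *\<^sub>R axis i 1) = \<phi> x"
proof (induction n arbitrary: x rule: int_induct[where k = 0])
  case base then show ?case by simp
next
  case (step1 n)
  have "x + (2 * pi * real_of_int (n + 1)) *\<^sub>R axis i 1 =
        (x + (2 * pi * real_of_int n) *\<^sub>R axis i 1) + (2 * pi) *\<^sub>R axis i 1"
    by (simp add: algebra_simps)
  then show ?case using step1 assms unfolding periodic_def by metis
next
  case (step2 n)
  have "x + (2 * pi * real_of_int n) *\<^sub>R axis i 1 =
        (x + (2 * pi * real_of_int (n - 1)) *\<^sub>R axis i 1) + (2 * pi) *\<^sub>R axis i 1"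
    by (simp add: algebra_simps)
  then show ?case using step2 assms unfolding periodic_def by metis
qed

text \<open>Translation by a lattice vector is a composition of translations along the axes.\<close>

lemma periodic_lattice:
  fixes \<phi> :: "real ^ 'd::finite \<Rightarrow> 'b"
  assumes "periodic \<phi>"
  shows "\<phi> (x + (\<chi> i. 2 * pi * real_of_int (n $ i))) = \<phi> x"
proof -
  have "\<phi> (x + (\<Sum>i\<in>I. (2 * pi * real_of_int (n $ i)) *\<^sub>R axis i 1)) = \<phi> x" if "finite I" for I
    using that
  proof (induction I arbitrary: x)
    case (insert i I)
    show ?case using insert.IH periodic_int_axis[OF assms] insert.hyps
      by (simp add: add.assoc[symmetric])
  qed simp
  moreover have "(\<Sum>i\<in>UNIV. (2 * pi * real_of_int (n $ i)) *\<^sub>R axis i 1) =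
      (\<chi> i. 2 * pi * real_of_int (n $ i))"
    by (simp add: vec_eq_iff axis_def if_distrib cong: if_cong)
  ultimately show ?thesis by (metis finite)
qed

lemma periodic_cell_representative:
  fixes x :: "real ^ 'd::finite"
  obtains y where "y \<in> cell" "\<And>\<phi> :: real ^ 'd \<Rightarrow> 'b. periodic \<phi> \<Longrightarrow> \<phi> y = \<phi> x"
proof
  define n :: "int ^ 'd" where "n = (\<chi> i. - \<lfloor>x $ i / (2 * pi)\<rfloor>)"
  let ?y = "x + (\<chi> i. 2 * pi * real_of_int (n $ i))"
  show "?y \<in> cell"
  proof -
    have "0 \<le> x $ i + 2 * pi * real_of_int (n $ i) \<and> x $ i + 2 * pi * real_of_int (n $ i) \<le> 2 * pi"
      for i
    proof -
      define q where "q = x $ i / (2 * pi)"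
      have x: "x $ i = 2 * pi * q" unfolding q_def by simp
      have "x $ i + 2 * pi * real_of_int (n $ i) = 2 * pi * (q - of_int \<lfloor>q\<rfloor>)"
        unfolding n_def q_def by (simp add: algebra_simps)
      moreover have "0 \<le> q - of_int \<lfloor>q\<rfloor>" "q - of_int \<lfloor>q\<rfloor> \<le> 1" by linarith+
      ultimately show ?thesis using mult_left_le[of "q - of_int \<lfloor>q\<rfloor>" "2 * pi"] by simp
    qed
    thus ?thesis by (simp add: mem_cell)
  qed
  show "\<phi> ?y = \<phi> x" if "periodic \<phi>" for \<phi> :: "real ^ 'd \<Rightarrow> 'b"
    using periodic_lattice[OF that] by simp
qed

lemma continuous_periodic_bounded:
  fixes \<phi> :: "real ^ 'd::finite \<Rightarrow> 'b::real_normed_vector"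
  assumes "periodic \<phi>" "continuous_on UNIV \<phi>"
  shows "bounded (range \<phi>)"
proof -
  have "range \<phi> \<subseteq> \<phi> ` cell"
  proof
    fix z assume "z \<in> range \<phi>"
    then obtain x where "z = \<phi> x" by auto
    moreover obtain y where "y \<in> cell" "\<phi> y = \<phi> x"
      using periodic_cell_representative[of x] assms(1) by metis
    ultimately show "z \<in> \<phi> ` cell" by (metis imageI)
  qed
  moreover have "compact (\<phi> ` cell)"
    using assms(2) continuous_on_subset unfolding cell_def
    by (intro compact_continuous_image) auto
  ultimately show ?thesis using bounded_subset compact_imp_bounded by blast
qed

section \<open>Partial derivatives and test functions\<close>

definition smooth :: "(real ^ 'd::finite \<Rightarrow> complex) \<Rightarrow> bool" where
  "smooth \<phi> \<longleftrightarrow> (\<forall>is x. partials is \<phi> differentiable (at x))"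

lemma test_fun_iff: "test_fun \<phi> \<longleftrightarrow> smooth \<phi> \<and> periodic \<phi>"
  unfolding test_fun_def smooth_def periodic_def by blast

lemma smooth_differentiable: "smooth \<phi> \<Longrightarrow> partials is \<phi> differentiable (at x)"
  unfolding smooth_def by blast

lemma smooth_differentiable0: "smooth \<phi> \<Longrightarrow> \<phi> differentiable (at x)"
  using smooth_differentiable[of \<phi> "[]"] by simp

lemma smooth_continuous: "smooth \<phi> \<Longrightarrow> continuous_on UNIV \<phi>"
  by (simp add: differentiable_imp_continuous_on differentiable_on_def smooth_differentiable0)

lemma partials_append: "partials (is @ js) \<phi> = partials is (partials js \<phi>)"
  by (induction "is") auto

lemma smooth_partials: "smooth \<phi> \<Longrightarrow> smooth (partials is \<phi>)"
  unfolding smooth_def by (metis partials_append)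

lemma smooth_partial: "smooth \<phi> \<Longrightarrow> smooth (partial i \<phi>)"
  using smooth_partials[of \<phi> "[i]"] by simp

lemma partial_eqI: "(\<phi> has_derivative D) (at x) \<Longrightarrow> partial i \<phi> x = D (axis i 1)"
  unfolding partial_def by (metis frechet_derivative_at)

lemma has_partial_derivative:
  "\<phi> differentiable (at x) \<Longrightarrow> (\<phi> has_derivative frechet_derivative \<phi> (at x)) (at x)"
  by (simp add: frechet_derivative_works)

lemma partials_add:
  assumes "smooth \<phi>" "smooth \<psi>"
  shows "partials is (\<lambda>x. \<phi> x + \<psi> x) = (\<lambda>x. partials is \<phi> x + partials is \<psi> x)"
proof (induction "is")
  case (Cons i "is")
  have "partial i (\<lambda>x. partials is \<phi> x + partials is \<psi> x) x =
      partial i (partials is \<phi>) x + partial i (partials is \<psi>) x" for x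
    by (subst partial_eqI[OF has_derivative_add[OF has_partial_derivative has_partial_derivative]])
      (simp_all add: assms smooth_differentiable partial_def)
  then show ?case using Cons by auto
qed simp

text \<open>Covers complex multiples and conjugation, which are both real-linear in the values.\<close>

lemma partials_linear:
  assumes "smooth \<phi>" and L: "bounded_linear L"
  shows "partials is (\<lambda>x. L (\<phi> x)) = (\<lambda>x. L (partials is \<phi> x))"
proof (induction "is")
  case (Cons i "is")
  have "partial i (\<lambda>x. L (partials is \<phi> x)) x = L (partial i (partials is \<phi>) x)" for x
    by (subst partial_eqI[OF bounded_linear.has_derivative[OF L has_partial_derivative]])
      (simp_all add: assms smooth_differentiable partial_def)
  then show ?case using Cons by auto
qed simp

lemma smooth_add: "smooth \<phi> \<Longrightarrow> smooth \<psi> \<Longrightarrow> smooth (\<lambda>x. \<phi> x + \<psi> x)"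
  by (subst smooth_def) (simp add: partials_add smooth_differentiable)

lemma smooth_linear: "smooth \<phi> \<Longrightarrow> bounded_linear L \<Longrightarrow> smooth (\<lambda>x. L (\<phi> x))"
  by (subst smooth_def)
    (auto simp: partials_linear intro!: smooth_differentiable
      differentiable_compose[of L, OF linear_imp_differentiable] dest: bounded_linear.linear)

lemma partials_cmult: "smooth \<phi> \<Longrightarrow> partials is (\<lambda>x. c * \<phi> x) = (\<lambda>x. c * partials is \<phi> x)"
  by (rule partials_linear) (simp_all add: bounded_linear_mult_right)

lemma partials_cnj: "smooth \<phi> \<Longrightarrow> partials is (\<lambda>x. cnj (\<phi> x)) = (\<lambda>x. cnj (partials is \<phi> x))"
  by (rule partials_linear) (simp_all add: bounded_linear_cnj)

lemma periodic_partial: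
  fixes \<phi> :: "real ^ 'd::finite \<Rightarrow> complex"
  assumes "periodic \<phi>" "\<And>x. \<phi> differentiable (at x)"
  shows "periodic (partial s \<phi>)"
  unfolding periodic_def
proof (intro allI)
  fix x :: "real ^ 'd" and i
  let ?c = "(2 * pi) *\<^sub>R axis i 1 :: real ^ 'd"
  let ?D = "frechet_derivative \<phi> (at (x + ?c))"
  have "(\<phi> has_derivative ?D) (at (x + ?c))" using assms(2) by (rule has_partial_derivative)
  hence "((\<lambda>y. \<phi> (y + ?c)) has_derivative ?D) (at x)"
    by (rule has_derivative_compose[rotated]) (auto intro!: derivative_eq_intros)
  moreover have "(\<lambda>y. \<phi> (y + ?c)) = \<phi>" using assms(1) unfolding periodic_def by auto
  ultimately have "(\<phi> has_derivative ?D) (at x)" by simp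
  from partial_eqI[OF this] show "partial s \<phi> (x + ?c) = partial s \<phi> x"
    by (simp add: partial_def)
qed

lemma test_fun_partials: "test_fun \<phi> \<Longrightarrow> test_fun (partials is \<phi>)"
  by (induction "is")
    (auto simp: test_fun_iff smooth_partial smooth_differentiable0 intro!: periodic_partial)

lemma test_fun_partial: "test_fun \<phi> \<Longrightarrow> test_fun (partial i \<phi>)"
  using test_fun_partials[of \<phi> "[i]"] by simp

lemma test_fun_add: "test_fun \<phi> \<Longrightarrow> test_fun \<psi> \<Longrightarrow> test_fun (\<lambda>x. \<phi> x + \<psi> x)"
  by (auto simp: test_fun_iff smooth_add periodic_def)

lemma test_fun_cmult: "test_fun \<phi> \<Longrightarrow> test_fun (\<lambda>x. c * \<phi> x)"
  using smooth_linear[of \<phi> "\<lambda>z. c * z"]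
  by (auto simp: test_fun_iff periodic_def bounded_linear_mult_right)

lemma test_fun_continuous: "test_fun \<phi> \<Longrightarrow> continuous_on UNIV \<phi>"
  by (simp add: smooth_continuous test_fun_iff)

lemma test_fun_bounded: "test_fun \<phi> \<Longrightarrow> bounded (range \<phi>)"
  by (simp add: continuous_periodic_bounded smooth_continuous test_fun_iff)

lemma test_fun_bdd_above: "test_fun \<phi> \<Longrightarrow> bdd_above (range (\<lambda>x. norm (\<phi> x)))"
  using test_fun_bounded[of \<phi>] by (auto simp: bounded_iff bdd_above_def)

lemma test_fun_le_SUP: "test_fun \<phi> \<Longrightarrow> norm (\<phi> x) \<le> (SUP x. norm (\<phi> x))"
  by (rule cSUP_upper) (auto intro: test_fun_bdd_above)

lemma test_fun_SUP_nonneg: "test_fun \<phi> \<Longrightarrow> 0 \<le> (SUP x. norm (\<phi> x))"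
  using test_fun_le_SUP[of \<phi> 0] by (meson norm_ge_zero order_trans)

lemma test_fun_measurable: "test_fun \<phi> \<Longrightarrow> \<phi> \<in> borel_measurable torus"
  by (simp add: measurable_torus_continuous test_fun_continuous)

lemma integrable_mult_test_fun:
  "integrable torus f \<Longrightarrow> test_fun \<phi> \<Longrightarrow> integrable torus (\<lambda>x. f x * \<phi> x)"
  by (rule integrable_torus_mult[where B = "SUP x. norm (\<phi> x)"])
    (auto intro: test_fun_measurable test_fun_le_SUP)

lemma integrable_test_fun: "test_fun \<phi> \<Longrightarrow> integrable torus \<phi>"
  using integrable_mult_test_fun[of "\<lambda>_. 1" \<phi>] by simp

section \<open>Exponentials and integration by parts\<close>

text \<open>The constant modulus of the exponentials; the dummy argument carries the dimension.\<close>

definition basis_norm :: "'d::finite itself \<Rightarrow> real" where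
  "basis_norm _ = (2 * pi) powr (- real CARD('d) / 2)"

lemma basis_norm_pos [simp]: "0 < basis_norm TYPE('d::finite)" "basis_norm TYPE('d) \<noteq> 0"
  "0 \<le> basis_norm TYPE('d)"
  by (simp_all add: basis_norm_def)

lemma basis_norm_square: "basis_norm TYPE('d::finite) * basis_norm TYPE('d) * (2 * pi) ^ CARD('d) = 1"
proof -
  have "basis_norm TYPE('d) * basis_norm TYPE('d) = (2 * pi) powr (- real CARD('d))"
    unfolding basis_norm_def by (subst powr_add[symmetric]) simp
  then show ?thesis by (simp add: powr_minus powr_realpow field_simps)
qed

definition phase :: "int ^ 'd \<Rightarrow> real ^ 'd::finite \<Rightarrow> real" where
  "phase k x = (\<Sum>r\<in>UNIV. real_of_int (k $ r) * x $ r)"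

lemma bounded_linear_phase: "bounded_linear (phase k)"
  unfolding phase_def[abs_def]
  by (intro bounded_linear_sum bounded_linear_const_mult bounded_linear_vec_nth)

lemma phase_axis: "phase k (c *\<^sub>R axis i 1) = c * real_of_int (k $ i)"
  by (simp add: phase_def axis_def if_distrib sum.delta' cong: if_cong)

lemma phase_add: "phase k (x + y) = phase k x + phase k y"
  by (rule linear_add[OF bounded_linear.linear[OF bounded_linear_phase]])

lemma fourier_basis_phase:
  "fourier_basis k x = complex_of_real (basis_norm TYPE('d)) * exp (\<i> * complex_of_real (phase k x))"
  for x :: "real ^ 'd::finite"
  by (simp add: fourier_basis_def basis_norm_def phase_def)

lemma norm_fourier_basis [simp]: "norm (fourier_basis k x) = basis_norm TYPE('d)"
  for x :: "real ^ 'd::finite"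
  using basis_norm_pos(1)[where 'd = 'd]
  by (simp add: fourier_basis_phase norm_mult less_imp_le)

lemma fourier_basis_0: "fourier_basis 0 = (\<lambda>x :: real ^ 'd::finite. complex_of_real (basis_norm TYPE('d)))"
  by (simp add: fourier_basis_phase phase_def fun_eq_iff)

lemma fourier_basis_mult:
  "fourier_basis h x * fourier_basis k x =
   complex_of_real (basis_norm TYPE('d)) * fourier_basis (h + k) x" for x :: "real ^ 'd::finite"
  by (simp add: fourier_basis_phase phase_def algebra_simps sum.distrib exp_add)

lemma cnj_fourier_basis: "cnj (fourier_basis k x) = fourier_basis (- k) x"
  for x :: "real ^ 'd::finite"
  by (simp add: fourier_basis_phase exp_cnj phase_def sum_negf)

lemma fourier_basis_translate:
  "fourier_basis k (x + (2 * pi) *\<^sub>R axis i 1) = fourier_basis k x" for x :: "real ^ 'd::finite"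
proof -
  have "phase k (x + (2 * pi) *\<^sub>R axis i 1) = phase k x + 2 * pi * real_of_int (k $ i)"
    by (simp add: phase_add phase_axis)
  moreover have "exp (\<i> * complex_of_real (2 * pi * real_of_int (k $ i))) = 1"
    using exp_integer_2pi[of "of_int (k $ i)"] by (simp add: mult_ac)
  ultimately show ?thesis
    by (simp add: fourier_basis_phase algebra_simps exp_add)
qed

lemma has_derivative_fourier_basis:
  "(fourier_basis k has_derivative (\<lambda>h. \<i> * complex_of_real (phase k h) * fourier_basis k x)) (at x)"
  for x :: "real ^ 'd::finite"
proof -
  have "(phase k has_derivative phase k) (at x)"
    by (rule bounded_linear_imp_has_derivative[OF bounded_linear_phase])
  hence "((\<lambda>x. \<i> * complex_of_real (phase k x)) has_derivative (\<lambda>h. \<i> * complex_of_real (phase k h))) (at x)"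
    by (auto intro!: derivative_eq_intros)
  hence "((\<lambda>x. exp (\<i> * complex_of_real (phase k x))) has_derivative
     (\<lambda>h. exp (\<i> * complex_of_real (phase k x)) * (\<i> * complex_of_real (phase k h)))) (at x)"
    using has_derivative_compose[OF _ DERIV_exp[THEN has_field_derivative_imp_has_derivative]]
    by (auto simp: mult.commute)
  from has_derivative_mult_right[OF this, of "complex_of_real (basis_norm TYPE('d))"] show ?thesis
    unfolding fourier_basis_phase[abs_def] by (simp add: mult_ac)
qed

lemma partial_fourier_basis:
  "partial s (\<lambda>x. c * fourier_basis k x) = (\<lambda>x. c * (\<i> * of_int (k $ s)) * fourier_basis k x)"
  for c :: complex
proof
  fix x :: "real ^ 'a"
  have "phase k (axis s 1) = real_of_int (k $ s)"
    using phase_axis[of k 1 s] by simp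
  then show "partial s (\<lambda>x. c * fourier_basis k x) x = c * (\<i> * of_int (k $ s)) * fourier_basis k x"
    by (subst partial_eqI[OF has_derivative_mult_right[OF has_derivative_fourier_basis]]) simp
qed

lemma partials_fourier_basis:
  "partials is (fourier_basis k) = (\<lambda>x. (\<Prod>s\<leftarrow>is. \<i> * of_int (k $ s)) * fourier_basis k x)"
proof (induction "is")
  case (Cons s "is")
  then show ?case
    by (simp only: partials.simps partial_fourier_basis list.map prod_list.Cons) (simp add: mult_ac)
qed simp

lemma test_fun_fourier_basis [simp]: "test_fun (fourier_basis k)"
proof -
  have "(\<lambda>x. c * fourier_basis k x) differentiable (at x)" for c and x :: "real ^ 'a"
    using has_derivative_mult_right[OF has_derivative_fourier_basis] differentiable_def by blast
  then show ?thesis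
    by (simp add: test_fun_def partials_fourier_basis fourier_basis_translate)
qed

lemma integrable_torus_continuous:
  fixes f :: "real ^ 'd::finite \<Rightarrow> complex"
  shows "continuous_on UNIV f \<Longrightarrow> integrable torus f"
  unfolding torus_integrable_iff cell_def
  by (rule absolutely_integrable_continuous) (rule continuous_on_subset, auto)

text \<open>A fundamental cell of the lattice may be shifted along a coordinate axis: cutting the shifted
  cell at the old boundary and moving the protruding slab back by one period gives the old cell.\<close>

lemma integral_cell_translate:
  fixes \<psi> :: "real ^ 'd::finite \<Rightarrow> complex"
  assumes per: "periodic \<psi>" and cont: "continuous_on UNIV \<psi>" and t: "0 \<le> t" "t \<le> 2 * pi"
  shows "integral cell (\<lambda>x. \<psi> (x + t *\<^sub>R axis i 1)) = integral cell \<psi>"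
proof -
  let ?e = "axis i 1 :: real ^ 'd" and ?p = "(\<chi> j. 2 * pi) :: real ^ 'd"
  have int: "\<psi> integrable_on cbox a b" for a b
    using cont continuous_on_subset integrable_continuous by blast
  have e: "?e \<in> Basis" by simp
  have inner_e: "x \<bullet> ?e = x $ i" for x by (simp add: inner_axis)
  have e_nth: "?e $ j = (if j = i then 1 else 0)" for j by (simp add: axis_def)
  have split: "integral (cbox a b) \<psi> =
      integral (cbox a b \<inter> {x. x \<bullet> ?e \<le> c}) \<psi> + integral (cbox a b \<inter> {x. c \<le> x \<bullet> ?e}) \<psi>" for a b c
    by (rule integral_split[OF int e])
  have shift: "integral (cbox a b) (\<lambda>x. \<psi> (x + c)) = integral (cbox (a + c) (b + c)) \<psi>" for a b c
    using has_integral_shift_cbox_iff[of \<psi> c _ a b] int[of "a + c" "b + c"]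
    by (metis (no_types, lifting) add.commute comp_apply ext integral_unique integrable_integral)
  have low: "cbox 0 ?p \<inter> {x. x \<bullet> ?e \<le> t} = cbox 0 (?p + (t - 2 * pi) *\<^sub>R ?e)"
    using t by (intro set_eqI) (simp add: mem_box_cart inner_e e_nth, smt (verit))
  have high: "cbox 0 ?p \<inter> {x. t \<le> x \<bullet> ?e} = cbox (t *\<^sub>R ?e) ?p"
    using t by (intro set_eqI) (simp add: mem_box_cart inner_e e_nth, smt (verit))
  have low': "cbox (t *\<^sub>R ?e) (?p + t *\<^sub>R ?e) \<inter> {x. x \<bullet> ?e \<le> 2 * pi} = cbox (t *\<^sub>R ?e) ?p"
    using t by (intro set_eqI) (simp add: mem_box_cart inner_e e_nth, smt (verit))
  have high': "cbox (t *\<^sub>R ?e) (?p + t *\<^sub>R ?e) \<inter> {x. 2 * pi \<le> x \<bullet> ?e} =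
      cbox ((2 * pi) *\<^sub>R ?e) (?p + t *\<^sub>R ?e)"
    using t by (intro set_eqI) (simp add: mem_box_cart inner_e e_nth, smt (verit))
  have "integral (cbox ((2 * pi) *\<^sub>R ?e) (?p + t *\<^sub>R ?e)) \<psi> =
        integral (cbox 0 (?p + (t - 2 * pi) *\<^sub>R ?e)) (\<lambda>x. \<psi> (x + (2 * pi) *\<^sub>R ?e))"
    by (subst shift) (simp add: algebra_simps)
  also have "(\<lambda>x. \<psi> (x + (2 * pi) *\<^sub>R ?e)) = \<psi>" using per unfolding periodic_def by auto
  finally have slab: "integral (cbox ((2 * pi) *\<^sub>R ?e) (?p + t *\<^sub>R ?e)) \<psi> =
    integral (cbox 0 (?p + (t - 2 * pi) *\<^sub>R ?e)) \<psi>" .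
  have "integral cell (\<lambda>x. \<psi> (x + t *\<^sub>R ?e)) = integral (cbox (t *\<^sub>R ?e) (?p + t *\<^sub>R ?e)) \<psi>"
    unfolding cell_def by (subst shift) simp
  also have "\<dots> = integral (cbox (t *\<^sub>R ?e) ?p) \<psi> + integral (cbox 0 (?p + (t - 2 * pi) *\<^sub>R ?e)) \<psi>"
    by (subst split[of _ _ "2 * pi"]) (simp only: low' high' slab)
  also have "\<dots> = integral cell \<psi>"
    unfolding cell_def by (subst split[of 0 ?p t]) (simp only: low high add.commute)
  finally show ?thesis .
qed

text \<open>The integral of the translates of \<open>\<psi>\<close> along an axis is constant by periodicity; its derivative,
  taken under the integral, is the integral of the partial derivative.\<close>

lemma integral_partial_eq_0:
  fixes \<psi> :: "real ^ 'd::finite \<Rightarrow> complex"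
  assumes per: "periodic \<psi>" and diff: "\<And>x. \<psi> differentiable (at x)"
    and cont': "continuous_on UNIV (partial i \<psi>)"
  shows "(\<integral>x. partial i \<psi> x \<partial>torus) = 0"
proof -
  let ?e = "axis i 1 :: real ^ 'd" and ?U = "{0..2 * pi}"
  have cont: "continuous_on UNIV \<psi>"
    using diff by (simp add: differentiable_imp_continuous_on differentiable_on_def)
  have "((\<lambda>t. integral (cbox 0 (\<chi> i. 2 * pi)) (\<lambda>x. \<psi> (x + t *\<^sub>R ?e))) has_vector_derivative
        integral (cbox 0 (\<chi> i. 2 * pi)) (\<lambda>x. partial i \<psi> (x + 0 *\<^sub>R ?e))) (at 0 within ?U)"
  proof (rule leibniz_rule_vector_derivative)
    fix t x
    have "(\<psi> has_derivative frechet_derivative \<psi> (at (x + t *\<^sub>R ?e))) (at (x + t *\<^sub>R ?e))"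
      using diff by (rule has_partial_derivative)
    moreover have "((\<lambda>t. x + t *\<^sub>R ?e) has_derivative (\<lambda>h. h *\<^sub>R ?e)) (at t within ?U)"
      by (auto intro!: derivative_eq_intros)
    ultimately have "((\<lambda>t. \<psi> (x + t *\<^sub>R ?e)) has_derivative
        (\<lambda>h. frechet_derivative \<psi> (at (x + t *\<^sub>R ?e)) (h *\<^sub>R ?e))) (at t within ?U)"
      by (rule has_derivative_compose[rotated])
    moreover have "linear (frechet_derivative \<psi> (at (x + t *\<^sub>R ?e)))"
      using diff by (rule linear_frechet_derivative)
    ultimately show "((\<lambda>t. \<psi> (x + t *\<^sub>R ?e)) has_vector_derivative partial i \<psi> (x + t *\<^sub>R ?e)) (at t within ?U)"
      unfolding has_vector_derivative_def partial_def by (simp add: linear_cmul)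
  next
    fix t
    show "(\<lambda>x. \<psi> (x + t *\<^sub>R ?e)) integrable_on cbox 0 (\<chi> i. 2 * pi)"
      by (intro integrable_continuous continuous_on_compose2[OF cont] continuous_intros) auto
  next
    show "continuous_on (?U \<times> cbox 0 (\<chi> i. 2 * pi)) (\<lambda>(t, x). partial i \<psi> (x + t *\<^sub>R ?e))"
      unfolding case_prod_beta
      by (intro continuous_on_compose2[OF cont'] continuous_intros) auto
  qed auto
  moreover have "((\<lambda>t. integral (cbox 0 (\<chi> i. 2 * pi)) (\<lambda>x. \<psi> (x + t *\<^sub>R ?e))) has_vector_derivative 0)
        (at 0 within ?U)"
  proof (rule has_vector_derivative_transform[where f = "\<lambda>_. integral cell \<psi>"])
    show "integral (cbox 0 (\<chi> i. 2 * pi)) (\<lambda>x. \<psi> (x + t *\<^sub>R ?e)) = integral cell \<psi>" if "t \<in> ?U" for t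
      using integral_cell_translate[OF per cont, of t i] that by (simp add: cell_def)
  qed auto
  ultimately have "integral cell (partial i \<psi>) = 0"
    using vector_derivative_unique_within[of "0::real" ?U] by (simp add: cell_def trivial_limit_within islimpt_Icc)
  then show ?thesis
    by (simp add: torus_integral_eq integrable_torus_continuous cont')
qed

lemma integral_partial_test_fun: "test_fun \<psi> \<Longrightarrow> (\<integral>x. partial i \<psi> x \<partial>torus) = 0"
  by (rule integral_partial_eq_0)
    (auto simp: test_fun_iff smooth_differentiable0 intro: smooth_continuous smooth_partial)

lemma partial_mult:
  assumes "\<phi> differentiable (at x)" "\<psi> differentiable (at x)"
  shows "partial i (\<lambda>x. \<phi> x * \<psi> x) x = \<phi> x * partial i \<psi> x + partial i \<phi> x * \<psi> x"
  by (subst partial_eqI[OF has_derivative_mult[OF has_partial_derivative has_partial_derivative]])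
    (simp_all add: assms partial_def)

text \<open>If \<open>k\<^sub>s \<noteq> 0\<close>, the exponential is a multiple of its own derivative in direction \<open>s\<close>.\<close>

lemma integral_fourier_basis:
  "(\<integral>x. fourier_basis k x \<partial>(torus :: (real ^ 'd::finite) measure)) =
     (if k = 0 then 1 / complex_of_real (basis_norm TYPE('d)) else 0)"
proof (cases "k = 0")
  case True
  have "complex_of_real (basis_norm TYPE('d)) * (2 * complex_of_real pi) ^ CARD('d) * complex_of_real (basis_norm TYPE('d)) = 1"
    using basis_norm_square[where 'd = 'd]
    by (metis (no_types, lifting) mult.assoc mult.commute of_real_1 of_real_mult of_real_numeral of_real_power)
  then show ?thesis using True
    by (simp add: fourier_basis_0 measure_torus scaleR_conv_of_real field_simps)
next
  case False
  then obtain s where s: "k $ s \<noteq> 0" by (auto simp: vec_eq_iff)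
  have "(\<integral>x. \<i> * of_int (k $ s) * fourier_basis k x \<partial>(torus :: (real ^ 'd) measure)) = 0"
    using integral_partial_test_fun[OF test_fun_fourier_basis[of k], of s] partial_fourier_basis[of s 1 k] by simp
  then show ?thesis using s False by simp
qed

lemma fourier_basis_orthonormal:
  "(\<integral>x. fourier_basis h x * fourier_basis (- k) x \<partial>(torus :: (real ^ 'd::finite) measure)) =
     (if h = k then 1 else 0)"
  by (simp add: fourier_basis_mult integral_fourier_basis)

section \<open>Uniqueness of Fourier coefficients\<close>

definition null_coeffs :: "(real ^ 'd::finite \<Rightarrow> complex) \<Rightarrow> bool" where
  "null_coeffs f \<longleftrightarrow> integrable torus f \<and> (\<forall>k. (\<integral>x. fourier_basis k x * f x \<partial>torus) = 0)"

text \<open>The multipliers that preserve the functions with vanishing coefficients form an algebra that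
  contains all exponentials. This replaces the algebra of trigonometric polynomials, and closure under
  products is immediate.\<close>

definition preserves_null :: "(real ^ 'd::finite \<Rightarrow> complex) \<Rightarrow> bool" where
  "preserves_null g \<longleftrightarrow> (\<forall>f. null_coeffs f \<longrightarrow> null_coeffs (\<lambda>x. g x * f x))"

lemma null_coeffs_add:
  assumes "null_coeffs f" "null_coeffs g"
  shows "null_coeffs (\<lambda>x. f x + g x)"
proof -
  have "integrable torus (\<lambda>x. fourier_basis k x * f x)" "integrable torus (\<lambda>x. fourier_basis k x * g x)" for k
    using assms integrable_mult_test_fun[OF _ test_fun_fourier_basis, of _ k]
    by (auto simp: null_coeffs_def mult.commute[of "fourier_basis k _"])
  then show ?thesis using assms by (simp add: null_coeffs_def algebra_simps)
qed

lemma null_coeffs_cmult: "null_coeffs f \<Longrightarrow> null_coeffs (\<lambda>x. c * f x)"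
  unfolding null_coeffs_def by (simp add: mult.left_commute[of _ c])

lemma preserves_null_const: "preserves_null (\<lambda>x. c)"
  by (simp add: preserves_null_def null_coeffs_cmult)

lemma preserves_null_add:
  "preserves_null g \<Longrightarrow> preserves_null h \<Longrightarrow> preserves_null (\<lambda>x. g x + h x)"
  by (simp add: preserves_null_def null_coeffs_add algebra_simps)

lemma preserves_null_mult:
  "preserves_null g \<Longrightarrow> preserves_null h \<Longrightarrow> preserves_null (\<lambda>x. g x * h x)"
  by (simp add: preserves_null_def mult.assoc)

lemma preserves_null_sum:
  "(\<And>i. i \<in> A \<Longrightarrow> preserves_null (g i)) \<Longrightarrow> preserves_null (\<lambda>x. \<Sum>i\<in>A. g i x)"
  by (induction A rule: infinite_finite_induct) (auto simp: preserves_null_const preserves_null_add)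

lemma preserves_null_fourier_basis: "preserves_null (fourier_basis k)"
  for k :: "int ^ 'd::finite"
  unfolding preserves_null_def null_coeffs_def
proof (intro allI impI conjI; elim conjE)
  fix f :: "real ^ 'd \<Rightarrow> complex" and h
  assume f: "integrable torus f" "\<forall>k. (\<integral>x. fourier_basis k x * f x \<partial>torus) = 0"
  show "integrable torus (\<lambda>x. fourier_basis k x * f x)"
    using integrable_mult_test_fun[OF f(1) test_fun_fourier_basis, of k] by (simp add: mult.commute)
  show "(\<integral>x. fourier_basis h x * (fourier_basis k x * f x) \<partial>torus) = 0"
    using f(2) by (simp add: mult.assoc[symmetric] fourier_basis_mult) (simp add: mult.assoc)
qed

text \<open>Embeds the torus as a compact subset of \<open>\<complex>\<^sup>d\<close>, where the Stone--Weierstrass theorem applies.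
  Linear coordinates become cosines and sines.\<close>

definition torus_point :: "real ^ 'd \<Rightarrow> complex ^ 'd::finite" where
  "torus_point x = (\<chi> i. cis (x $ i))"

lemma continuous_torus_point: "continuous_on A torus_point"
  unfolding torus_point_def by (intro continuous_intros)

lemma preserves_null_cis:
  "preserves_null (\<lambda>x. cis (x $ i))" "preserves_null (\<lambda>x. cis (- (x $ i)))"
proof -
  let ?c = "complex_of_real (basis_norm TYPE('a))"
  have ph: "phase (axis i 1) x = x $ i" "phase (- axis i 1) x = - (x $ i)" for x :: "real ^ 'a"
    by (simp_all add: phase_def axis_def if_distrib if_distribR sum.delta' sum_negf cong: if_cong)
  have "(\<lambda>x. cis (x $ i)) = (\<lambda>x. (1 / ?c) * fourier_basis (axis i 1) x)"
       "(\<lambda>x. cis (- (x $ i))) = (\<lambda>x. (1 / ?c) * fourier_basis (- axis i 1) x)"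
    by (simp_all add: fourier_basis_phase ph cis_conv_exp)
  then show "preserves_null (\<lambda>x. cis (x $ i))" "preserves_null (\<lambda>x. cis (- (x $ i)))"
    by (simp_all only: preserves_null_mult preserves_null_const preserves_null_fourier_basis)
qed

lemma preserves_null_polynomial:
  fixes P :: "complex ^ 'd::finite \<Rightarrow> real"
  assumes "real_polynomial_function P"
  shows "preserves_null (\<lambda>x. complex_of_real (P (torus_point x)))"
  using assms
proof induction
  case (linear L)
  have decomp: "L z = (\<Sum>i\<in>UNIV. Re (z $ i) * L (axis i 1) + Im (z $ i) * L (axis i \<i>))" for z
  proof -
    have "z = (\<Sum>i\<in>UNIV. Re (z $ i) *\<^sub>R axis i 1 + Im (z $ i) *\<^sub>R axis i \<i>)"
    proof (rule vec_eq_iff[THEN iffD2], rule allI)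
      fix j
      have "(\<Sum>i\<in>UNIV. Re (z $ i) *\<^sub>R axis i 1 + Im (z $ i) *\<^sub>R axis i \<i>) $ j =
        (\<Sum>i\<in>UNIV. if i = j then Re (z $ i) *\<^sub>R 1 + Im (z $ i) *\<^sub>R \<i> else 0)"
        unfolding sum_component by (rule sum.cong) (auto simp: axis_def)
      then show "z $ j = (\<Sum>i\<in>UNIV. Re (z $ i) *\<^sub>R axis i 1 + Im (z $ i) *\<^sub>R axis i \<i>) $ j"
        by (simp add: complex_eq_iff sum.delta)
    qed
    then have "L z = L (\<Sum>i\<in>UNIV. Re (z $ i) *\<^sub>R axis i 1 + Im (z $ i) *\<^sub>R axis i \<i>)" by simp
    also have "\<dots> = (\<Sum>i\<in>UNIV. Re (z $ i) * L (axis i 1) + Im (z $ i) * L (axis i \<i>))"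
      using bounded_linear.linear[OF linear] by (simp add: linear_sum linear_add linear_scale)
    finally show ?thesis .
  qed
  have "complex_of_real (L (torus_point x)) = (\<Sum>i\<in>UNIV.
      Complex (L (axis i 1) / 2) (- L (axis i \<i>) / 2) * cis (x $ i) +
      Complex (L (axis i 1) / 2) (L (axis i \<i>) / 2) * cis (- (x $ i)))" for x
    unfolding decomp[of "torus_point x"] of_real_sum
    by (rule sum.cong) (simp_all add: torus_point_def complex_eq_iff)
  then show ?case
    by (simp only:) (intro preserves_null_sum preserves_null_add preserves_null_mult
      preserves_null_const preserves_null_cis)
next
  case (const c)
  show ?case by (rule preserves_null_const)
next
  case (add P Q)
  then show ?case by (simp add: preserves_null_add)
next
  case (mult P Q)
  then show ?case by (simp add: preserves_null_mult)
qed

lemma null_coeffs_integral_0: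
  fixes f :: "real ^ 'd::finite \<Rightarrow> complex"
  assumes "null_coeffs f" shows "(\<integral>x. f x \<partial>torus) = 0"
  using assms[unfolded null_coeffs_def, THEN conjunct2, THEN spec, of 0]
  by (simp add: fourier_basis_0)

lemma compact_torus_range: "compact (range (torus_point :: real ^ 'd::finite \<Rightarrow> _))"
proof -
  let ?p = "torus_point :: real ^ 'd \<Rightarrow> _"
  have "range ?p \<subseteq> ?p ` cell"
  proof
    fix z assume "z \<in> range ?p"
    then obtain x :: "real ^ 'd" where x: "z = torus_point x" by auto
    have "periodic (torus_point :: real ^ 'd \<Rightarrow> _)"
      by (auto simp: periodic_def torus_point_def vec_eq_iff axis_def simp flip: cis_mult)
    then obtain y where "y \<in> cell" "torus_point y = torus_point x"
      using periodic_cell_representative[of x] by metis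
    with x show "z \<in> ?p ` cell" by (metis imageI)
  qed
  then have "range ?p = ?p ` cell" by auto
  then show ?thesis
    by (simp add: compact_continuous_image continuous_torus_point cell_def)
qed

text \<open>Real polynomials on the embedded torus preserve the vanishing of coefficients and are uniformly
  dense in the continuous functions.\<close>

lemma null_coeffs_continuous:
  fixes g :: "complex ^ 'd::finite \<Rightarrow> real"
  assumes f: "null_coeffs f" and g: "continuous_on UNIV g"
  shows "(\<integral>x. complex_of_real (g (torus_point x)) * f x \<partial>torus) = 0"
proof -
  have int_f: "integrable torus f" using f by (simp add: null_coeffs_def)
  have cont: "continuous_on UNIV (\<lambda>x :: real ^ 'd. complex_of_real (g (torus_point x)))"
    by (intro continuous_intros continuous_on_compose2[OF g] continuous_torus_point) auto
  have "compact ((\<lambda>x. complex_of_real (g x)) ` range torus_point)"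
    by (intro compact_continuous_image continuous_intros compact_torus_range
        continuous_on_subset[OF g]) auto
  then obtain B where B: "\<And>x :: real ^ 'd. norm (complex_of_real (g (torus_point x))) \<le> B"
    by (metis (no_types, lifting) bounded_iff compact_imp_bounded image_eqI rangeI)
  have int_g: "integrable torus (\<lambda>x. complex_of_real (g (torus_point x)) * f x)"
    using integrable_torus_mult[OF int_f measurable_torus_continuous[OF cont] B]
    by (simp add: mult.commute)
  have "norm (\<integral>x. complex_of_real (g (torus_point x)) * f x \<partial>torus) \<le> e * (\<integral>x. norm (f x) \<partial>torus)"
    if e: "e > 0" for e
  proof -
    obtain P where P: "real_polynomial_function P"
      and gP: "\<And>z. z \<in> range torus_point \<Longrightarrow> \<bar>g z - P z\<bar> < e"
      using Stone_Weierstrass_real_polynomial_function[OF compact_torus_range continuous_on_subset[OF g] e] by auto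
    have nP: "null_coeffs (\<lambda>x. complex_of_real (P (torus_point x)) * f x)"
      using preserves_null_polynomial[OF P] f by (simp add: preserves_null_def)
    hence int_P: "integrable torus (\<lambda>x. complex_of_real (P (torus_point x)) * f x)"
      by (simp add: null_coeffs_def)
    have "(\<integral>x. complex_of_real (g (torus_point x)) * f x \<partial>torus) =
      (\<integral>x. complex_of_real (g (torus_point x)) * f x - complex_of_real (P (torus_point x)) * f x \<partial>torus)"
      using null_coeffs_integral_0[OF nP] int_g int_P by simp
    also have "norm \<dots> \<le> (\<integral>x. e * norm (f x) \<partial>torus)"
    proof (rule Bochner_Integration.integral_norm_bound_integral)
      fix x :: "real ^ 'd"
      have "norm (complex_of_real (g (torus_point x)) * f x - complex_of_real (P (torus_point x)) * f x)
          = \<bar>g (torus_point x) - P (torus_point x)\<bar> * norm (f x)"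
        by (simp flip: left_diff_distrib of_real_diff add: norm_mult)
      also have "\<dots> \<le> e * norm (f x)" using gP[of "torus_point x"] by (intro mult_right_mono) auto
      finally show "norm (complex_of_real (g (torus_point x)) * f x -
        complex_of_real (P (torus_point x)) * f x) \<le> e * norm (f x)" .
    qed (use int_g int_P int_f in auto)
    finally show ?thesis by simp
  qed
  note bound = this
  have nn: "0 \<le> (\<integral>x. norm (f x) \<partial>torus)" by simp
  have frac: "a / (a + 1) \<le> 1" if "0 \<le> a" for a :: real
    using that by simp
  have "norm (\<integral>x. complex_of_real (g (torus_point x)) * f x \<partial>torus) \<le> e" if "e > 0" for e
  proof -
    let ?F = "\<integral>x. norm (f x) \<partial>torus"
    have "norm (\<integral>x. complex_of_real (g (torus_point x)) * f x \<partial>torus) \<le> e / (?F + 1) * ?F"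
      using nn that by (intro bound divide_pos_pos add_nonneg_pos) auto
    also have "\<dots> = e * (?F / (?F + 1))" by simp
    also have "\<dots> \<le> e * 1" using frac[OF nn] that by (intro mult_left_mono) auto
    also have "\<dots> = e" by simp
    finally show ?thesis .
  qed
  then have "norm (\<integral>x. complex_of_real (g (torus_point x)) * f x \<partial>torus) \<le> 0"
    by (rule dense_ge)
  then show ?thesis by (rule norm_le_zero_iff[THEN iffD1])
qed

text \<open>The continuous functions \<open>1 / (1 + n dist(z, C))\<close> decrease to the indicator of \<open>C\<close>.\<close>

lemma null_coeffs_closed:
  fixes C :: "(complex ^ 'd::finite) set"
  assumes f: "null_coeffs f" and C: "closed C"
  shows "(\<integral>x. indicator C (torus_point x) * f x \<partial>torus) = 0"
proof (cases "C = {}")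
  case False
  have int_f: "integrable torus f" using f by (simp add: null_coeffs_def)
  hence mf [measurable]: "f \<in> borel_measurable torus" by simp
  define g where "g = (\<lambda>(n::nat) z. 1 / (1 + real n * infdist z C))"
  have nz: "1 + real n * infdist z C \<noteq> 0" for n z
    using infdist_nonneg[of z C] by (smt (verit) mult_nonneg_nonneg of_nat_0_le_iff)
  have g_cont: "continuous_on UNIV (g n)" for n
    unfolding g_def by (intro continuous_intros) (use nz in auto)
  have g01: "0 \<le> g n z" "g n z \<le> 1" for n z
    using mult_nonneg_nonneg[OF of_nat_0_le_iff[of n] infdist_nonneg[of z C]]
    by (simp_all add: g_def divide_le_eq_1_pos)
  have mg: "(\<lambda>x. complex_of_real (g n (torus_point x))) \<in> borel_measurable torus" for n
    by (intro measurable_torus_continuous continuous_intros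
        continuous_on_compose2[OF g_cont] continuous_torus_point) auto
  have lim: "(\<lambda>n. g n z) \<longlonglongrightarrow> indicator C z" for z
  proof (cases "z \<in> C")
    case True
    then show ?thesis by (simp add: g_def)
  next
    case zC: False
    hence "infdist z C > 0"
      using C False by (metis in_closed_iff_infdist_zero infdist_nonneg less_eq_real_def)
    hence "(\<lambda>n. 1 / (1 + real n * infdist z C)) \<longlonglongrightarrow> 0"
      by (intro real_tendsto_divide_at_top[OF tendsto_const]
          filterlim_tendsto_add_at_top[OF tendsto_const]
          filterlim_at_top_mult_tendsto_pos[OF tendsto_const] filterlim_real_sequentially)
    thus ?thesis using zC by (simp add: g_def)
  qed
  have mi: "(\<lambda>x. indicator C (torus_point x) * f x) \<in> borel_measurable torus"
  proof (rule borel_measurable_LIMSEQ_metric)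
    fix n show "(\<lambda>x. complex_of_real (g n (torus_point x)) * f x) \<in> borel_measurable torus"
      using mg[of n] mf by (rule borel_measurable_times)
  next
    fix x
    have "(\<lambda>n. complex_of_real (g n (torus_point x)) * f x) \<longlonglongrightarrow>
        complex_of_real (indicator C (torus_point x)) * f x"
      by (intro tendsto_intros lim)
    thus "(\<lambda>n. complex_of_real (g n (torus_point x)) * f x) \<longlonglongrightarrow> indicator C (torus_point x) * f x"
      by (simp add: of_real_indicator)
  qed
  have "(\<lambda>n. \<integral>x. complex_of_real (g n (torus_point x)) * f x \<partial>torus) \<longlonglongrightarrow>
      (\<integral>x. indicator C (torus_point x) * f x \<partial>torus)"
  proof (rule integral_dominated_convergence[where w = "\<lambda>x. norm (f x)"])
    show "AE x in torus. (\<lambda>n. complex_of_real (g n (torus_point x)) * f x)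
        \<longlonglongrightarrow> indicator C (torus_point x) * f x"
    proof (rule AE_I2)
      fix x
      have "(\<lambda>n. complex_of_real (g n (torus_point x)) * f x) \<longlonglongrightarrow>
          complex_of_real (indicator C (torus_point x)) * f x"
        by (intro tendsto_intros lim)
      thus "(\<lambda>n. complex_of_real (g n (torus_point x)) * f x) \<longlonglongrightarrow> indicator C (torus_point x) * f x"
        by (simp add: of_real_indicator)
    qed
    show "AE x in torus. norm (complex_of_real (g n (torus_point x)) * f x) \<le> norm (f x)" for n
      using g01 by (intro AE_I2) (simp add: norm_mult mult_left_le_one_le)
    show "(\<lambda>x. complex_of_real (g n (torus_point x)) * f x) \<in> borel_measurable torus" for n
      using mg[of n] mf by (rule borel_measurable_times)
  qed (use mi int_f in auto)
  moreover have "(\<integral>x. complex_of_real (g n (torus_point x)) * f x \<partial>torus) = 0" for n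
    using f g_cont by (rule null_coeffs_continuous)
  ultimately show ?thesis by (simp add: LIMSEQ_const_iff)
qed simp

abbreviation open_cell :: "(real ^ 'd::finite) set" where
  "open_cell \<equiv> box 0 (\<chi> i. 2 * pi)"

lemma sets_torus_iff: "A \<in> sets torus \<longleftrightarrow> A \<subseteq> cell \<and> A \<in> sets lebesgue"
  unfolding torus_def by (simp add: sets_restrict_space_iff)

lemma torus_point_inj: "inj_on torus_point (open_cell :: (real ^ 'd::finite) set)"
proof (rule inj_onI)
  fix x y :: "real ^ 'd" assume xy: "x \<in> open_cell" "y \<in> open_cell" "torus_point x = torus_point y"
  show "x = y"
  proof (rule vec_eq_iff[THEN iffD2], rule allI)
    fix i
    have r: "0 < x $ i" "x $ i < 2 * pi" "0 < y $ i" "y $ i < 2 * pi"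
      using xy by (auto simp: mem_box_cart)
    have "exp (\<i> * of_real (x $ i)) = exp (\<i> * of_real (y $ i))"
      using xy(3) by (simp add: torus_point_def vec_eq_iff cis_conv_exp)
    then obtain n :: int where "\<i> * of_real (x $ i) = \<i> * of_real (y $ i) + (of_int (2 * n) * pi) * \<i>"
      by (auto simp: exp_eq)
    hence n: "x $ i = y $ i + of_int (2 * n) * pi" by (simp add: complex_eq_iff)
    have "\<bar>of_int (2 * n) * pi\<bar> < 2 * pi" using r n by linarith
    hence "\<bar>real_of_int n\<bar> < 1" by (simp add: abs_mult)
    hence "n = 0" by linarith
    with n show "x $ i = y $ i" by simp
  qed
qed

lemma AE_torus_open_cell: "AE x in (torus :: (real ^ 'd::finite) measure). x \<in> open_cell"
proof -
  have "negligible (cell - open_cell :: (real ^ 'd) set)"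
    unfolding cell_def by (rule negligible_frontier_interval)
  then have "cell - open_cell \<in> null_sets (lebesgue_on (cell :: (real ^ 'd) set))"
    by (subst null_sets_restrict_space) (auto simp: negligible_iff_null_sets)
  then show ?thesis
    unfolding torus_def by (rule AE_I') auto
qed

lemma compact_in_torus: "compact K \<Longrightarrow> K \<subseteq> open_cell \<Longrightarrow> K \<in> sets torus"
  using box_subset_cbox[of "0 :: real ^ 'a" "\<chi> i. 2 * pi"]
  by (auto simp: sets_torus_iff cell_def lmeasurable_compact fmeasurableD)

text \<open>Inside the open cell the embedding is injective, so a compact set there is the preimage of a closed
  set up to the boundary of the cell, which is null.\<close>

lemma null_coeffs_compact:
  fixes K :: "(real ^ 'd::finite) set"
  assumes f: "null_coeffs f" and K: "compact K" "K \<subseteq> open_cell"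
  shows "(\<integral>x. indicator K x * f x \<partial>torus) = 0"
proof -
  have "closed (torus_point ` K)"
    by (intro compact_imp_closed compact_continuous_image continuous_torus_point K)
  from null_coeffs_closed[OF f this]
  have "(\<integral>x. indicator (torus_point ` K) (torus_point x) * f x \<partial>torus) = 0" .
  moreover have ae: "AE x in torus. indicator (torus_point ` K) (torus_point x) * f x = indicator K x * f x"
    using AE_torus_open_cell
  proof eventually_elim
    case (elim x)
    then have "torus_point x \<in> torus_point ` K \<longleftrightarrow> x \<in> K"
      by (intro inj_on_image_mem_iff[OF torus_point_inj _ K(2)])
    then show ?case by (simp add: indicator_def)
  qed
  moreover have m: "f \<in> borel_measurable torus" using f by (auto simp: null_coeffs_def)
  moreover have m1: "(\<lambda>x. indicator K x * f x) \<in> borel_measurable torus"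
  proof -
    have "K \<in> sets torus" using compact_in_torus[OF K] .
    hence "(indicator K :: _ \<Rightarrow> complex) \<in> borel_measurable torus"
      by (rule borel_measurable_indicator)
    thus ?thesis using m by (rule borel_measurable_times)
  qed
  moreover have m2: "(\<lambda>x. indicator (torus_point ` K) (torus_point x) * f x) \<in> borel_measurable torus"
  proof -
    have "torus_point \<in> torus \<rightarrow>\<^sub>M (borel :: (complex ^ 'd) measure)"
      by (rule measurable_torus_continuous[OF continuous_torus_point])
    moreover have "(indicator (torus_point ` K) :: _ \<Rightarrow> complex) \<in> borel_measurable borel"
      using \<open>closed (torus_point ` K)\<close> by (intro borel_measurable_indicator borel_closed)
    ultimately have "(\<lambda>x. indicator (torus_point ` K) (torus_point x) :: complex) \<in> borel_measurable torus"
      by (rule measurable_compose)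
    thus ?thesis using m by (rule borel_measurable_times)
  qed
  ultimately show ?thesis using integral_cong_AE[OF m2 m1 ae] by simp
qed

text \<open>If \<open>u > 0\<close> held on a set of positive measure, it would hold on a compact subset of positive
  measure, over which the integral of \<open>u\<close> could not vanish.\<close>

lemma AE_nonpos_if_compact_integrals_0:
  fixes u :: "real ^ 'd::finite \<Rightarrow> real"
  assumes u: "integrable torus u"
    and K: "\<And>K. compact K \<Longrightarrow> K \<subseteq> open_cell \<Longrightarrow> (\<integral>x. indicator K x * u x \<partial>torus) = 0"
  shows "AE x in torus. u x \<le> 0"
proof -
  define S where "S = {x \<in> open_cell. u x > 0}"
  have oc: "open_cell \<subseteq> (cell :: (real ^ 'd) set)" unfolding cell_def by (rule box_subset_cbox)
  have "{x \<in> space torus. u x > 0} \<in> sets torus" using u by measurable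
  hence "{x \<in> cell. u x > 0} \<in> sets lebesgue"
    unfolding torus_def by (simp add: sets_restrict_space_iff)
  hence "{x \<in> cell. u x > 0} \<inter> open_cell \<in> sets lebesgue" by (intro sets.Int) auto
  moreover have "{x \<in> cell. u x > 0} \<inter> open_cell = S" using oc by (auto simp: S_def)
  ultimately have S: "S \<in> sets lebesgue" by simp
  have "emeasure lebesgue S = 0"
  proof (rule ccontr)
    assume nz: "emeasure lebesgue S \<noteq> 0"
    have "emeasure lebesgue S \<le> emeasure lebesgue (cell :: (real ^ 'd) set)"
      using oc by (intro emeasure_mono) (auto simp: S_def)
    also have "\<dots> < \<infinity>" using cell_lmeasurable(1) by (simp add: fmeasurable_def)
    finally have fin: "emeasure lebesgue S < \<infinity>" .
    then obtain e where e: "emeasure lebesgue S = ennreal e" "e > 0"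
      using nz by (cases "emeasure lebesgue S") (auto simp: less_eq_real_def)
    obtain T where T: "closed T" "T \<subseteq> S" "emeasure lebesgue (S - T) < ennreal e"
      using sets_lebesgue_inner_closed[OF S e(2)] by metis
    have Tc: "compact T" using T(1) bounded_subset[OF bounded_box, of T] T(2)
      by (auto simp: S_def compact_eq_bounded_closed)
    have To: "T \<subseteq> open_cell" using T by (auto simp: S_def)
    have Tl: "T \<in> sets lebesgue" using T by (simp add: borel_closed)
    have Tt: "T \<in> sets torus" using Tl To oc by (auto simp: sets_torus_iff)
    have "(\<integral>x. indicator T x * u x \<partial>torus) = 0" using K Tc To by blast
    moreover have "integrable torus (\<lambda>x. indicator T x * u x)"
      using integrable_real_mult_indicator[OF Tt u] by (simp add: mult.commute)
    moreover have "AE x in torus. 0 \<le> indicator T x * u x"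
      using T by (intro AE_I2) (auto simp: S_def indicator_def)
    ultimately have "AE x in torus. indicator T x * u x = 0"
      using integral_nonneg_eq_0_iff_AE by blast
    hence "AE x in torus. x \<notin> T"
      by eventually_elim (use T in \<open>auto simp: S_def indicator_def split: if_splits\<close>)
    hence "T \<in> null_sets torus" using Tt by (subst AE_iff_null_sets) auto
    hence "T \<in> null_sets lebesgue" unfolding torus_def
      by (subst (asm) null_sets_restrict_space) auto
    hence "emeasure lebesgue (S - T) = emeasure lebesgue S"
      using S by (rule emeasure_Diff_null_set)
    with T e show False by simp
  qed
  hence "S \<in> null_sets lebesgue" using S by auto
  hence "S \<in> null_sets torus" unfolding torus_def using oc
    by (subst null_sets_restrict_space) (auto simp: S_def)
  hence "AE x in torus. x \<notin> S" by (rule AE_not_in)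
  with AE_torus_open_cell show ?thesis
    by eventually_elim (auto simp: S_def)
qed

text \<open>An integrable function with vanishing coefficients integrates to zero against every continuous
  function on the torus by the Stone--Weierstrass theorem, hence over every closed set, and then inner
  regularity leaves no room for a set of positive measure where its real or imaginary part has a sign.\<close>

theorem null_coeffs_AE_0:
  fixes f :: "real ^ 'd::finite \<Rightarrow> complex"
  assumes f: "null_coeffs f"
  shows "AE x in torus. f x = 0"
proof -
  have int: "integrable torus f" using f by (simp add: null_coeffs_def)
  have part: "AE x in torus. L (f x) \<le> 0" if L: "bounded_linear L" for L :: "complex \<Rightarrow> real"
  proof (rule AE_nonpos_if_compact_integrals_0)
    show "integrable torus (\<lambda>x. L (f x))" using int L by (simp add: integrable_bounded_linear)
    fix K :: "(real ^ 'd) set" assume K: "compact K" "K \<subseteq> open_cell"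
    have "K \<in> sets torus" using compact_in_torus[OF K] .
    hence "integrable torus (\<lambda>x. indicator K x *\<^sub>R f x)" using int by (rule integrable_mult_indicator)
    from integral_bounded_linear[OF L this]
    have "(\<integral>x. L (indicator K x *\<^sub>R f x) \<partial>torus) = L (\<integral>x. indicator K x *\<^sub>R f x \<partial>torus)" .
    also have "(\<integral>x. indicator K x *\<^sub>R f x \<partial>torus) = 0"
      using null_coeffs_compact[OF f K] by (simp add: scaleR_conv_of_real of_real_indicator)
    finally show "(\<integral>x. indicator K x * L (f x) \<partial>torus) = 0"
      using bounded_linear.linear[OF L] by (simp add: linear_scale linear_0)
  qed
  have "AE x in torus. Re (f x) \<le> 0" "AE x in torus. Im (f x) \<le> 0"
       "AE x in torus. - Re (f x) \<le> 0" "AE x in torus. - Im (f x) \<le> 0"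
    by (intro part bounded_linear_Re bounded_linear_Im bounded_linear_minus)+
  then show ?thesis by eventually_elim (simp add: complex_eq_iff)
qed

section \<open>Lattice sums\<close>

lemma lnorm_nonneg [simp]: "0 \<le> lnorm k"
  by (simp add: lnorm_def)

lemma lnorm_0 [simp]: "lnorm (0 :: int ^ 'd::finite) = 0"
  by (simp add: lnorm_def zero_vec_def[symmetric])

lemma component_le_lnorm: "\<bar>real_of_int (k $ i)\<bar> \<le> lnorm k"
  for k :: "int ^ 'd::finite"
  using component_le_norm_cart[of "\<chi> i. real_of_int (k $ i)" i] by (simp add: lnorm_def)

lemma lnorm_ge_1: "k \<noteq> 0 \<Longrightarrow> 1 \<le> lnorm k"
  for k :: "int ^ 'd::finite"
proof -
  assume "k \<noteq> 0"
  then obtain i where "k $ i \<noteq> 0" by (auto simp: vec_eq_iff)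
  hence "1 \<le> \<bar>real_of_int (k $ i)\<bar>" by linarith
  thus ?thesis using component_le_lnorm[of k i] by linarith
qed

lemma lnorm_minus [simp]: "lnorm (- k) = lnorm k"
proof -
  have "(\<chi> i. real_of_int ((- k) $ i)) = - (\<chi> i. real_of_int (k $ i))" by (simp add: vec_eq_iff)
  then show ?thesis unfolding lnorm_def by (metis norm_minus_cancel)
qed

lemma lnorm_diff_commute: "lnorm (k - h) = lnorm (h - k)"
  by (metis lnorm_minus minus_diff_eq)

lemma summable_on_int_powr:
  assumes "q > 1"
  shows "(\<lambda>n::int. (1 + \<bar>real_of_int n\<bar>) powr (- q)) summable_on UNIV"
proof -
  let ?g = "\<lambda>n::int. (1 + \<bar>real_of_int n\<bar>) powr (- q)"
  have s: "summable (\<lambda>n. real n powr (- q))" using assms by (simp add: summable_real_powr_iff)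
  have s1: "(\<lambda>n::nat. (1 + real n) powr (- q)) summable_on UNIV"
    using summable_ignore_initial_segment[OF s, of 1]
    by (subst summable_on_UNIV_nonneg_real_iff) (auto simp: add.commute)
  have s2: "(\<lambda>n::nat. (2 + real n) powr (- q)) summable_on UNIV"
    using summable_ignore_initial_segment[OF s, of 2]
    by (subst summable_on_UNIV_nonneg_real_iff) (auto simp: add.commute)
  have "?g summable_on range int"
    using s1 by (subst summable_on_reindex) (auto simp: o_def)
  moreover have "?g summable_on range (\<lambda>n. - int (Suc n))"
    using s2 by (subst summable_on_reindex) (auto simp: o_def inj_def algebra_simps)
  ultimately have "?g summable_on (range int \<union> range (\<lambda>n. - int (Suc n)))"
    by (rule summable_on_Un_disjoint) auto
  moreover have "range int \<union> range (\<lambda>n. - int (Suc n)) = UNIV"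
  proof (intro UNIV_eq_I[symmetric])
    fix z :: int
    show "z \<in> range int \<union> range (\<lambda>n. - int (Suc n))" by (cases z rule: int_cases) auto
  qed
  ultimately show ?thesis by simp
qed

text \<open>Since \<open>1 + \<bar>k\<^sub>i\<bar> \<le> 2\<bar>k\<bar>\<close> for every coordinate of a nonzero \<open>k\<close>, the summand is dominated by a
  product of one-dimensional ones, each with the exponent \<open>p / d > 1\<close>.\<close>

lemma lattice_summable:
  assumes p: "p > real CARD('d::finite)"
  shows "(\<lambda>k :: int ^ 'd. lnorm k powr (- p)) summable_on (UNIV - {0})"
proof (rule nonneg_bdd_above_summable_on)
  define q where "q = p / real CARD('d)"
  have cpos: "real CARD('d) > 0" by simp
  have q: "q > 1" using p cpos by (simp add: q_def)
  define g where "g = (\<lambda>n::int. (1 + \<bar>real_of_int n\<bar>) powr (- q))"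
  have g0: "0 \<le> g n" for n by (simp add: g_def)
  have gs: "g summable_on UNIV" unfolding g_def using q by (rule summable_on_int_powr)
  show "bdd_above (sum (\<lambda>k :: int ^ 'd. lnorm k powr (- p)) ` {F. F \<subseteq> UNIV - {0} \<and> finite F})"
  proof (rule bdd_aboveI2)
    fix F :: "(int ^ 'd) set" assume F: "F \<in> {F. F \<subseteq> UNIV - {0} \<and> finite F}"
    define B where "B = (\<Union>k\<in>F. range (\<lambda>i. k $ i))"
    have finB: "finite B" using F by (auto simp: B_def)
    have bound: "lnorm k powr (- p) \<le> 2 powr p * (\<Prod>i\<in>UNIV. g (k $ i))" if "k \<in> F" for k
    proof -
      have L: "1 \<le> lnorm k" using that F lnorm_ge_1[of k] by auto
      have "(2 * lnorm k) powr (- q) \<le> g (k $ i)" for i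
        unfolding g_def
      proof (rule powr_mono2')
        show "1 + \<bar>real_of_int (k $ i)\<bar> \<le> 2 * lnorm k"
          using L component_le_lnorm[of k i] by linarith
      qed (use q in auto)
      hence "(\<Prod>i\<in>(UNIV::'d set). (2 * lnorm k) powr (- q)) \<le> (\<Prod>i\<in>UNIV. g (k $ i))"
        by (intro prod_mono) auto
      also have "(\<Prod>i\<in>(UNIV::'d set). (2 * lnorm k) powr (- q)) = (2 * lnorm k) powr (- p)"
        using L cpos by (simp add: powr_realpow[symmetric] powr_powr q_def)
      also have "\<dots> = 2 powr (- p) * lnorm k powr (- p)" using L by (simp add: powr_mult)
      finally have "2 powr p * (2 powr (- p) * lnorm k powr (- p)) \<le> 2 powr p * (\<Prod>i\<in>UNIV. g (k $ i))"
        by (intro mult_left_mono) auto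
      then show ?thesis by (simp add: mult.assoc[symmetric] powr_add[symmetric])
    qed
    have "(\<Sum>k\<in>F. lnorm k powr (- p)) \<le> (\<Sum>k\<in>F. 2 powr p * (\<Prod>i\<in>UNIV. g (k $ i)))"
      by (intro sum_mono bound)
    also have "\<dots> = 2 powr p * (\<Sum>k\<in>F. \<Prod>i\<in>UNIV. g (k $ i))" by (simp add: sum_distrib_left)
    also have "(\<Sum>k\<in>F. \<Prod>i\<in>UNIV. g (k $ i)) = (\<Sum>f\<in>vec_nth ` F. \<Prod>i\<in>UNIV. g (f i))"
      by (subst sum.reindex) (auto simp: inj_on_def vec_nth_inject)
    also have "\<dots> \<le> (\<Sum>f\<in>PiE (UNIV :: 'd set) (\<lambda>_. B). \<Prod>i\<in>UNIV. g (f i))"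
      by (rule sum_mono2) (use finB in \<open>auto simp: B_def g0 prod_nonneg intro!: finite_PiE\<close>)
    also have "\<dots> = (\<Prod>i\<in>(UNIV :: 'd set). \<Sum>n\<in>B. g n)"
      by (rule prod_sum_PiE[symmetric]) (use finB in auto)
    also have "\<dots> \<le> (\<Prod>i\<in>(UNIV :: 'd set). infsum g UNIV)"
      by (intro prod_mono) (auto intro!: sum_nonneg g0 finite_sum_le_infsum[OF gs finB])
    finally show "(\<Sum>k\<in>F. lnorm k powr (- p)) \<le> 2 powr p * (\<Prod>i\<in>(UNIV :: 'd set). infsum g UNIV)"
      by simp
  qed
qed simp

section \<open>Boundedness of the kernel\<close>

text \<open>The smaller of \<open>\<bar>h\<bar>\<close> and \<open>\<bar>k - h\<bar>\<close> may replace both of them in the denominator, so that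
  the sum over \<open>h\<close> is at most twice a convergent lattice sum independent of \<open>k\<close>.\<close>

lemma Kfun_term_le:
  fixes h k :: "int ^ 'd::finite"
  assumes "\<omega> > 0" "h \<noteq> 0" "h \<noteq> k"
  shows "1 / (lnorm h powr (2 * \<omega>) * (lnorm (k - h))\<^sup>2) \<le>
    lnorm h powr (- (2 * \<omega> + 2)) + lnorm (k - h) powr (- (2 * \<omega> + 2))"
proof -
  let ?A = "lnorm h" and ?B = "lnorm (k - h)"
  have A: "1 \<le> ?A" and B: "1 \<le> ?B" using assms lnorm_ge_1[of h] lnorm_ge_1[of "k - h"] by auto
  have pw: "x powr (- (2 * \<omega> + 2)) = 1 / (x powr (2 * \<omega>) * x\<^sup>2)" if "1 \<le> x" for x :: real
  proof -
    have "x powr (2 * \<omega> + 2) = x powr (2 * \<omega>) * x powr 2" by (rule powr_add)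
    also have "x powr 2 = x\<^sup>2" using that by (simp add: powr_numeral)
    finally show ?thesis by (simp only: powr_minus_divide)
  qed
  show ?thesis
  proof (cases "?A \<le> ?B")
    case True
    have "1 / (?A powr (2 * \<omega>) * ?B\<^sup>2) \<le> 1 / (?A powr (2 * \<omega>) * ?A\<^sup>2)"
      using True A B by (intro divide_left_mono mult_left_mono power_mono mult_pos_pos) auto
    then show ?thesis using pw[OF A] powr_ge_zero[of ?B] by (simp add: add_increasing2)
  next
    case False
    have "1 / (?A powr (2 * \<omega>) * ?B\<^sup>2) \<le> 1 / (?B powr (2 * \<omega>) * ?B\<^sup>2)"
      using False A B assms(1) by (intro divide_left_mono mult_right_mono powr_mono2 mult_pos_pos) auto
    then show ?thesis using pw[OF B] powr_ge_zero[of ?A] by (simp add: add_increasing)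
  qed
qed

lemma Kfun_summable_bound:
  fixes k :: "int ^ 'd::finite"
  assumes w: "\<omega> > 0" "\<omega> > real CARD('d) / 2 - 1"
  shows "(\<lambda>h. 1 / (lnorm h powr (2 * \<omega>) * (lnorm (k - h))\<^sup>2)) summable_on (UNIV - {0, k})"
    and "Kfun \<omega> k \<le> 2 * (\<Sum>\<^sub>\<infinity>h\<in>UNIV - {0 :: int ^ 'd}. lnorm h powr (- (2 * \<omega> + 2)))"
proof -
  let ?z = "\<lambda>h :: int ^ 'd. lnorm h powr (- (2 * \<omega> + 2))" and ?S = "UNIV - {0, k}"
  have z: "?z summable_on (UNIV - {0})" using w by (intro lattice_summable) auto
  have im: "(\<lambda>h. k - h) ` ?S \<subseteq> UNIV - {0}" by auto
  have inj: "inj_on (\<lambda>h. k - h) ?S" by (auto simp: inj_on_def)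
  have z1: "?z summable_on ?S" using z by (rule summable_on_subset_banach) auto
  have z2: "(\<lambda>h. ?z (k - h)) summable_on ?S"
    using summable_on_reindex[OF inj, of ?z] summable_on_subset_banach[OF z im] by (simp add: o_def)
  have le: "1 / (lnorm h powr (2 * \<omega>) * (lnorm (k - h))\<^sup>2) \<le> ?z h + ?z (k - h)" if "h \<in> ?S" for h
    using Kfun_term_le[OF w(1), of h k] that by auto
  show s: "(\<lambda>h. 1 / (lnorm h powr (2 * \<omega>) * (lnorm (k - h))\<^sup>2)) summable_on ?S"
    by (rule summable_on_comparison_test[OF summable_on_add[OF z1 z2]]) (use le in auto)
  have "Kfun \<omega> k \<le> (\<Sum>\<^sub>\<infinity>h\<in>?S. ?z h + ?z (k - h))"
    unfolding Kfun_def by (rule infsum_mono[OF s summable_on_add[OF z1 z2] le])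
  also have "\<dots> = infsum ?z ?S + (\<Sum>\<^sub>\<infinity>h\<in>?S. ?z (k - h))" by (rule infsum_add[OF z1 z2])
  also have "(\<Sum>\<^sub>\<infinity>h\<in>?S. ?z (k - h)) = infsum ?z ((\<lambda>h. k - h) ` ?S)"
    using infsum_reindex[OF inj, of ?z] by (simp add: o_def)
  also have "\<dots> \<le> infsum ?z (UNIV - {0})"
    by (rule infsum_mono_neutral) (use z im summable_on_subset_banach[OF z im] in auto)
  also have "infsum ?z ?S \<le> infsum ?z (UNIV - {0})"
    by (rule infsum_mono_neutral) (use z z1 in auto)
  finally show "Kfun \<omega> k \<le> 2 * infsum ?z (UNIV - {0})" by simp
qed

text \<open>The supremum of the kernel is an upper bound because the kernel is bounded.\<close>

lemma Kfun_le_of_SUP: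
  fixes k :: "int ^ 'd::finite"
  assumes "\<omega> > 0" "\<omega> > real CARD('d) / 2 - 1" "k \<noteq> 0" "0 \<le> K"
    and K: "1 / (2 * pi) powr (real CARD('d) / 2) *
           sqrt (SUP k \<in> UNIV - {0 :: int ^ 'd}. Kfun \<omega> k) \<le> K"
  shows "(basis_norm TYPE('d))\<^sup>2 * Kfun \<omega> k \<le> K\<^sup>2"
proof -
  let ?S = "SUP k \<in> UNIV - {0 :: int ^ 'd}. Kfun \<omega> k"
  have bdd: "bdd_above (Kfun \<omega> ` (UNIV - {0 :: int ^ 'd}))"
    using Kfun_summable_bound(2)[OF assms(1,2)] by (intro bdd_aboveI2) blast
  have le: "Kfun \<omega> k \<le> ?S" using assms(3) by (intro cSUP_upper bdd) auto
  have nn: "0 \<le> Kfun \<omega> k" unfolding Kfun_def by (intro infsum_nonneg) auto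
  have "basis_norm TYPE('d) = 1 / (2 * pi) powr (real CARD('d) / 2)"
    by (simp add: basis_norm_def powr_minus_divide)
  hence "basis_norm TYPE('d) * sqrt ?S \<le> K" using K by simp
  hence "(basis_norm TYPE('d) * sqrt ?S)\<^sup>2 \<le> K\<^sup>2"
    by (rule power_mono) (use nn le in \<open>auto simp: basis_norm_def\<close>)
  hence "(basis_norm TYPE('d))\<^sup>2 * ?S \<le> K\<^sup>2" using nn le by (simp add: power_mult_distrib)
  moreover have "(basis_norm TYPE('d))\<^sup>2 * Kfun \<omega> k \<le> (basis_norm TYPE('d))\<^sup>2 * ?S"
    using le by (rule mult_left_mono) simp
  ultimately show ?thesis by linarith
qed

section \<open>Fourier series of test functions and of distributions\<close>

definition fourier_coeff :: "(real ^ 'd::finite \<Rightarrow> complex) \<Rightarrow> int ^ 'd \<Rightarrow> complex" where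
  "fourier_coeff f k = (\<integral>x. f x * fourier_basis (- k) x \<partial>torus)"

definition test_norm :: "nat \<Rightarrow> (real ^ 'd::finite \<Rightarrow> complex) \<Rightarrow> real" where
  "test_norm N \<phi> = (\<Sum>is | length is \<le> N. SUP x. norm (partials is \<phi> x))"

lemma finite_short_lists: "finite {is :: 'd::finite list. length is \<le> N}"
  using finite_lists_length_le[of "UNIV :: 'd set" N] by simp

lemma SUP_partials_nonneg: "test_fun \<phi> \<Longrightarrow> 0 \<le> (SUP x. norm (partials is \<phi> x))"
  by (intro test_fun_SUP_nonneg test_fun_partials)

lemma test_norm_nonneg: "test_fun \<phi> \<Longrightarrow> 0 \<le> test_norm N \<phi>"
  unfolding test_norm_def by (intro sum_nonneg SUP_partials_nonneg)

lemma SUP_partials_le_test_norm: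
  "test_fun \<phi> \<Longrightarrow> length is \<le> N \<Longrightarrow> (SUP x. norm (partials is \<phi> x)) \<le> test_norm N \<phi>"
  unfolding test_norm_def
  by (rule member_le_sum[where f = "\<lambda>is. SUP x. norm (partials is \<phi> x)"])
    (auto intro: SUP_partials_nonneg finite_short_lists)

lemma norm_le_test_norm: "test_fun \<phi> \<Longrightarrow> norm (\<phi> x) \<le> test_norm N \<phi>"
  using SUP_partials_le_test_norm[of \<phi> "[]" N] test_fun_le_SUP[of \<phi> x] by simp

text \<open>Integration by parts: the derivative of the product with the exponential has integral zero.\<close>

lemma fourier_coeff_partial:
  fixes \<phi> :: "real ^ 'd::finite \<Rightarrow> complex"
  assumes \<phi>: "test_fun \<phi>"
  shows "fourier_coeff (partial i \<phi>) k = \<i> * of_int (k $ i) * fourier_coeff \<phi> k"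
proof -
  let ?e = "fourier_basis (- k) :: real ^ 'd \<Rightarrow> complex"
  have d: "\<phi> differentiable (at x)" "?e differentiable (at x)" for x
    using \<phi> test_fun_fourier_basis[of "- k"] by (auto simp: test_fun_iff smooth_differentiable0)
  have p: "partial i (\<lambda>x. \<phi> x * ?e x) =
      (\<lambda>x. \<phi> x * (- (\<i> * of_int (k $ i)) * ?e x) + partial i \<phi> x * ?e x)"
    using partial_mult[OF d] partial_fourier_basis[of i 1 "- k"] by (auto simp: fun_eq_iff)
  have "(\<integral>x. partial i (\<lambda>x. \<phi> x * ?e x) x \<partial>torus) = 0"
  proof (rule integral_partial_eq_0)
    show "periodic (\<lambda>x. \<phi> x * ?e x)"
      using \<phi> test_fun_fourier_basis[of "- k"] by (auto simp: test_fun_iff periodic_def)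
    show "(\<lambda>x. \<phi> x * ?e x) differentiable (at x)" for x using d by (rule differentiable_mult)
    show "continuous_on UNIV (partial i (\<lambda>x. \<phi> x * ?e x))" unfolding p
      by (intro continuous_intros test_fun_continuous \<phi> test_fun_partial test_fun_fourier_basis)
  qed
  moreover have "integrable torus (\<lambda>x. partial i \<phi> x * ?e x)" "integrable torus (\<lambda>x. \<phi> x * ?e x)"
    by (intro integrable_mult_test_fun integrable_test_fun test_fun_partial \<phi> test_fun_fourier_basis)+
  ultimately have "- (\<i> * of_int (k $ i)) * fourier_coeff \<phi> k + fourier_coeff (partial i \<phi>) k = 0"
    unfolding p fourier_coeff_def by (simp add: mult.left_commute[of "\<phi> _"])
  then show ?thesis by (simp add: algebra_simps)
qed

lemma fourier_coeff_partials:
  "test_fun \<phi> \<Longrightarrow> fourier_coeff (partials is \<phi>) k = (\<Prod>s\<leftarrow>is. \<i> * of_int (k $ s)) * fourier_coeff \<phi> k"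
  by (induction "is") (simp_all add: fourier_coeff_partial test_fun_partials mult.assoc)

lemma norm_fourier_coeff_le_SUP:
  fixes \<phi> :: "real ^ 'd::finite \<Rightarrow> complex"
  assumes "test_fun \<phi>"
  shows "norm (fourier_coeff \<phi> k) \<le> (SUP x. norm (\<phi> x)) / basis_norm TYPE('d)"
proof -
  let ?b = "basis_norm TYPE('d)" and ?s = "SUP x. norm (\<phi> x)"
  have "norm (fourier_coeff \<phi> k) \<le> (\<integral>x. ?s * ?b \<partial>(torus :: (real ^ 'd) measure))"
    unfolding fourier_coeff_def
  proof (rule Bochner_Integration.integral_norm_bound_integral)
    show "integrable torus (\<lambda>x. \<phi> x * fourier_basis (- k) x)"
      using assms by (intro integrable_mult_test_fun integrable_test_fun test_fun_fourier_basis)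
    show "norm (\<phi> x * fourier_basis (- k) x) \<le> ?s * ?b" for x
      unfolding norm_mult norm_fourier_basis using assms by (intro mult_right_mono test_fun_le_SUP) auto
  qed auto
  also have "\<dots> = ?s / ?b"
  proof -
    have "(2 * pi) ^ CARD('d) = 1 / (?b * ?b)"
      using basis_norm_square[where 'd = 'd] by (simp add: field_simps)
    then show ?thesis by (simp add: measure_torus)
  qed
  finally show ?thesis .
qed

text \<open>The least integer power whose lattice sum converges, with an arbitrary positive value at the origin.\<close>

definition lattice_weight :: "int ^ 'd::finite \<Rightarrow> real" where
  "lattice_weight k = (if k = 0 then 1 else lnorm k powr (- (real CARD('d) + 1)))"

lemma lattice_weight_nonneg: "0 \<le> lattice_weight k"
  by (simp add: lattice_weight_def)

lemma lattice_weight_summable: "lattice_weight summable_on (UNIV :: (int ^ 'd::finite) set)"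
proof -
  have "(\<lambda>k :: int ^ 'd. lnorm k powr (- (real CARD('d) + 1))) summable_on (UNIV - {0})"
    by (rule lattice_summable) simp
  hence "lattice_weight summable_on (UNIV - {0 :: int ^ 'd})"
    by (rule summable_on_cong[THEN iffD1, rotated]) (simp add: lattice_weight_def)
  hence "lattice_weight summable_on insert 0 (UNIV - {0 :: int ^ 'd})"
    by (simp only: summable_on_insert_iff)
  moreover have "insert 0 (UNIV - {0}) = (UNIV :: (int ^ 'd) set)" by auto
  ultimately show ?thesis by (simp only:)
qed

lemma lnorm_power_le: "lnorm k ^ M \<le> real CARD('d) ^ M * (\<Sum>i\<in>UNIV. \<bar>real_of_int (k $ i)\<bar> ^ M)"
  for k :: "int ^ 'd::finite"
proof -
  obtain j where j: "\<And>i. \<bar>real_of_int (k $ i)\<bar> \<le> \<bar>real_of_int (k $ j)\<bar>"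
  proof -
    let ?f = "\<lambda>i. \<bar>real_of_int (k $ i)\<bar>"
    have "Max (range ?f) \<in> range ?f" by (intro Max_in) auto
    then obtain j where "Max (range ?f) = ?f j" by blast
    then show thesis using that[of j] Max_ge[of "range ?f"] by (metis finite finite_imageI rangeI)
  qed
  have "lnorm k \<le> (\<Sum>i\<in>UNIV. \<bar>real_of_int (k $ i)\<bar>)"
    unfolding lnorm_def using norm_le_l1_cart[of "\<chi> i. real_of_int (k $ i)"] by simp
  also have "\<dots> \<le> real CARD('d) * \<bar>real_of_int (k $ j)\<bar>"
    using sum_bounded_above[of UNIV "\<lambda>i. \<bar>real_of_int (k $ i)\<bar>"] j by simp
  finally have "lnorm k ^ M \<le> (real CARD('d) * \<bar>real_of_int (k $ j)\<bar>) ^ M"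
    by (rule power_mono) simp
  also have "\<dots> = real CARD('d) ^ M * \<bar>real_of_int (k $ j)\<bar> ^ M" by (rule power_mult_distrib)
  also have "\<dots> \<le> real CARD('d) ^ M * (\<Sum>i\<in>UNIV. \<bar>real_of_int (k $ i)\<bar> ^ M)"
    by (intro mult_left_mono member_le_sum) auto
  finally show ?thesis .
qed

text \<open>Integrate by parts \<open>d + 1\<close> times in each coordinate direction. Of the \<open>d + 2\<close> factors \<open>d\<close> in the
  constant, \<open>d + 1\<close> compare \<open>\<bar>k\<bar>\<close> with its coordinates and one counts the directions; the summand \<open>1\<close>
  covers \<open>k = 0\<close>.\<close>

lemma fourier_coeff_decay:
  fixes C :: real
  defines "C \<equiv> (real CARD('d) ^ (CARD('d) + 2) + 1) / basis_norm TYPE('d::finite)"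
  assumes \<phi>: "test_fun (\<phi> :: real ^ 'd \<Rightarrow> complex)"
  shows "norm (fourier_coeff \<phi> k) \<le> C * test_norm (CARD('d) + 1) \<phi> * lattice_weight k"
proof -
  let ?M = "CARD('d) + 1" and ?b = "basis_norm TYPE('d)"
  let ?t = "test_norm ?M \<phi>"
  have t0: "0 \<le> ?t" using \<phi> by (rule test_norm_nonneg)
  have b0: "0 < ?b" by simp
  show ?thesis
  proof (cases "k = 0")
    case True
    have "norm (fourier_coeff \<phi> k) \<le> (SUP x. norm (\<phi> x)) / ?b" using \<phi> by (rule norm_fourier_coeff_le_SUP)
    also have "\<dots> \<le> ?t / ?b"
      using SUP_partials_le_test_norm[OF \<phi>, of "[]" ?M] b0 by (intro divide_right_mono) auto
    also have "\<dots> \<le> C * ?t" unfolding C_def using t0 b0 by (simp add: field_simps)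
    finally show ?thesis using True by (simp add: lattice_weight_def)
  next
    case False
    hence L: "1 \<le> lnorm k" by (rule lnorm_ge_1)
    have "\<bar>real_of_int (k $ i)\<bar> ^ ?M * norm (fourier_coeff \<phi> k) \<le> ?t / ?b" for i
    proof -
      have "norm (fourier_coeff (partials (replicate ?M i) \<phi>) k) = \<bar>real_of_int (k $ i)\<bar> ^ ?M * norm (fourier_coeff \<phi> k)"
        unfolding fourier_coeff_partials[OF \<phi>]
        by (simp only: map_replicate prod_list_replicate norm_mult norm_power norm_ii norm_of_int mult_1)
      moreover have "norm (fourier_coeff (partials (replicate ?M i) \<phi>) k) \<le>
          (SUP x. norm (partials (replicate ?M i) \<phi> x)) / ?b"
        by (intro norm_fourier_coeff_le_SUP test_fun_partials \<phi>)
      moreover have "\<dots> \<le> ?t / ?b"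
        using SUP_partials_le_test_norm[OF \<phi>, of "replicate ?M i" ?M] b0 by (intro divide_right_mono) auto
      ultimately show ?thesis by linarith
    qed
    hence "(\<Sum>i\<in>(UNIV :: 'd set). \<bar>real_of_int (k $ i)\<bar> ^ ?M * norm (fourier_coeff \<phi> k)) \<le>
        real CARD('d) * (?t / ?b)"
      using sum_bounded_above[of UNIV "\<lambda>i. \<bar>real_of_int (k $ i)\<bar> ^ ?M * norm (fourier_coeff \<phi> k)" "?t / ?b"] by simp
    hence s: "(\<Sum>i\<in>UNIV. \<bar>real_of_int (k $ i)\<bar> ^ ?M) * norm (fourier_coeff \<phi> k) \<le> real CARD('d) * (?t / ?b)"
      by (simp add: sum_distrib_right)
    have "lnorm k ^ ?M * norm (fourier_coeff \<phi> k) \<le>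
        real CARD('d) ^ ?M * (\<Sum>i\<in>UNIV. \<bar>real_of_int (k $ i)\<bar> ^ ?M) * norm (fourier_coeff \<phi> k)"
      by (intro mult_right_mono lnorm_power_le) simp
    also have "\<dots> \<le> real CARD('d) ^ ?M * (real CARD('d) * (?t / ?b))"
      using s by (simp only: mult.assoc) (intro mult_left_mono, auto)
    also have "\<dots> \<le> C * ?t" unfolding C_def using t0 b0 by (simp add: field_simps)
    finally have "lnorm k ^ ?M * norm (fourier_coeff \<phi> k) \<le> C * ?t" .
    moreover have "lattice_weight k = 1 / lnorm k ^ ?M"
    proof -
      have "lnorm k powr (real CARD('d) + 1) = lnorm k ^ ?M"
        using L powr_realpow[of "lnorm k" ?M] by (simp add: add.commute)
      then show ?thesis using False by (simp only: lattice_weight_def powr_minus_divide if_False)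
    qed
    moreover have "0 < lnorm k ^ ?M" using L by simp
    ultimately show ?thesis by (simp only: pos_le_divide_eq mult.commute times_divide_eq_right mult_1_right)
  qed
qed

lemma fourier_coeff_abs_summable:
  fixes \<phi> :: "real ^ 'd::finite \<Rightarrow> complex"
  assumes "test_fun \<phi>"
  shows "(\<lambda>k. norm (fourier_coeff \<phi> k)) summable_on UNIV"
  by (rule summable_on_comparison_test[OF summable_on_cmult_right[OF lattice_weight_summable]])
    (rule fourier_coeff_decay[OF assms], simp)

lemma infsum_tail_tendsto_0:
  fixes f :: "'a \<Rightarrow> real"
  assumes "f summable_on UNIV"
  shows "((\<lambda>A. infsum f (- A)) \<longlongrightarrow> 0) (finite_subsets_at_top UNIV)"
proof -
  have "(sum f \<longlongrightarrow> infsum f UNIV) (finite_subsets_at_top UNIV)"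
    using has_sum_infsum[OF assms] by (simp add: has_sum_def)
  hence "((\<lambda>A. infsum f UNIV - sum f A) \<longlongrightarrow> 0) (finite_subsets_at_top UNIV)"
    using tendsto_diff[OF tendsto_const[of "infsum f UNIV"]] by fastforce
  moreover have "eventually (\<lambda>A. infsum f UNIV - sum f A = infsum f (- A)) (finite_subsets_at_top UNIV)"
  proof (rule eventually_finite_subsets_at_top_weakI)
    fix A :: "'a set" assume "finite A"
    then show "infsum f UNIV - sum f A = infsum f (- A)"
      using infsum_Diff[OF assms, of A] by (simp add: Compl_eq_Diff_UNIV)
  qed
  ultimately show ?thesis by (simp cong: tendsto_cong)
qed

text \<open>Turns estimates against partial sums into exact identities.\<close>

lemma zero_if_le_tails:
  fixes z :: "'b::real_normed_vector" and f :: "'a \<Rightarrow> real"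
  assumes f: "f summable_on UNIV"
    and le: "\<And>A. finite A \<Longrightarrow> B \<subseteq> A \<Longrightarrow> norm z \<le> C * infsum f (- A)"
    and B: "finite B"
  shows "z = 0"
proof -
  have "((\<lambda>A. C * infsum f (- A)) \<longlongrightarrow> C * 0) (finite_subsets_at_top UNIV)"
    by (intro tendsto_intros infsum_tail_tendsto_0 f)
  moreover have "eventually (\<lambda>A. norm z \<le> C * infsum f (- A)) (finite_subsets_at_top UNIV)"
    using B le by (auto simp: eventually_finite_subsets_at_top)
  ultimately have "norm z \<le> C * 0"
    by (intro tendsto_lowerbound) auto
  then show ?thesis by simp
qed

text \<open>The open set where \<open>g\<close> is nonzero inside the cell is null, hence empty; the rest follows by
  closure and periodicity.\<close>

lemma continuous_periodic_AE_0:
  fixes g :: "real ^ 'd::finite \<Rightarrow> complex"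
  assumes per: "periodic g" and cont: "continuous_on UNIV g" and ae: "AE x in torus. g x = 0"
  shows "g x = 0"
proof -
  let ?S = "{x \<in> open_cell. g x \<noteq> 0}"
  have "open {x. g x \<noteq> 0}" using cont by (intro open_Collect_neq) auto
  hence "open (open_cell \<inter> {x. g x \<noteq> 0})" by (intro open_Int) auto
  hence op: "open ?S" by (simp add: Int_def)
  have "{x \<in> space torus. g x \<noteq> 0} \<in> null_sets torus"
  proof -
    have [measurable]: "g \<in> borel_measurable torus" using cont by (rule measurable_torus_continuous)
    have "{x \<in> space torus. g x \<noteq> 0} \<in> sets torus" by measurable
    with ae show ?thesis by (auto simp: AE_iff_null)
  qed
  hence "{x \<in> cell. g x \<noteq> 0} \<in> null_sets lebesgue"
    unfolding torus_def by (subst (asm) null_sets_restrict_space) auto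
  hence "negligible {x \<in> cell. g x \<noteq> 0}" by (simp add: negligible_iff_null_sets)
  hence "negligible ?S"
    by (rule negligible_subset) (use box_subset_cbox in \<open>auto simp: cell_def\<close>)
  hence "?S = {}" using op open_not_negligible by blast
  hence "open_cell \<subseteq> {x. g x = 0}" by auto
  moreover have "closed {x. g x = 0}" using cont by (intro closed_Collect_eq) auto
  ultimately have "closure open_cell \<subseteq> {x. g x = 0}" by (rule closure_minimal)
  moreover have "closure open_cell = (cell :: (real ^ 'd) set)"
    unfolding cell_def by (rule closure_box) (simp add: interval_ne_empty_cart)
  moreover obtain y where "y \<in> cell" "g y = g x"
    using periodic_cell_representative[of x] per by metis
  ultimately show ?thesis by auto
qed

text \<open>The absolutely convergent Fourier series has a continuous sum with the same coefficients as \<open>\<phi>\<close>.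
  By uniqueness the difference vanishes almost everywhere, hence everywhere by continuity.\<close>

theorem fourier_series_uniform:
  fixes \<phi> :: "real ^ 'd::finite \<Rightarrow> complex"
  assumes \<phi>: "test_fun \<phi>" and A: "finite A"
  shows "norm (\<phi> x - (\<Sum>k\<in>A. fourier_coeff \<phi> k * fourier_basis k x)) \<le>
     basis_norm TYPE('d) * (\<Sum>\<^sub>\<infinity>k\<in>-A. norm (fourier_coeff \<phi> k))"
proof -
  let ?b = "basis_norm TYPE('d)"
  let ?t = "\<lambda>A. \<Sum>\<^sub>\<infinity>k\<in>-A. norm (fourier_coeff \<phi> k)"
  define S where "S x = (\<Sum>\<^sub>\<infinity>k. fourier_coeff \<phi> k * fourier_basis k x)" for x
  define P where "P A x = (\<Sum>k\<in>A. fourier_coeff \<phi> k * fourier_basis k x)" for A x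
  have sm: "(\<lambda>k. norm (fourier_coeff \<phi> k)) summable_on UNIV" using \<phi> by (rule fourier_coeff_abs_summable)
  have ab: "(\<lambda>k. norm (fourier_coeff \<phi> k * fourier_basis k x)) summable_on B" for x B
    using summable_on_cmult_left[OF summable_on_subset_banach[OF sm subset_UNIV], where c = ?b]
    by (simp add: norm_mult)
  have sb: "(\<lambda>k. fourier_coeff \<phi> k * fourier_basis k x) summable_on B" for x B
    using ab by (rule abs_summable_summable)
  have rest: "norm (S x - P A x) \<le> ?b * ?t A" if "finite A" for A x
  proof -
    have "S x - P A x = (\<Sum>\<^sub>\<infinity>k\<in>-A. fourier_coeff \<phi> k * fourier_basis k x)"
      unfolding S_def P_def using infsum_Diff[OF sb[of x UNIV], of A] that
      by (simp add: Compl_eq_Diff_UNIV sb)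
    also have "norm \<dots> \<le> (\<Sum>\<^sub>\<infinity>k\<in>-A. norm (fourier_coeff \<phi> k * fourier_basis k x))"
      by (rule norm_infsum_bound[OF ab])
    also have "\<dots> = ?b * ?t A" by (simp add: norm_mult infsum_cmult_right' mult.commute)
    finally show ?thesis .
  qed
  have P_cont: "continuous_on UNIV (P A)" for A
    unfolding P_def by (intro continuous_intros test_fun_continuous test_fun_fourier_basis)
  have unif: "uniform_limit UNIV P S (finite_subsets_at_top UNIV)"
  proof (rule uniform_limitI)
    fix e :: real assume e: "0 < e"
    have "((\<lambda>A. ?b * ?t A) \<longlongrightarrow> ?b * 0) (finite_subsets_at_top UNIV)"
      by (intro tendsto_intros infsum_tail_tendsto_0 sm)
    hence "eventually (\<lambda>A. ?b * ?t A < e) (finite_subsets_at_top UNIV)"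
      using e by (intro order_tendstoD(2)) auto
    moreover have "eventually finite (finite_subsets_at_top (UNIV :: (int ^ 'd) set))"
      by (rule eventually_finite_subsets_at_top_weakI)
    ultimately show "\<forall>\<^sub>F A in finite_subsets_at_top UNIV. \<forall>x\<in>UNIV. dist (P A x) (S x) < e"
    proof eventually_elim
      case (elim A)
      show ?case
      proof
        fix x show "dist (P A x) (S x) < e"
          using rest[of A x] elim by (simp add: dist_norm norm_minus_commute)
      qed
    qed
  qed
  have S_cont: "continuous_on UNIV S"
    by (rule uniform_limit_theorem[OF _ unif]) (auto intro: P_cont always_eventually)
  have S_int: "integrable torus S" using S_cont by (rule integrable_torus_continuous)
  have P_int: "integrable torus (P A)" for A using P_cont by (rule integrable_torus_continuous)
  have P_coeff: "fourier_coeff (P A) k = fourier_coeff \<phi> k" if "finite A" "k \<in> A" for A k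
  proof -
    have e_int: "integrable torus (\<lambda>x. fourier_basis h x * fourier_basis (- k) x :: complex)"
      for h :: "int ^ 'd"
      by (intro integrable_mult_test_fun integrable_test_fun test_fun_fourier_basis)
    have "fourier_coeff (P A) k = (\<integral>x. (\<Sum>h\<in>A. fourier_coeff \<phi> h * (fourier_basis h x * fourier_basis (- k) x)) \<partial>torus)"
      unfolding fourier_coeff_def[of "P A"] P_def by (simp add: sum_distrib_right mult.assoc)
    also have "\<dots> = (\<Sum>h\<in>A. fourier_coeff \<phi> h * (\<integral>x. fourier_basis h x * fourier_basis (- k) x \<partial>(torus :: (real ^ 'd) measure)))"
      by (subst Bochner_Integration.integral_sum) (simp_all add: e_int)
    also have "\<dots> = fourier_coeff \<phi> k"
      using that by (simp add: fourier_basis_orthonormal if_distrib sum.delta cong: if_cong)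
    finally show ?thesis .
  qed
  have S_coeff: "fourier_coeff S k = fourier_coeff \<phi> k" for k
  proof -
    have "norm (fourier_coeff S k - fourier_coeff \<phi> k) \<le> (2 * pi) ^ CARD('d) * ?b * ?b * ?t A"
      if "finite A" "{k} \<subseteq> A" for A
    proof -
      have "fourier_coeff S k - fourier_coeff \<phi> k = fourier_coeff S k - fourier_coeff (P A) k" using P_coeff that by simp
      also have "\<dots> = (\<integral>x. (S x - P A x) * fourier_basis (- k) x \<partial>torus)"
        unfolding fourier_coeff_def left_diff_distrib
        by (subst Bochner_Integration.integral_diff)
          (auto intro!: integrable_mult_test_fun S_int P_int)
      also have "norm \<dots> \<le> (\<integral>x. ?b * ?t A * ?b \<partial>(torus :: (real ^ 'd) measure))"
      proof (rule Bochner_Integration.integral_norm_bound_integral)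
        show "norm ((S x - P A x) * fourier_basis (- k) x) \<le> ?b * ?t A * ?b" for x
          unfolding norm_mult norm_fourier_basis
          by (intro mult_right_mono rest that) (simp add: less_imp_le)
      qed (auto intro!: integrable_mult_test_fun S_int P_int)
      also have "\<dots> = (2 * pi) ^ CARD('d) * ?b * ?b * ?t A" by (simp add: measure_torus)
      finally show ?thesis .
    qed
    hence "fourier_coeff S k - fourier_coeff \<phi> k = 0" by (intro zero_if_le_tails[OF sm, where B = "{k}"]) auto
    then show ?thesis by simp
  qed
  have diff_int: "integrable torus (\<lambda>x. \<phi> x - S x)"
    using S_int integrable_test_fun[OF \<phi>] by (rule Bochner_Integration.integrable_diff[rotated])
  have "null_coeffs (\<lambda>x. \<phi> x - S x)"
    unfolding null_coeffs_def
  proof (intro conjI allI diff_int)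
    fix k
    have "(\<integral>x. fourier_basis k x * (\<phi> x - S x) \<partial>torus) = fourier_coeff \<phi> (- k) - fourier_coeff S (- k)"
      unfolding fourier_coeff_def right_diff_distrib mult.commute[of "fourier_basis k _"] minus_minus
      by (rule Bochner_Integration.integral_diff)
        (simp_all add: integrable_mult_test_fun integrable_test_fun \<phi> S_int)
    then show "(\<integral>x. fourier_basis k x * (\<phi> x - S x) \<partial>torus) = 0" by (simp add: S_coeff)
  qed
  hence "AE x in torus. \<phi> x - S x = 0" by (rule null_coeffs_AE_0)
  moreover have "periodic (\<lambda>x. \<phi> x - S x)"
    using \<phi> by (auto simp: test_fun_iff periodic_def S_def fourier_basis_translate)
  ultimately have "\<phi> x - S x = 0"
    by (intro continuous_periodic_AE_0 continuous_intros S_cont test_fun_continuous \<phi>)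
  then show ?thesis using rest[OF A, of x] by (simp add: P_def)
qed

lemma smooth_fourier_basis [simp]: "smooth (fourier_basis k)"
  using test_fun_fourier_basis[of k] by (simp add: test_fun_iff)

lemma test_fun_sum: "finite A \<Longrightarrow> (\<And>i. i \<in> A \<Longrightarrow> test_fun (f i)) \<Longrightarrow> test_fun (\<lambda>x. \<Sum>i\<in>A. f i x)"
proof (induction A rule: finite_induct)
  case empty
  show ?case using test_fun_cmult[OF test_fun_fourier_basis[of 0], of 0] by simp
qed (simp add: test_fun_add)

lemma partials_sum:
  fixes f :: "'i \<Rightarrow> real ^ 'd::finite \<Rightarrow> complex"
  shows "finite A \<Longrightarrow> (\<And>i. i \<in> A \<Longrightarrow> test_fun (f i)) \<Longrightarrow>
   partials is (\<lambda>x. \<Sum>i\<in>A. f i x) = (\<lambda>x. \<Sum>i\<in>A. partials is (f i) x)"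
proof (induction A rule: finite_induct)
  case empty
  show ?case using partials_cmult[of "fourier_basis (0 :: int ^ 'd)" "is" 0] by simp
next
  case (insert a A)
  then show ?case
    using partials_add[of "f a" "\<lambda>x. \<Sum>i\<in>A. f i x" "is"] test_fun_sum[of A f]
    by (simp add: test_fun_iff)
qed

lemma distribution_add:
  "distribution u \<Longrightarrow> test_fun \<phi> \<Longrightarrow> test_fun \<psi> \<Longrightarrow> u (\<lambda>x. \<phi> x + \<psi> x) = u \<phi> + u \<psi>"
  unfolding distribution_def by blast

lemma distribution_cmult: "distribution u \<Longrightarrow> test_fun \<phi> \<Longrightarrow> u (\<lambda>x. c * \<phi> x) = c * u \<phi>"
  unfolding distribution_def by blast

lemma distribution_bound:
  assumes "distribution u"
  obtains C N where "0 \<le> C" "\<And>\<phi>. test_fun \<phi> \<Longrightarrow> norm (u \<phi>) \<le> C * test_norm N \<phi>"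
proof -
  obtain C N where C: "\<And>\<phi>. test_fun \<phi> \<Longrightarrow> norm (u \<phi>) \<le> C * test_norm N \<phi>"
    using assms unfolding distribution_def test_norm_def by blast
  have "norm (u \<phi>) \<le> \<bar>C\<bar> * test_norm N \<phi>" if "test_fun \<phi>" for \<phi>
    using C[OF that] mult_right_mono[OF abs_ge_self[of C] test_norm_nonneg[OF that, of N]] by linarith
  then show thesis using that[of "\<bar>C\<bar>" N] by simp
qed

lemma distribution_sum:
  assumes u: "distribution u" and "finite A" "\<And>i. i \<in> A \<Longrightarrow> test_fun (f i)"
  shows "u (\<lambda>x. \<Sum>i\<in>A. f i x) = (\<Sum>i\<in>A. u (f i))"
  using assms(2,3)
proof (induction A rule: finite_induct)
  case empty
  show ?case using distribution_cmult[OF u test_fun_fourier_basis[of 0], of 0] by simp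
qed (simp add: distribution_add[OF u] test_fun_sum)

text \<open>Applying the uniform convergence to every derivative, the Fourier series of a test function
  converges in the topology of test functions, hence may be summed under a distribution.\<close>

theorem distribution_fourier_series:
  fixes \<phi> :: "real ^ 'd::finite \<Rightarrow> complex"
  assumes u: "distribution u" and \<phi>: "test_fun \<phi>"
  shows "((\<lambda>k. fourier_coeff \<phi> k * u (fourier_basis k)) has_sum u \<phi>) UNIV"
proof -
  obtain C N where C0: "0 \<le> C" and C: "\<And>\<phi>. test_fun \<phi> \<Longrightarrow> norm (u \<phi>) \<le> C * test_norm N \<phi>"
    using distribution_bound[OF u] by metis
  let ?b = "basis_norm TYPE('d)" and ?F = "finite_subsets_at_top (UNIV :: (int ^ 'd) set)"
  define P where "P A = (\<lambda>x. \<Sum>k\<in>A. fourier_coeff \<phi> k * fourier_basis k x)" for A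
  define R where "R A = (\<lambda>x. \<phi> x + (- 1) * P A x)" for A
  let ?t = "\<lambda>A. \<Sum>is | length is \<le> N. ?b * (\<Sum>\<^sub>\<infinity>k\<in>-A. norm (fourier_coeff (partials is \<phi>) k))"
  have tP: "test_fun (P A)" if "finite A" for A
    unfolding P_def using that by (intro test_fun_sum test_fun_cmult test_fun_fourier_basis)
  have tR: "test_fun (R A)" if "finite A" for A
    unfolding R_def by (intro test_fun_add test_fun_cmult tP \<phi> that)
  have uP: "u (P A) = (\<Sum>k\<in>A. fourier_coeff \<phi> k * u (fourier_basis k))" if "finite A" for A
    unfolding P_def using that
    by (subst distribution_sum[OF u]) (auto simp: distribution_cmult[OF u] test_fun_cmult)
  have bound: "norm (u (P A) - u \<phi>) \<le> C * ?t A" if A: "finite A" for A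
  proof -
    have uR: "u (R A) = u \<phi> + (- 1) * u (P A)"
      unfolding R_def using distribution_add[OF u \<phi> test_fun_cmult[OF tP[OF A]], of "- 1"]
        distribution_cmult[OF u tP[OF A], of "- 1"] by simp
    have "norm (u (R A)) \<le> C * test_norm N (R A)" using A by (intro C tR)
    also have "test_norm N (R A) \<le> ?t A"
      unfolding test_norm_def
    proof (rule sum_mono)
      fix "is" :: "'d list"
      have "partials is (R A) x = partials is \<phi> x -
          (\<Sum>k\<in>A. fourier_coeff (partials is \<phi>) k * fourier_basis k x)" for x
      proof -
        have sP: "smooth (P A)" and s\<phi>: "smooth \<phi>" using tP[OF A] \<phi> by (auto simp: test_fun_iff)
        have sm1: "smooth (\<lambda>x. (- 1) * P A x)"
          using test_fun_cmult[OF tP[OF A], of "- 1"] by (simp add: test_fun_iff)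
        have "partials is (P A) = (\<lambda>x. \<Sum>k\<in>A. partials is (\<lambda>x. fourier_coeff \<phi> k * fourier_basis k x) x)"
          unfolding P_def by (intro partials_sum A test_fun_cmult test_fun_fourier_basis)
        also have "\<dots> = (\<lambda>x. \<Sum>k\<in>A. fourier_coeff (partials is \<phi>) k * fourier_basis k x)"
          unfolding partials_cmult[OF smooth_fourier_basis] partials_fourier_basis fourier_coeff_partials[OF \<phi>]
          by (simp add: mult_ac)
        finally show ?thesis
          unfolding R_def partials_add[OF s\<phi> sm1] partials_cmult[OF sP] by simp
      qed
      then show "(SUP x. norm (partials is (R A) x)) \<le> ?b * (\<Sum>\<^sub>\<infinity>k\<in>-A. norm (fourier_coeff (partials is \<phi>) k))"
        using fourier_series_uniform[OF test_fun_partials[OF \<phi>] A] by (intro cSUP_least) auto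
    qed
    finally have "norm (u (R A)) \<le> C * ?t A" using C0 by (simp add: mult_left_mono)
    then show ?thesis using uR by (simp add: norm_minus_commute)
  qed
  have "((\<lambda>A. C * ?t A) \<longlongrightarrow> C * (\<Sum>is :: 'd list | length is \<le> N. ?b * 0)) ?F"
    by (intro tendsto_intros infsum_tail_tendsto_0 fourier_coeff_abs_summable test_fun_partials \<phi>)
  hence t0: "((\<lambda>A. C * ?t A) \<longlongrightarrow> 0) ?F" by simp
  have "((\<lambda>A. u (P A) - u \<phi>) \<longlongrightarrow> 0) ?F"
  proof (rule Lim_null_comparison[OF _ t0])
    show "\<forall>\<^sub>F A in ?F. norm (u (P A) - u \<phi>) \<le> C * ?t A"
      by (rule eventually_finite_subsets_at_top_weakI) (rule bound)
  qed
  hence "((\<lambda>A. u (P A)) \<longlongrightarrow> u \<phi>) ?F" by (simp add: LIM_zero_iff)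
  moreover have "eventually (\<lambda>A. u (P A) = (\<Sum>k\<in>A. fourier_coeff \<phi> k * u (fourier_basis k))) ?F"
    by (intro eventually_finite_subsets_at_top_weakI uP)
  ultimately show ?thesis unfolding has_sum_def by (simp cong: tendsto_cong)
qed

corollary distribution_eqI:
  assumes "distribution u" "distribution u'" "\<And>k. u (fourier_basis k) = u' (fourier_basis k)" "test_fun \<phi>"
  shows "u \<phi> = u' \<phi>"
  using distribution_fourier_series[OF assms(1,4)] distribution_fourier_series[OF assms(2,4)]
  by (simp add: assms(3) has_sum_unique)

section \<open>Square-summable Fourier series\<close>

definition square_integrable :: "(real ^ 'd::finite \<Rightarrow> complex) \<Rightarrow> bool" where
  "square_integrable f \<longleftrightarrow> f \<in> borel_measurable torus \<and> integrable torus (\<lambda>x. (norm (f x))\<^sup>2)"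

definition square_norm :: "(real ^ 'd::finite \<Rightarrow> complex) \<Rightarrow> real" where
  "square_norm f = (\<integral>x. (norm (f x))\<^sup>2 \<partial>torus)"

lemma square_norm_nonneg: "0 \<le> square_norm f"
  unfolding square_norm_def by simp

lemma square_integrable_measurable: "square_integrable f \<Longrightarrow> f \<in> borel_measurable torus"
  by (simp add: square_integrable_def)

lemma square_integrable_mult:
  assumes "square_integrable f" "square_integrable g"
  shows "integrable torus (\<lambda>x. f x * g x)"
proof (rule Bochner_Integration.integrable_bound)
  show "integrable torus (\<lambda>x. (norm (f x))\<^sup>2 + (norm (g x))\<^sup>2)"
    using assms by (intro Bochner_Integration.integrable_add) (auto simp: square_integrable_def)
  show "(\<lambda>x. f x * g x) \<in> borel_measurable torus"
    using assms by (intro borel_measurable_times square_integrable_measurable)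
  show "AE x in torus. norm (f x * g x) \<le> norm ((norm (f x))\<^sup>2 + (norm (g x))\<^sup>2)"
  proof (rule AE_I2)
    fix x
    have "2 * (norm (f x) * norm (g x)) \<le> (norm (f x))\<^sup>2 + (norm (g x))\<^sup>2"
      using sum_squares_bound[of "norm (f x)" "norm (g x)"] by simp
    moreover have "0 \<le> norm (f x) * norm (g x)" by simp
    ultimately have "norm (f x) * norm (g x) \<le> (norm (f x))\<^sup>2 + (norm (g x))\<^sup>2" by linarith
    then show "norm (f x * g x) \<le> norm ((norm (f x))\<^sup>2 + (norm (g x))\<^sup>2)"
      unfolding norm_mult by simp
  qed
qed

lemma square_integrable_add:
  assumes "square_integrable f" "square_integrable g"
  shows "square_integrable (\<lambda>x. f x + g x)"
  unfolding square_integrable_def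
proof
  show m: "(\<lambda>x. f x + g x) \<in> borel_measurable torus"
    using assms by (intro borel_measurable_add square_integrable_measurable)
  show "integrable torus (\<lambda>x. (norm (f x + g x))\<^sup>2)"
  proof (rule Bochner_Integration.integrable_bound)
    show "integrable torus (\<lambda>x. 2 * (norm (f x))\<^sup>2 + 2 * (norm (g x))\<^sup>2)"
      using assms by (intro Bochner_Integration.integrable_add) (auto simp: square_integrable_def)
    show "(\<lambda>x. (norm (f x + g x))\<^sup>2) \<in> borel_measurable torus" using m by measurable
    show "AE x in torus. norm ((norm (f x + g x))\<^sup>2) \<le> norm (2 * (norm (f x))\<^sup>2 + 2 * (norm (g x))\<^sup>2)"
    proof (rule AE_I2)
      fix x
      have "(norm (f x + g x))\<^sup>2 \<le> (norm (f x) + norm (g x))\<^sup>2"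
        by (intro power_mono norm_triangle_ineq) simp
      also have "\<dots> \<le> 2 * (norm (f x))\<^sup>2 + 2 * (norm (g x))\<^sup>2"
        using sum_squares_bound[of "norm (f x)" "norm (g x)"] by (simp add: power2_sum)
      finally show "norm ((norm (f x + g x))\<^sup>2) \<le> norm (2 * (norm (f x))\<^sup>2 + 2 * (norm (g x))\<^sup>2)"
        by simp
    qed
  qed
qed

lemma square_integrable_cmult: "square_integrable f \<Longrightarrow> square_integrable (\<lambda>x. c * f x)"
  by (auto simp: square_integrable_def norm_mult power_mult_distrib)

lemma square_integrable_diff:
  "square_integrable f \<Longrightarrow> square_integrable g \<Longrightarrow> square_integrable (\<lambda>x. f x - g x)"
  using square_integrable_add[of f "\<lambda>x. (- 1) * g x"] square_integrable_cmult[of g "- 1"] by simp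

lemma square_integrable_continuous: "continuous_on UNIV f \<Longrightarrow> square_integrable f"
proof -
  assume f: "continuous_on UNIV f"
  have "integrable torus (\<lambda>x. complex_of_real ((norm (f x))\<^sup>2))"
    by (intro integrable_torus_continuous continuous_intros f)
  then show ?thesis
    using f by (simp only: square_integrable_def measurable_torus_continuous complex_of_real_integrable_eq)
qed

lemma square_integrable_test_fun: "test_fun \<phi> \<Longrightarrow> square_integrable \<phi>"
  by (intro square_integrable_continuous test_fun_continuous)

lemma square_integrable_mult_fourier_basis:
  "square_integrable g \<Longrightarrow> square_integrable (\<lambda>x. g x * fourier_basis k x)"
  using test_fun_measurable[OF test_fun_fourier_basis[of k]]
  by (auto simp: square_integrable_def norm_mult power_mult_distrib)

lemma cauchy_schwarz_abs:
  assumes f: "square_integrable f" and g: "square_integrable g"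
  shows "(\<integral>x. norm (f x * g x) \<partial>torus)\<^sup>2 \<le> square_norm f * square_norm g"
proof -
  have [measurable]: "f \<in> borel_measurable torus" "g \<in> borel_measurable torus"
    using f g by (auto simp: square_integrable_def)
  have i: "integrable torus (\<lambda>x. norm (f x * g x))"
    using square_integrable_mult[OF f g] by (rule integrable_norm)
  have "(\<integral>\<^sup>+x. ennreal (norm (f x)) * ennreal (norm (g x)) \<partial>torus)\<^sup>2 \<le>
      (\<integral>\<^sup>+x. ennreal (norm (f x)) ^ 2 \<partial>torus) * (\<integral>\<^sup>+x. ennreal (norm (g x)) ^ 2 \<partial>torus)"
    by (rule Cauchy_Schwarz_nn_integral) measurable
  also have "(\<lambda>x. ennreal (norm (f x)) * ennreal (norm (g x))) = (\<lambda>x. ennreal (norm (f x * g x)))"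
    by (simp add: norm_mult ennreal_mult)
  also have "(\<integral>\<^sup>+x. ennreal (norm (f x * g x)) \<partial>torus) = ennreal (\<integral>x. norm (f x * g x) \<partial>torus)"
    by (rule nn_integral_eq_integral[OF i]) simp
  also have "(\<integral>\<^sup>+x. ennreal (norm (f x)) ^ 2 \<partial>torus) = ennreal (square_norm f)"
    using f unfolding square_norm_def ennreal_power[OF norm_ge_zero] square_integrable_def
    by (intro nn_integral_eq_integral) auto
  also have "(\<integral>\<^sup>+x. ennreal (norm (g x)) ^ 2 \<partial>torus) = ennreal (square_norm g)"
    using g unfolding square_norm_def ennreal_power[OF norm_ge_zero] square_integrable_def
    by (intro nn_integral_eq_integral) auto
  finally show ?thesis
    by (simp add: ennreal_power ennreal_mult[symmetric] square_norm_nonneg)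
qed

lemma cauchy_schwarz:
  assumes f: "square_integrable f" and g: "square_integrable g"
  shows "norm (\<integral>x. f x * g x \<partial>torus) \<le> sqrt (square_norm f * square_norm g)"
proof -
  have "norm (\<integral>x. f x * g x \<partial>torus) \<le> (\<integral>x. norm (f x * g x) \<partial>torus)"
    by (rule integral_norm_bound)
  also have "\<dots> \<le> sqrt (square_norm f * square_norm g)"
    using cauchy_schwarz_abs[OF f g] by (rule real_le_rsqrt)
  finally show ?thesis .
qed

definition fourier_sum :: "(int ^ 'd \<Rightarrow> complex) \<Rightarrow> (int ^ 'd) set \<Rightarrow> real ^ 'd::finite \<Rightarrow> complex" where
  "fourier_sum c A x = (\<Sum>k\<in>A. c k * fourier_basis k x)"

lemma continuous_fourier_sum: "continuous_on UNIV (fourier_sum c A)"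
  unfolding fourier_sum_def[abs_def]
  by (intro continuous_intros test_fun_continuous test_fun_fourier_basis)

lemma square_integrable_fourier_sum: "square_integrable (fourier_sum c A)"
  by (intro square_integrable_continuous continuous_fourier_sum)

lemma integral_fourier_sum_mult:
  assumes "square_integrable g"
  shows "(\<integral>x. fourier_sum c A x * g x \<partial>torus) = (\<Sum>k\<in>A. c k * (\<integral>x. fourier_basis k x * g x \<partial>torus))"
proof -
  have i: "integrable torus (\<lambda>x. fourier_basis k x * g x)" for k
    by (intro square_integrable_mult square_integrable_test_fun test_fun_fourier_basis assms)
  have "(\<integral>x. fourier_sum c A x * g x \<partial>torus) = (\<integral>x. (\<Sum>k\<in>A. c k * (fourier_basis k x * g x)) \<partial>torus)"
    by (simp add: fourier_sum_def sum_distrib_right mult.assoc)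
  also have "\<dots> = (\<Sum>k\<in>A. c k * (\<integral>x. fourier_basis k x * g x \<partial>torus))"
    by (subst Bochner_Integration.integral_sum) (simp_all add: i)
  finally show ?thesis .
qed

lemma fourier_coeff_fourier_sum:
  "finite A \<Longrightarrow> fourier_coeff (fourier_sum c A) k = (if k \<in> A then c k else 0)"
  unfolding fourier_coeff_def
  by (subst integral_fourier_sum_mult)
    (auto simp: square_integrable_test_fun fourier_basis_orthonormal if_distrib sum.delta cong: if_cong)

text \<open>The conjugate of a trigonometric sum is a trigonometric sum with reflected frequencies, so that
  orthonormality applies to the product of both.\<close>

lemma square_norm_fourier_sum:
  assumes A: "finite A"
  shows "square_norm (fourier_sum c A) = (\<Sum>k\<in>A. (norm (c k))\<^sup>2)"
proof -
  have cnj_sum: "cnj (fourier_sum c A x) = fourier_sum (\<lambda>k. cnj (c (- k))) (uminus ` A) x" for x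
    by (simp add: fourier_sum_def sum.reindex inj_on_def cnj_fourier_basis o_def)
  have "complex_of_real (square_norm (fourier_sum c A)) =
      (\<integral>x. fourier_sum c A x * cnj (fourier_sum c A x) \<partial>torus)"
    unfolding square_norm_def integral_complex_of_real[symmetric] complex_norm_square ..
  also have "\<dots> = (\<Sum>k\<in>A. c k * (\<integral>x. fourier_basis k x * cnj (fourier_sum c A x) \<partial>torus))"
    unfolding cnj_sum by (rule integral_fourier_sum_mult) (rule square_integrable_fourier_sum)
  also have "\<dots> = (\<Sum>k\<in>A. c k * cnj (c k))"
  proof (rule sum.cong)
    fix k assume k: "k \<in> A"
    have "(\<integral>x. fourier_basis k x * cnj (fourier_sum c A x) \<partial>torus) =
        fourier_coeff (fourier_sum (\<lambda>k. cnj (c (- k))) (uminus ` A)) (- k)"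
      unfolding cnj_sum fourier_coeff_def by (simp add: mult.commute)
    also have "\<dots> = cnj (c k)"
      using A k by (subst fourier_coeff_fourier_sum) auto
    finally show "c k * (\<integral>x. fourier_basis k x * cnj (fourier_sum c A x) \<partial>torus) = c k * cnj (c k)"
      by simp
  qed simp
  also have "\<dots> = complex_of_real (\<Sum>k\<in>A. (norm (c k))\<^sup>2)"
    unfolding of_real_sum complex_norm_square ..
  finally show ?thesis by (simp only: of_real_eq_iff)
qed

text \<open>Only the frequencies in the symmetric difference survive.\<close>

lemma square_norm_fourier_sum_diff:
  assumes "finite A" "finite B"
  shows "square_norm (\<lambda>x. fourier_sum c A x - fourier_sum c B x) =
     (\<Sum>k\<in>A - B. (norm (c k))\<^sup>2) + (\<Sum>k\<in>B - A. (norm (c k))\<^sup>2)"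
proof -
  define d where "d k = (if k \<in> A - B then c k else - c k)" for k
  have "fourier_sum c A x - fourier_sum c B x = fourier_sum d ((A - B) \<union> (B - A)) x" for x
  proof -
    have "fourier_sum c A x = fourier_sum c (A - B) x + fourier_sum c (A \<inter> B) x"
      unfolding fourier_sum_def by (subst sum.union_disjoint[symmetric]) (auto simp: assms intro: sum.cong)
    moreover have "fourier_sum c B x = fourier_sum c (B - A) x + fourier_sum c (A \<inter> B) x"
      unfolding fourier_sum_def by (subst sum.union_disjoint[symmetric]) (auto simp: assms intro: sum.cong)
    moreover have "fourier_sum d ((A - B) \<union> (B - A)) x = fourier_sum d (A - B) x + fourier_sum d (B - A) x"
      unfolding fourier_sum_def by (rule sum.union_disjoint) (auto simp: assms)
    moreover have "fourier_sum d (A - B) x = fourier_sum c (A - B) x"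
      unfolding fourier_sum_def by (rule sum.cong) (auto simp: d_def)
    moreover have "fourier_sum d (B - A) x = - fourier_sum c (B - A) x"
      unfolding fourier_sum_def sum_negf[symmetric] by (rule sum.cong) (auto simp: d_def)
    ultimately show ?thesis by simp
  qed
  hence "square_norm (\<lambda>x. fourier_sum c A x - fourier_sum c B x) =
      (\<Sum>k\<in>(A - B) \<union> (B - A). (norm (d k))\<^sup>2)"
    using square_norm_fourier_sum[of "(A - B) \<union> (B - A)" d] assms by simp
  also have "\<dots> = (\<Sum>k\<in>A - B. (norm (d k))\<^sup>2) + (\<Sum>k\<in>B - A. (norm (d k))\<^sup>2)"
    by (rule sum.union_disjoint) (auto simp: assms)
  also have "\<dots> = (\<Sum>k\<in>A - B. (norm (c k))\<^sup>2) + (\<Sum>k\<in>B - A. (norm (c k))\<^sup>2)"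
    by (intro arg_cong2[where f = "(+)"] sum.cong) (auto simp: d_def)
  finally show ?thesis .
qed

text \<open>The series with square-summable coefficients \<open>c\<close> converges to \<open>f\<close> in the mean, with the
  rate given by the tails.\<close>

definition mean_sum :: "(int ^ 'd \<Rightarrow> complex) \<Rightarrow> (real ^ 'd::finite \<Rightarrow> complex) \<Rightarrow> bool" where
  "mean_sum c f \<longleftrightarrow> (\<lambda>k. (norm (c k))\<^sup>2) summable_on UNIV \<and> square_integrable f \<and>
     (\<forall>A. finite A \<longrightarrow> square_norm (\<lambda>x. f x - fourier_sum c A x) \<le> (\<Sum>\<^sub>\<infinity>k\<in>-A. (norm (c k))\<^sup>2))"

lemma sum_le_tail:
  fixes f :: "'a \<Rightarrow> real"
  assumes "f summable_on UNIV" "\<And>x. 0 \<le> f x" "finite F" "F \<inter> A = {}"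
  shows "sum f F \<le> infsum f (- A)"
  using assms by (intro finite_sum_le_infsum summable_on_subset_banach[OF assms(1)]) auto

lemma AE_summable_if_integrals_summable:
  fixes D :: "nat \<Rightarrow> real ^ 'd::finite \<Rightarrow> complex"
  assumes D: "\<And>n. integrable torus (D n)" and s: "summable (\<lambda>n. \<integral>x. norm (D n x) \<partial>torus)"
  shows "AE x in torus. summable (\<lambda>n. norm (D n x))"
proof -
  have [measurable]: "D n \<in> borel_measurable torus" for n using D by auto
  have "(\<integral>\<^sup>+x. (\<Sum>n. ennreal (norm (D n x))) \<partial>torus) = (\<Sum>n. \<integral>\<^sup>+x. ennreal (norm (D n x)) \<partial>torus)"
    by (rule nn_integral_suminf) measurable
  also have "\<dots> = (\<Sum>n. ennreal (\<integral>x. norm (D n x) \<partial>torus))"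
    by (intro suminf_cong nn_integral_eq_integral integrable_norm D) simp
  also have "\<dots> = ennreal (\<Sum>n. \<integral>x. norm (D n x) \<partial>torus)"
    by (rule suminf_ennreal2[OF _ s]) simp
  finally have "(\<integral>\<^sup>+x. (\<Sum>n. ennreal (norm (D n x))) \<partial>torus) \<noteq> \<infinity>" by simp
  hence "AE x in torus. (\<Sum>n. ennreal (norm (D n x))) \<noteq> \<infinity>"
    by (intro nn_integral_noteq_infinite) measurable
  then show ?thesis
    by eventually_elim (auto intro: summable_suminf_not_top)
qed

text \<open>Partial sums over rapidly exhausting sets have summable increments in \<open>L\<^sup>1\<close>, so that they
  converge almost everywhere; Fatou's lemma turns this into convergence in the mean.\<close>

theorem riesz_fischer:
  fixes c :: "int ^ 'd::finite \<Rightarrow> complex"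
  assumes c: "(\<lambda>k. (norm (c k))\<^sup>2) summable_on UNIV"
  obtains f where "mean_sum c f"
proof -
  let ?a = "\<lambda>k. (norm (c k))\<^sup>2"
  let ?t = "\<lambda>A. infsum ?a (- A)"
  \<comment> \<open>Tails below \<open>4\<^sup>-\<^sup>n\<close> give increments of norm at most \<open>2\<^sup>-\<^sup>n\<close>, which is summable.\<close>
  have "\<exists>B. finite B \<and> ?t B < (1 / 4) ^ n" for n :: nat
  proof -
    have "eventually (\<lambda>B. ?t B < (1 / 4) ^ n) (finite_subsets_at_top UNIV)"
      by (rule order_tendstoD(2)[OF infsum_tail_tendsto_0[OF c]]) simp
    then show ?thesis unfolding eventually_finite_subsets_at_top by blast
  qed
  then obtain B where B: "\<And>n. finite (B n)" "\<And>n. ?t (B n) < (1 / 4) ^ n" by metis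
  define A where "A n = (\<Union>m\<le>n. B m)" for n
  have finA: "finite (A n)" for n using B by (simp add: A_def)
  have subA: "A n \<subseteq> A (Suc n)" for n unfolding A_def by (intro UN_mono) auto
  have tail: "sum ?a F \<le> (1 / 4) ^ n" if "finite F" "F \<inter> A n = {}" for F n
  proof -
    have "F \<inter> B n = {}" using that(2) by (auto simp: A_def)
    hence "sum ?a F \<le> ?t (B n)" using that(1) by (intro sum_le_tail c) auto
    with B(2)[of n] show ?thesis by linarith
  qed
  define D where "D n = fourier_sum c (A (Suc n) - A n)" for n
  have D_sq: "square_integrable (D n)" for n unfolding D_def by (rule square_integrable_fourier_sum)
  have one_sq: "square_integrable (\<lambda>x :: real ^ 'd. 1)"
    by (intro square_integrable_continuous continuous_intros)
  have D_int: "integrable torus (D n)" for n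
    using square_integrable_mult[OF D_sq one_sq] by simp
  let ?V = "sqrt (square_norm (\<lambda>x :: real ^ 'd. 1))"
  have D_le: "(\<integral>x. norm (D n x) \<partial>torus) \<le> ?V * (1 / 2) ^ n" for n
  proof -
    have "square_norm (D n) \<le> (1 / 4) ^ n"
      unfolding D_def using finA by (subst square_norm_fourier_sum) (auto intro!: tail)
    also have "(1 / 4 :: real) ^ n = ((1 / 2) ^ n)\<^sup>2"
      by (simp add: power_mult[symmetric] mult.commute power_mult power2_eq_square power_one_over field_simps
          flip: power_mult_distrib)
    finally have "sqrt (square_norm (D n)) \<le> (1 / 2) ^ n" by (simp add: real_le_lsqrt)
    moreover have "(\<integral>x. norm (D n x) \<partial>torus) \<le> sqrt (square_norm (D n)) * ?V"
      using real_le_rsqrt[OF cauchy_schwarz_abs[OF D_sq one_sq, of n]] by (simp add: real_sqrt_mult)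
    moreover have "0 \<le> ?V" by (simp add: square_norm_nonneg)
    ultimately have "(\<integral>x. norm (D n x) \<partial>torus) \<le> (1 / 2) ^ n * ?V"
      using mult_right_mono[of "sqrt (square_norm (D n))" "(1 / 2) ^ n" ?V] by linarith
    then show ?thesis by (simp only: mult.commute)
  qed
  have D_sum: "summable (\<lambda>n. \<integral>x. norm (D n x) \<partial>torus)"
    by (rule summable_comparison_test'[where g = "\<lambda>n. ?V * (1 / 2) ^ n" and N = 0])
      (auto intro!: summable_mult summable_geometric D_le)
  have D_AE: "AE x in torus. summable (\<lambda>n. norm (D n x))"
    using D_int D_sum by (rule AE_summable_if_integrals_summable)
  define f where "f x = fourier_sum c (A 0) x + (\<Sum>n. D n x)" for x
  have f_meas [measurable]: "f \<in> borel_measurable torus"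
  proof -
    have "integrable torus (\<lambda>x. \<Sum>n. D n x)"
      using D_int D_AE D_sum by (rule integrable_suminf)
    then have "(\<lambda>x. \<Sum>n. D n x) \<in> borel_measurable torus" by (rule borel_measurable_integrable)
    then show ?thesis unfolding f_def[abs_def]
      by (rule borel_measurable_add[OF square_integrable_measurable[OF square_integrable_fourier_sum]])
  qed
  have partial_sums: "fourier_sum c (A n) x = fourier_sum c (A 0) x + (\<Sum>m<n. D m x)" for n x
  proof (induction n)
    case (Suc n)
    have "fourier_sum c (A (Suc n)) x = fourier_sum c (A n) x + D n x"
      unfolding fourier_sum_def D_def
      using sum.subset_diff[OF subA finA, of "\<lambda>k. c k * fourier_basis k x"] by simp
    with Suc show ?case by simp
  qed simp
  have conv: "AE x in torus. (\<lambda>n. fourier_sum c (A n) x) \<longlonglongrightarrow> f x"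
    using D_AE
  proof eventually_elim
    case (elim x)
    hence "(\<lambda>n. \<Sum>m<n. D m x) \<longlonglongrightarrow> (\<Sum>n. D n x)"
      by (rule summable_LIMSEQ[OF summable_norm_cancel])
    hence "(\<lambda>n. fourier_sum c (A 0) x + (\<Sum>m<n. D m x)) \<longlonglongrightarrow> f x"
      unfolding f_def by (intro tendsto_intros)
    then show ?case by (simp only: partial_sums[symmetric])
  qed
  have fatou: "(\<integral>\<^sup>+x. ennreal ((norm (f x - fourier_sum c E x))\<^sup>2) \<partial>torus) \<le> ennreal (?t E)"
    if E: "finite E" for E
  proof -
    have mE [measurable]: "fourier_sum c E \<in> borel_measurable torus" "fourier_sum c (A n) \<in> borel_measurable torus" for E n
      by (intro square_integrable_measurable square_integrable_fourier_sum)+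
    have "(\<integral>\<^sup>+x. ennreal ((norm (f x - fourier_sum c E x))\<^sup>2) \<partial>torus) =
        (\<integral>\<^sup>+x. liminf (\<lambda>n. ennreal ((norm (fourier_sum c (A n) x - fourier_sum c E x))\<^sup>2)) \<partial>torus)"
    proof (rule nn_integral_cong_AE)
      show "AE x in torus. ennreal ((norm (f x - fourier_sum c E x))\<^sup>2) =
          liminf (\<lambda>n. ennreal ((norm (fourier_sum c (A n) x - fourier_sum c E x))\<^sup>2))"
        using conv
      proof eventually_elim
        case (elim x)
        hence "(\<lambda>n. ennreal ((norm (fourier_sum c (A n) x - fourier_sum c E x))\<^sup>2)) \<longlonglongrightarrow>
            ennreal ((norm (f x - fourier_sum c E x))\<^sup>2)"
          by (intro tendsto_intros tendsto_ennrealI)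
        then show ?case by (rule lim_imp_Liminf[OF sequentially_bot, symmetric])
      qed
    qed
    also have "\<dots> \<le> liminf (\<lambda>n. \<integral>\<^sup>+x. ennreal ((norm (fourier_sum c (A n) x - fourier_sum c E x))\<^sup>2) \<partial>torus)"
      by (intro nn_integral_liminf) measurable
    also have "\<dots> \<le> liminf (\<lambda>n. ennreal (?t E + (1 / 4) ^ n))"
    proof (intro Liminf_mono always_eventually allI)
      fix n
      have "square_integrable (\<lambda>x. fourier_sum c (A n) x - fourier_sum c E x)"
        by (intro square_integrable_diff square_integrable_fourier_sum)
      hence "(\<integral>\<^sup>+x. ennreal ((norm (fourier_sum c (A n) x - fourier_sum c E x))\<^sup>2) \<partial>torus) =
          ennreal (square_norm (\<lambda>x. fourier_sum c (A n) x - fourier_sum c E x))"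
        unfolding square_norm_def square_integrable_def by (intro nn_integral_eq_integral) auto
      also have "square_norm (\<lambda>x. fourier_sum c (A n) x - fourier_sum c E x) =
          sum ?a (A n - E) + sum ?a (E - A n)"
        using finA E by (rule square_norm_fourier_sum_diff)
      also have "ennreal \<dots> \<le> ennreal (?t E + (1 / 4) ^ n)"
        using finA E by (intro ennreal_leI add_mono tail sum_le_tail c) auto
      finally show "(\<integral>\<^sup>+x. ennreal ((norm (fourier_sum c (A n) x - fourier_sum c E x))\<^sup>2) \<partial>torus) \<le>
          ennreal (?t E + (1 / 4) ^ n)" .
    qed
    also have "\<dots> = ennreal (?t E)"
    proof (rule lim_imp_Liminf)
      have "(\<lambda>n. ?t E + (1 / 4) ^ n) \<longlonglongrightarrow> ?t E + 0"
        by (intro tendsto_intros LIMSEQ_power_zero) simp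
      then show "(\<lambda>n. ennreal (?t E + (1 / 4) ^ n)) \<longlonglongrightarrow> ennreal (?t E)"
        by (intro tendsto_ennrealI) simp
    qed simp
    finally show ?thesis .
  qed
  have sq_int: "integrable torus (\<lambda>x. (norm (f x - fourier_sum c E x))\<^sup>2)" if "finite E" for E
  proof (rule integrableI_bounded)
    show "(\<lambda>x. (norm (f x - fourier_sum c E x))\<^sup>2) \<in> borel_measurable torus"
      using square_integrable_measurable[OF square_integrable_fourier_sum[of c E]] by measurable
    show "(\<integral>\<^sup>+x. ennreal (norm ((norm (f x - fourier_sum c E x))\<^sup>2)) \<partial>torus) < \<infinity>"
      using fatou[OF that] by (simp add: le_less_trans)
  qed
  have "square_integrable f"
    using sq_int[of "{}"] by (simp add: square_integrable_def f_meas fourier_sum_def)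
  moreover have "square_norm (\<lambda>x. f x - fourier_sum c E x) \<le> ?t E" if "finite E" for E
  proof -
    have "ennreal (square_norm (\<lambda>x. f x - fourier_sum c E x)) \<le> ennreal (?t E)"
      using fatou[OF that] unfolding square_norm_def
      by (subst nn_integral_eq_integral[OF sq_int[OF that], symmetric]) auto
    then show ?thesis by (simp add: infsum_nonneg ennreal_le_iff)
  qed
  ultimately have "mean_sum c f" using c by (simp add: mean_sum_def)
  then show thesis by (rule that)
qed

text \<open>The error of a partial sum is controlled by the Cauchy--Schwarz inequality and the tail.\<close>

theorem parseval:
  fixes c :: "int ^ 'd::finite \<Rightarrow> complex"
  assumes f: "mean_sum c f" and g: "square_integrable g"
  shows "((\<lambda>k. c k * (\<integral>x. fourier_basis k x * g x \<partial>torus)) has_sum (\<integral>x. f x * g x \<partial>torus)) UNIV"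
proof -
  let ?t = "\<lambda>A. \<Sum>\<^sub>\<infinity>k\<in>-A. (norm (c k))\<^sup>2" and ?F = "finite_subsets_at_top (UNIV :: (int ^ 'd) set)"
  have c: "(\<lambda>k. (norm (c k))\<^sup>2) summable_on UNIV" and fs: "square_integrable f"
    and ft: "\<And>A. finite A \<Longrightarrow> square_norm (\<lambda>x. f x - fourier_sum c A x) \<le> ?t A"
    using f by (auto simp: mean_sum_def)
  have "((\<lambda>A. sqrt (?t A * square_norm g)) \<longlongrightarrow> sqrt (0 * square_norm g)) ?F"
    by (intro tendsto_intros infsum_tail_tendsto_0 c)
  hence lim: "((\<lambda>A. sqrt (?t A * square_norm g)) \<longlongrightarrow> 0) ?F" by simp
  have "((\<lambda>A. (\<Sum>k\<in>A. c k * (\<integral>x. fourier_basis k x * g x \<partial>torus)) - (\<integral>x. f x * g x \<partial>torus)) \<longlongrightarrow> 0) ?F"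
  proof (rule Lim_null_comparison[OF _ lim], rule eventually_finite_subsets_at_top_weakI)
    fix A :: "(int ^ 'd) set" assume A: "finite A"
    have "(\<Sum>k\<in>A. c k * (\<integral>x. fourier_basis k x * g x \<partial>torus)) - (\<integral>x. f x * g x \<partial>torus) =
        - (\<integral>x. (f x - fourier_sum c A x) * g x \<partial>torus)"
      unfolding left_diff_distrib integral_fourier_sum_mult[OF g, symmetric]
      by (subst Bochner_Integration.integral_diff)
        (simp_all add: square_integrable_mult fs g square_integrable_fourier_sum)
    also have "norm \<dots> \<le> sqrt (square_norm (\<lambda>x. f x - fourier_sum c A x) * square_norm g)"
      unfolding norm_minus_cancel
      by (intro cauchy_schwarz square_integrable_diff fs g square_integrable_fourier_sum)
    also have "\<dots> \<le> sqrt (?t A * square_norm g)"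
      using A by (intro real_sqrt_le_mono mult_right_mono ft square_norm_nonneg)
    finally show "norm ((\<Sum>k\<in>A. c k * (\<integral>x. fourier_basis k x * g x \<partial>torus)) - (\<integral>x. f x * g x \<partial>torus))
        \<le> sqrt (?t A * square_norm g)" .
  qed
  then show ?thesis unfolding has_sum_def by (simp only: LIM_zero_iff)
qed

lemma fourier_coeff_mean_sum:
  fixes c :: "int ^ 'd::finite \<Rightarrow> complex"
  assumes f: "mean_sum c f"
  shows "fourier_coeff f k = c k"
proof -
  have "((\<lambda>h. c h * (\<integral>x. fourier_basis h x * fourier_basis (- k) x \<partial>(torus :: (real ^ 'd) measure)))
      has_sum fourier_coeff f k) UNIV"
    unfolding fourier_coeff_def by (intro parseval f square_integrable_test_fun test_fun_fourier_basis)
  moreover have "((\<lambda>h. c h * (\<integral>x. fourier_basis h x * fourier_basis (- k) x \<partial>(torus :: (real ^ 'd) measure)))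
      has_sum c k) UNIV"
    by (rule has_sum_finite_neutralI[where B = "{k}"]) (auto simp: fourier_basis_orthonormal)
  ultimately show ?thesis by (rule has_sum_unique)
qed

lemma mean_sum_cong_AE:
  assumes f: "mean_sum c f" and g: "g \<in> borel_measurable torus" and ae: "AE x in torus. f x = g x"
  shows "mean_sum c g"
proof -
  have [measurable]: "f \<in> borel_measurable torus"
    using f by (auto simp: mean_sum_def square_integrable_def)
  note [measurable] = g
  have "square_integrable g"
  proof -
    have "integrable torus (\<lambda>x. (norm (f x))\<^sup>2)" using f by (simp add: mean_sum_def square_integrable_def)
    hence "integrable torus (\<lambda>x. (norm (g x))\<^sup>2)"
      by (rule Bochner_Integration.integrable_cong_AE_imp) (measurable, use ae in auto)
    then show ?thesis using g by (simp add: square_integrable_def)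
  qed
  moreover have "square_norm (\<lambda>x. g x - fourier_sum c A x) = square_norm (\<lambda>x. f x - fourier_sum c A x)" for A
  proof -
    have [measurable]: "fourier_sum c A \<in> borel_measurable torus"
      by (intro square_integrable_measurable square_integrable_fourier_sum)
    show ?thesis unfolding square_norm_def
      by (rule integral_cong_AE) (measurable, use ae in auto)
  qed
  ultimately show ?thesis using f by (simp add: mean_sum_def)
qed

section \<open>Distributions that are square-integrable functions\<close>

lemma of_function_torus: "of_function f \<phi> = (\<integral>x. complex_of_real (f x) * \<phi> x \<partial>torus)"
  unfolding of_function_def by (rule torus_set_integral)

lemma represents_iff:
  "represents f u \<longleftrightarrow> integrable torus f \<and> (\<forall>\<phi>. test_fun \<phi> \<longrightarrow> u \<phi> = of_function f \<phi>)"
  unfolding represents_def torus_integrable_iff ..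

lemma distributionI:
  assumes "\<And>\<phi> \<psi>. test_fun \<phi> \<Longrightarrow> test_fun \<psi> \<Longrightarrow> u (\<lambda>x. \<phi> x + \<psi> x) = u \<phi> + u \<psi>"
    and "\<And>c \<phi>. test_fun \<phi> \<Longrightarrow> u (\<lambda>x. c * \<phi> x) = c * u \<phi>"
    and "\<And>\<phi>. test_fun \<phi> \<Longrightarrow> norm (u \<phi>) \<le> C * test_norm N \<phi>"
  shows "distribution u"
  unfolding distribution_def using assms by (auto simp: test_norm_def)

lemma real_distribution_of_function:
  fixes f :: "real ^ 'd::finite \<Rightarrow> real"
  assumes f: "integrable torus f"
  shows "real_distribution (of_function f)"
proof -
  have fc: "integrable torus (\<lambda>x. complex_of_real (f x))" using f by simp
  have i: "integrable torus (\<lambda>x. complex_of_real (f x) * \<phi> x)" if "test_fun \<phi>" for \<phi>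
    using fc that by (rule integrable_mult_test_fun)
  have "distribution (of_function f)"
  proof (rule distributionI)
    fix \<phi> \<psi> :: "real ^ 'd \<Rightarrow> complex" assume "test_fun \<phi>" "test_fun \<psi>"
    then show "of_function f (\<lambda>x. \<phi> x + \<psi> x) = of_function f \<phi> + of_function f \<psi>"
      unfolding of_function_torus distrib_left by (intro Bochner_Integration.integral_add i)
  next
    fix c and \<phi> :: "real ^ 'd \<Rightarrow> complex"
    show "of_function f (\<lambda>x. c * \<phi> x) = c * of_function f \<phi>"
      unfolding of_function_torus by (simp add: mult.left_commute[of _ c])
  next
    fix \<phi> :: "real ^ 'd \<Rightarrow> complex" assume \<phi>: "test_fun \<phi>"
    have "norm (of_function f \<phi>) \<le> (\<integral>x. \<bar>f x\<bar> * test_norm 0 \<phi> \<partial>torus)"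
      unfolding of_function_torus
    proof (rule Bochner_Integration.integral_norm_bound_integral)
      show "norm (complex_of_real (f x) * \<phi> x) \<le> \<bar>f x\<bar> * test_norm 0 \<phi>" for x
        unfolding norm_mult norm_of_real by (intro mult_left_mono norm_le_test_norm \<phi>) simp
    qed (use f i[OF \<phi>] in auto)
    then show "norm (of_function f \<phi>) \<le> (\<integral>x. \<bar>f x\<bar> \<partial>torus) * test_norm 0 \<phi>" by simp
  qed
  moreover have "of_function f (\<lambda>x. cnj (\<phi> x)) = cnj (of_function f \<phi>)" for \<phi>
    unfolding of_function_torus using Bochner_Integration.integral_cnj[of torus "\<lambda>x. complex_of_real (f x) * \<phi> x"] by simp
  ultimately show ?thesis by (simp add: real_distribution_def)
qed

text \<open>A derivative costs one order of the seminorm.\<close>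

lemma test_norm_partial_le:
  assumes \<phi>: "test_fun \<phi>"
  shows "test_norm N (partial s \<phi>) \<le> test_norm (Suc N) \<phi>"
proof -
  have p: "partials is (partial s \<phi>) = partials (is @ [s]) \<phi>" for "is"
    by (simp add: partials_append)
  have "test_norm N (partial s \<phi>) = (\<Sum>js\<in>(\<lambda>is. is @ [s]) ` {is. length is \<le> N}. SUP x. norm (partials js \<phi> x))"
    unfolding test_norm_def p by (subst sum.reindex) (auto simp: inj_on_def)
  also have "\<dots> \<le> test_norm (Suc N) \<phi>"
    unfolding test_norm_def
    by (rule sum_mono2) (auto intro: SUP_partials_nonneg \<phi> finite_short_lists)
  finally show ?thesis .
qed

lemma real_distribution_dist_partial:
  fixes u :: "'d::finite functional"
  assumes u: "real_distribution u"
  shows "real_distribution (dist_partial s u)"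
proof -
  have d: "distribution u" using u by (simp add: real_distribution_def)
  obtain C N where C0: "0 \<le> C" and C: "\<And>\<phi>. test_fun \<phi> \<Longrightarrow> norm (u \<phi>) \<le> C * test_norm N \<phi>"
    using distribution_bound[OF d] by metis
  have "distribution (dist_partial s u)"
  proof (rule distributionI)
    fix \<phi> \<psi> :: "real ^ 'd \<Rightarrow> complex" assume "test_fun \<phi>" "test_fun \<psi>"
    then show "dist_partial s u (\<lambda>x. \<phi> x + \<psi> x) = dist_partial s u \<phi> + dist_partial s u \<psi>"
      using partials_add[of \<phi> \<psi> "[s]"] distribution_add[OF d test_fun_partial test_fun_partial]
      by (simp add: dist_partial_def test_fun_iff)
  next
    fix c and \<phi> :: "real ^ 'd \<Rightarrow> complex" assume "test_fun \<phi>"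
    then show "dist_partial s u (\<lambda>x. c * \<phi> x) = c * dist_partial s u \<phi>"
      using partials_cmult[of \<phi> "[s]" c] distribution_cmult[OF d test_fun_partial]
      by (simp add: dist_partial_def test_fun_iff)
  next
    fix \<phi> :: "real ^ 'd \<Rightarrow> complex" assume \<phi>: "test_fun \<phi>"
    have "norm (dist_partial s u \<phi>) \<le> C * test_norm N (partial s \<phi>)"
      using C[OF test_fun_partial[OF \<phi>]] by (simp add: dist_partial_def)
    also have "\<dots> \<le> C * test_norm (Suc N) \<phi>"
      using C0 by (intro mult_left_mono test_norm_partial_le \<phi>)
    finally show "norm (dist_partial s u \<phi>) \<le> C * test_norm (Suc N) \<phi>" .
  qed
  moreover have "dist_partial s u (\<lambda>x. cnj (\<phi> x)) = cnj (dist_partial s u \<phi>)" if \<phi>: "test_fun \<phi>" for \<phi>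
    using partials_cnj[of \<phi> "[s]"] u test_fun_partial[OF \<phi>, of s] \<phi>
    by (simp add: dist_partial_def real_distribution_def test_fun_iff)
  ultimately show ?thesis by (simp add: real_distribution_def)
qed

lemma real_distribution_fourier_basis:
  "real_distribution u \<Longrightarrow> u (fourier_basis (- k)) = cnj (u (fourier_basis k))"
  unfolding real_distribution_def cnj_fourier_basis[symmetric] by simp

lemma dist_partial_fourier_basis:
  "real_distribution u \<Longrightarrow>
   dist_partial s u (fourier_basis (- k)) = \<i> * of_int (k $ s) * u (fourier_basis (- k))"
  using partial_fourier_basis[of s 1 "- k"]
    distribution_cmult[OF _ test_fun_fourier_basis[of "- k"], of u "- (\<i> * of_int (k $ s))"]
  by (simp add: dist_partial_def real_distribution_def)

text \<open>The sum \<open>F\<close> of the Fourier series has the coefficients of \<open>u\<close>. So has its conjugate, because \<open>u\<close>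
  is real, and therefore also the real part of \<open>F\<close>.\<close>

theorem square_summable_distribution_is_function:
  fixes u :: "'d::finite functional"
  assumes u: "real_distribution u" and c: "(\<lambda>k. (norm (u (fourier_basis (- k))))\<^sup>2) summable_on UNIV"
  obtains f where "represents f u"
proof -
  obtain F where F: "mean_sum (\<lambda>k. u (fourier_basis (- k))) F"
    using riesz_fischer[OF c] by metis
  have one: "square_integrable (\<lambda>x :: real ^ 'd. 1)"
    by (intro square_integrable_continuous continuous_intros)
  have Fi: "integrable torus F"
    using square_integrable_mult[OF _ one, of F] F by (simp add: mean_sum_def)
  have f: "integrable torus (\<lambda>x. Re (F x))" using Fi by (rule integrable_Re)
  have Fk: "(\<integral>x. F x * fourier_basis k x \<partial>torus) = u (fourier_basis k)" for k
    using fourier_coeff_mean_sum[OF F, of "- k"] by (simp add: fourier_coeff_def)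
  have coeff: "of_function (\<lambda>x. Re (F x)) (fourier_basis k) = u (fourier_basis k)" for k
  proof -
    have i: "integrable torus (\<lambda>x. F x * fourier_basis k x)" "integrable torus (\<lambda>x. cnj (F x) * fourier_basis k x)"
      by (intro integrable_mult_test_fun test_fun_fourier_basis Fi integrable_cnj)+
    have "(\<integral>x. cnj (F x) * fourier_basis k x \<partial>torus) = cnj (\<integral>x. F x * fourier_basis (- k) x \<partial>torus)"
      using Bochner_Integration.integral_cnj[of torus "\<lambda>x. F x * fourier_basis (- k) x"] by (simp add: cnj_fourier_basis)
    also have "\<dots> = u (fourier_basis k)"
      unfolding Fk using real_distribution_fourier_basis[OF u, of k] by simp
    finally have cF: "(\<integral>x. cnj (F x) * fourier_basis k x \<partial>torus) = u (fourier_basis k)" .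
    have "of_function (\<lambda>x. Re (F x)) (fourier_basis k) =
        (\<integral>x. (F x * fourier_basis k x + cnj (F x) * fourier_basis k x) / 2 \<partial>torus)"
      unfolding of_function_torus
      by (intro Bochner_Integration.integral_cong refl) (simp add: complex_add_cnj flip: distrib_right)
    also have "\<dots> = u (fourier_basis k)"
      using i cF Fk by simp
    finally show ?thesis .
  qed
  have d: "distribution u" "distribution (of_function (\<lambda>x. Re (F x)))"
    using u real_distribution_of_function[OF f] by (auto simp: real_distribution_def)
  have "represents (\<lambda>x. Re (F x)) u"
    unfolding represents_iff using f distribution_eqI[OF d] coeff by auto
  then show thesis by (rule that)
qed

lemma null_coeffs_diff:
  assumes f: "integrable torus f" and g: "integrable torus g"
    and eq: "\<And>k. (\<integral>x. f x * fourier_basis k x \<partial>torus) = (\<integral>x. g x * fourier_basis k x \<partial>torus)"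
  shows "AE x in torus. f x = g x"
proof -
  have i: "integrable torus (\<lambda>x. f x * fourier_basis k x)" "integrable torus (\<lambda>x. g x * fourier_basis k x)" for k
    by (intro integrable_mult_test_fun test_fun_fourier_basis f g)+
  have "null_coeffs (\<lambda>x. f x - g x)"
    unfolding null_coeffs_def right_diff_distrib mult.commute[of "fourier_basis _ _"]
    using f g i eq by simp
  from null_coeffs_AE_0[OF this] show ?thesis by simp
qed

lemma represents_unique:
  fixes f g :: "real ^ 'd::finite \<Rightarrow> real"
  assumes "represents f u" "represents g u"
  shows "AE x in torus. f x = g x"
proof -
  have "AE x in torus. complex_of_real (f x) = complex_of_real (g x)"
    using assms test_fun_fourier_basis
    by (intro null_coeffs_diff) (auto simp: represents_iff simp flip: of_function_torus)
  then show ?thesis by simp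
qed

text \<open>Any representative agrees almost everywhere with the sum of the Fourier series, which makes it
  square-integrable with convergence in the mean.\<close>

lemma represents_mean_sum:
  fixes u :: "'d::finite functional"
  assumes f: "represents f u" and c: "(\<lambda>k. (norm (u (fourier_basis (- k))))\<^sup>2) summable_on UNIV"
  shows "mean_sum (\<lambda>k. u (fourier_basis (- k))) (\<lambda>x. complex_of_real (f x))"
proof -
  obtain F where F: "mean_sum (\<lambda>k. u (fourier_basis (- k))) F"
    using riesz_fischer[OF c] by metis
  have one: "square_integrable (\<lambda>x :: real ^ 'd. 1)"
    by (intro square_integrable_continuous continuous_intros)
  have fi: "integrable torus (\<lambda>x. complex_of_real (f x))" using f by (simp add: represents_iff)
  have "AE x in torus. F x = complex_of_real (f x)"
  proof (rule null_coeffs_diff[OF _ fi])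
    show "integrable torus F"
      using square_integrable_mult[OF _ one, of F] F by (simp add: mean_sum_def)
    fix k
    have "(\<integral>x. F x * fourier_basis k x \<partial>torus) = u (fourier_basis k)"
      using fourier_coeff_mean_sum[OF F, of "- k"] by (simp add: fourier_coeff_def)
    also have "\<dots> = of_function f (fourier_basis k)" using f by (simp add: represents_iff)
    finally show "(\<integral>x. F x * fourier_basis k x \<partial>torus) = (\<integral>x. complex_of_real (f x) * fourier_basis k x \<partial>torus)"
      by (simp add: of_function_torus)
  qed
  then show ?thesis by (rule mean_sum_cong_AE[OF F borel_measurable_integrable[OF fi]])
qed

text \<open>Parseval's identity, tested against \<open>g e\<^sub>-\<^sub>k\<close>.\<close>

lemma fourier_coeff_mult:
  fixes c d :: "int ^ 'd::finite \<Rightarrow> complex"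
  assumes f: "mean_sum c f" and g: "mean_sum d g"
  shows "((\<lambda>h. complex_of_real (basis_norm TYPE('d)) * (c h * d (k - h))) has_sum
      fourier_coeff (\<lambda>x. f x * g x) k) UNIV"
proof -
  have gs: "square_integrable g" using g by (simp add: mean_sum_def)
  have "(\<integral>x. fourier_basis h x * (g x * fourier_basis (- k) x) \<partial>torus) =
      complex_of_real (basis_norm TYPE('d)) * d (k - h)" for h
  proof -
    have "(\<lambda>x. fourier_basis h x * (g x * fourier_basis (- k) x)) =
        (\<lambda>x. complex_of_real (basis_norm TYPE('d)) * (g x * fourier_basis (- (k - h)) x))"
    proof
      fix x
      have "fourier_basis h x * (g x * fourier_basis (- k) x) = g x * (fourier_basis h x * fourier_basis (- k) x)"
        by (simp add: mult_ac)
      then show "fourier_basis h x * (g x * fourier_basis (- k) x) =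
          complex_of_real (basis_norm TYPE('d)) * (g x * fourier_basis (- (k - h)) x)"
        by (simp add: fourier_basis_mult mult_ac)
    qed
    then show ?thesis using fourier_coeff_mean_sum[OF g, of "k - h"] by (simp add: fourier_coeff_def)
  qed
  moreover have "((\<lambda>h. c h * (\<integral>x. fourier_basis h x * (g x * fourier_basis (- k) x) \<partial>torus)) has_sum
      (\<integral>x. f x * (g x * fourier_basis (- k) x) \<partial>torus)) UNIV"
    by (intro parseval f square_integrable_mult_fourier_basis gs)
  ultimately show ?thesis by (simp add: fourier_coeff_def mult_ac)
qed

section \<open>The convolution inequality\<close>

lemma has_sum_finite_sum:
  fixes f :: "'i \<Rightarrow> 'a \<Rightarrow> 'b::topological_comm_monoid_add"
  assumes "finite I" "\<And>i. i \<in> I \<Longrightarrow> (f i has_sum s i) A"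
  shows "((\<lambda>x. \<Sum>i\<in>I. f i x) has_sum (\<Sum>i\<in>I. s i)) A"
  using assms by (induction I rule: finite_induct) (auto intro: has_sum_add has_sum_0)

lemma
  fixes f :: "'i \<Rightarrow> 'a \<Rightarrow> 'b::{topological_comm_monoid_add, t2_space}"
  assumes "finite I" "\<And>i. i \<in> I \<Longrightarrow> f i summable_on A"
  shows summable_on_finite_sum: "(\<lambda>x. \<Sum>i\<in>I. f i x) summable_on A"
    and infsum_finite_sum: "(\<Sum>\<^sub>\<infinity>x\<in>A. \<Sum>i\<in>I. f i x) = (\<Sum>i\<in>I. infsum (f i) A)"
  using has_sum_finite_sum[where f = f and s = "\<lambda>i. infsum (f i) A" and A = A and I = I] assms
  by (auto simp: has_sum_infsum summable_on_def intro: infsumI)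

lemma square_summable_mult:
  fixes f g :: "'a \<Rightarrow> real"
  assumes f: "(\<lambda>x. (f x)\<^sup>2) summable_on A" and g: "(\<lambda>x. (g x)\<^sup>2) summable_on A"
    and nn: "\<And>x. 0 \<le> f x" "\<And>x. 0 \<le> g x"
  shows "(\<lambda>x. f x * g x) summable_on A"
    and "(\<Sum>\<^sub>\<infinity>x\<in>A. f x * g x) \<le> sqrt (\<Sum>\<^sub>\<infinity>x\<in>A. (f x)\<^sup>2) * sqrt (\<Sum>\<^sub>\<infinity>x\<in>A. (g x)\<^sup>2)"
proof -
  have fin: "(\<Sum>x\<in>F. f x * g x) \<le> sqrt (\<Sum>\<^sub>\<infinity>x\<in>A. (f x)\<^sup>2) * sqrt (\<Sum>\<^sub>\<infinity>x\<in>A. (g x)\<^sup>2)"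
    if "finite F" "F \<subseteq> A" for F
  proof -
    have "(\<Sum>x\<in>F. f x * g x) \<le> L2_set f F * L2_set g F"
      using L2_set_mult_ineq[of f g F] nn by simp
    also have "\<dots> \<le> sqrt (\<Sum>\<^sub>\<infinity>x\<in>A. (f x)\<^sup>2) * sqrt (\<Sum>\<^sub>\<infinity>x\<in>A. (g x)\<^sup>2)"
      unfolding L2_set_def using that
      by (intro mult_mono real_sqrt_le_mono finite_sum_le_infsum f g) (auto simp: sum_nonneg infsum_nonneg)
    finally show ?thesis .
  qed
  show s: "(\<lambda>x. f x * g x) summable_on A"
    by (rule nonneg_bdd_above_summable_on) (use nn fin in \<open>auto intro!: bdd_aboveI2\<close>)
  show "(\<Sum>\<^sub>\<infinity>x\<in>A. f x * g x) \<le> sqrt (\<Sum>\<^sub>\<infinity>x\<in>A. (f x)\<^sup>2) * sqrt (\<Sum>\<^sub>\<infinity>x\<in>A. (g x)\<^sup>2)"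
    using s fin by (rule infsum_le_finite_sums)
qed

lemma le_if_le_sqrt_mult:
  fixes S R :: real
  assumes "S \<le> sqrt S * sqrt R" "0 \<le> S" "0 \<le> R"
  shows "S \<le> R"
proof (rule ccontr)
  assume "\<not> S \<le> R"
  hence "sqrt S * sqrt R < sqrt S * sqrt S"
    using assms by (intro mult_strict_left_mono) auto
  then show False using assms by simp
qed

lemma bij_lattice_reflect: "bij (\<lambda>h. k - h :: int ^ 'd)"
  by (rule bij_betw_byWitness[where f' = "\<lambda>h. k - h"]) auto

lemma summable_on_reflect:
  fixes f :: "int ^ 'd \<Rightarrow> 'b::{comm_monoid_add, topological_space}"
  shows "(\<lambda>h. f (k - h)) summable_on UNIV \<longleftrightarrow> f summable_on UNIV"
  unfolding summable_on_def by (subst has_sum_reindex_bij_betw[OF bij_lattice_reflect]) simp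

lemma infsum_reflect:
  fixes f :: "int ^ 'd \<Rightarrow> 'b::{comm_monoid_add, t2_space}"
  shows "(\<Sum>\<^sub>\<infinity>h. f (k - h)) = infsum f UNIV"
  by (rule infsum_reindex_bij_betw[OF bij_lattice_reflect])

text \<open>Test the convolution against the weighted values \<open>X\<close> it takes on a finite set \<open>F\<close>, and exchange
  the sums. For fixed \<open>l\<close>, the Cauchy--Schwarz inequality splits off the factor
  \<open>\<Sum>\<^sub>k \<bar>k\<bar>\<^sup>-\<^sup>2\<^sup>\<omega> \<bar>k - l\<bar>\<^sup>-\<^sup>2\<close>, which is the kernel at \<open>l\<close>; a second application in \<open>l\<close> leaves
  the sum over \<open>k\<close> and \<open>l\<close> of \<open>X\<^sub>k\<^sup>2\<close> times a shifted summable sequence.\<close>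

lemma convolution_inequality:
  fixes a b :: "int ^ 'd::finite \<Rightarrow> real"
  assumes w: "\<omega> > 0" "\<omega> > real CARD('d) / 2 - 1"
    and \<kappa>: "\<And>k :: int ^ 'd. k \<noteq> 0 \<Longrightarrow> Kfun \<omega> k \<le> \<kappa>" and \<kappa>0: "0 \<le> \<kappa>"
    and a: "\<And>h. 0 \<le> a h" "a 0 = 0" "(\<lambda>h. (lnorm h * a h)\<^sup>2) summable_on UNIV"
    and b: "\<And>h. 0 \<le> b h" "b 0 = 0" "(\<lambda>h. (b h)\<^sup>2) summable_on UNIV"
    and F: "finite F" "0 \<notin> F"
  shows "(\<Sum>k\<in>F. (lnorm k powr (- \<omega>) * (\<Sum>\<^sub>\<infinity>h. a h * b (k - h)))\<^sup>2) \<le>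
    \<kappa> * (\<Sum>\<^sub>\<infinity>h. (lnorm h * a h)\<^sup>2) * (\<Sum>\<^sub>\<infinity>h. (b h)\<^sup>2)"
proof -
  define z where "z k = (\<Sum>\<^sub>\<infinity>h. a h * b (k - h))" for k
  define X where "X k = lnorm k powr (- \<omega>) * z k" for k
  define A where "A h = lnorm h * a h" for h
  let ?NA = "\<Sum>\<^sub>\<infinity>h. (A h)\<^sup>2" and ?NB = "\<Sum>\<^sub>\<infinity>h. (b h)\<^sup>2" and ?S = "\<Sum>k\<in>F. (X k)\<^sup>2"
  have A0: "0 \<le> A h" for h by (simp add: A_def a)
  have aA: "a h \<le> A h" for h
  proof (cases "h = 0")
    case False
    then show ?thesis using mult_right_mono[OF lnorm_ge_1[of h] a(1)[of h]] by (simp add: A_def)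
  qed (simp add: A_def a)
  have sA: "(\<lambda>h. (A h)\<^sup>2) summable_on UNIV" using a(3) by (simp add: A_def)
  have sa: "(\<lambda>h. (a h)\<^sup>2) summable_on UNIV"
    by (rule summable_on_comparison_test[OF sA]) (auto intro!: power_mono aA a)
  have sa': "(\<lambda>l. (a (k - l))\<^sup>2) summable_on UNIV" for k
    using sa summable_on_reflect[of "\<lambda>h. (a h)\<^sup>2" k] by simp
  have sA': "(\<lambda>l. (A (k - l))\<^sup>2) summable_on UNIV" for k
    using sA summable_on_reflect[of "\<lambda>h. (A h)\<^sup>2" k] by simp
  have ba: "(\<lambda>l. b l * a (k - l)) summable_on UNIV" for k
    using b(3) sa' b(1) a(1) by (rule square_summable_mult(1))
  have z_eq: "z k = (\<Sum>\<^sub>\<infinity>l. b l * a (k - l))" for k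
    unfolding z_def using infsum_reflect[of "\<lambda>h. a h * b (k - h)" k] by (simp add: mult.commute)
  have z0: "0 \<le> z k" for k unfolding z_def by (intro infsum_nonneg mult_nonneg_nonneg a b)
  have X0: "0 \<le> X k" for k unfolding X_def by (intro mult_nonneg_nonneg z0) simp
  define G where "G l = (\<Sum>k\<in>F. (X k * A (k - l))\<^sup>2)" for l
  have G0: "0 \<le> G l" for l unfolding G_def by (intro sum_nonneg) simp
  have sG: "G summable_on UNIV" unfolding G_def[abs_def] power_mult_distrib
    by (intro summable_on_finite_sum summable_on_cmult_right sA' F)
  have G_sum: "(\<Sum>\<^sub>\<infinity>l. G l) = ?S * ?NA"
  proof -
    have "(\<Sum>\<^sub>\<infinity>l. G l) = (\<Sum>k\<in>F. (X k)\<^sup>2 * (\<Sum>\<^sub>\<infinity>l. (A (k - l))\<^sup>2))"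
      unfolding G_def power_mult_distrib
      by (subst infsum_finite_sum) (auto simp: infsum_cmult_right' F intro!: summable_on_cmult_right sA')
    then show ?thesis
      using infsum_reflect[of "\<lambda>h. (A h)\<^sup>2"] by (simp add: sum_distrib_right)
  qed
  have inner: "(\<Sum>k\<in>F. X k * lnorm k powr (- \<omega>) * a (k - l)) \<le> sqrt (G l) * sqrt \<kappa>"
    if l: "l \<noteq> 0" for l
  proof -
    define q where "q k = lnorm k powr (- \<omega>) / lnorm (k - l)" for k
    have q2: "(q k)\<^sup>2 = 1 / (lnorm k powr (2 * \<omega>) * (lnorm (l - k))\<^sup>2)" for k
    proof -
      have "(lnorm k powr (- \<omega>))\<^sup>2 = lnorm k powr (- (2 * \<omega>))"
        by (simp add: power2_eq_square flip: powr_add)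
      then show ?thesis
        by (simp add: q_def power_divide power_mult_distrib powr_minus_divide lnorm_diff_commute[of k l])
    qed
    have "(\<Sum>k\<in>F. X k * lnorm k powr (- \<omega>) * a (k - l)) = (\<Sum>k\<in>F - {l}. (X k * A (k - l)) * q k)"
    proof (rule sum.mono_neutral_cong_right)
      show "X k * lnorm k powr (- \<omega>) * a (k - l) = (X k * A (k - l)) * q k" if "k \<in> F - {l}" for k
      proof -
        have "k - l \<noteq> 0" using that by simp
        hence "lnorm (k - l) \<noteq> 0" using lnorm_ge_1[of "k - l"] by linarith
        then show ?thesis by (simp add: A_def q_def)
      qed
    qed (use F a(2) in auto)
    also have "\<dots> \<le> L2_set (\<lambda>k. X k * A (k - l)) (F - {l}) * L2_set q (F - {l})"
      using L2_set_mult_ineq[of "\<lambda>k. X k * A (k - l)" q "F - {l}"] X0 A0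
      by (simp add: q_def)
    also have "\<dots> \<le> sqrt (G l) * sqrt \<kappa>"
    proof (rule mult_mono)
      show "L2_set (\<lambda>k. X k * A (k - l)) (F - {l}) \<le> sqrt (G l)"
        unfolding L2_set_def G_def by (intro real_sqrt_le_mono sum_mono2 F) auto
      have "(\<Sum>k\<in>F - {l}. (q k)\<^sup>2) \<le> Kfun \<omega> l"
        unfolding Kfun_def q2 using F
        by (intro finite_sum_le_infsum Kfun_summable_bound(1)[OF w]) auto
      then show "L2_set q (F - {l}) \<le> sqrt \<kappa>"
        unfolding L2_set_def using \<kappa>[OF l] by (intro real_sqrt_le_mono) linarith
    qed (auto simp: G0 L2_set_nonneg)
    finally show ?thesis .
  qed
  have "?S = (\<Sum>k\<in>F. X k * lnorm k powr (- \<omega>) * (\<Sum>\<^sub>\<infinity>l. b l * a (k - l)))"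
    unfolding z_eq[symmetric] by (simp add: X_def power2_eq_square mult_ac)
  also have "\<dots> = (\<Sum>\<^sub>\<infinity>l. \<Sum>k\<in>F. X k * lnorm k powr (- \<omega>) * (b l * a (k - l)))"
    by (subst infsum_finite_sum) (auto simp: infsum_cmult_right' F intro!: summable_on_cmult_right ba)
  also have "\<dots> \<le> (\<Sum>\<^sub>\<infinity>l. sqrt \<kappa> * (b l * sqrt (G l)))"
  proof (rule infsum_mono)
    show "(\<lambda>l. \<Sum>k\<in>F. X k * lnorm k powr (- \<omega>) * (b l * a (k - l))) summable_on UNIV"
      by (intro summable_on_finite_sum summable_on_cmult_right ba F)
    show "(\<lambda>l. sqrt \<kappa> * (b l * sqrt (G l))) summable_on UNIV"
      using sG G0 b by (intro summable_on_cmult_right square_summable_mult(1)) auto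
    fix l
    have "(\<Sum>k\<in>F. X k * lnorm k powr (- \<omega>) * (b l * a (k - l))) =
        b l * (\<Sum>k\<in>F. X k * lnorm k powr (- \<omega>) * a (k - l))"
      by (simp add: sum_distrib_left mult_ac)
    also have "\<dots> \<le> b l * (sqrt (G l) * sqrt \<kappa>)"
      using inner[of l] b by (cases "l = 0") (auto intro!: mult_left_mono)
    finally show "(\<Sum>k\<in>F. X k * lnorm k powr (- \<omega>) * (b l * a (k - l))) \<le> sqrt \<kappa> * (b l * sqrt (G l))"
      by (simp add: mult_ac)
  qed
  also have "\<dots> = sqrt \<kappa> * (\<Sum>\<^sub>\<infinity>l. b l * sqrt (G l))" by (rule infsum_cmult_right')
  also have "\<dots> \<le> sqrt \<kappa> * (sqrt ?NB * sqrt (?S * ?NA))"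
  proof (rule mult_left_mono)
    have "(\<Sum>\<^sub>\<infinity>l. b l * sqrt (G l)) \<le> sqrt ?NB * sqrt (\<Sum>\<^sub>\<infinity>l. (sqrt (G l))\<^sup>2)"
      using sG G0 b by (intro square_summable_mult(2)) auto
    then show "(\<Sum>\<^sub>\<infinity>l. b l * sqrt (G l)) \<le> sqrt ?NB * sqrt (?S * ?NA)"
      using G0 G_sum by simp
  qed (simp add: \<kappa>0)
  finally have "?S \<le> sqrt ?S * sqrt (\<kappa> * ?NA * ?NB)"
    by (simp add: real_sqrt_mult mult_ac)
  hence "?S \<le> \<kappa> * ?NA * ?NB"
    by (rule le_if_le_sqrt_mult) (auto simp: sum_nonneg infsum_nonneg \<kappa>0)
  then show ?thesis by (simp add: X_def z_def A_def)
qed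

section \<open>Fields of finite Sobolev norm\<close>

lemma norm_scale_vec: "norm (c *s x) = norm c * norm x"
  for x :: "complex ^ 'd::finite"
  by (simp add: norm_vec_def norm_mult L2_set_right_distrib)

lemma norm_ldot_le: "norm (ldot k c) \<le> lnorm k * norm c"
  for c :: "complex ^ 'd::finite"
proof -
  have "norm (ldot k c) \<le> (\<Sum>r\<in>UNIV. \<bar>real_of_int (k $ r)\<bar> * norm (c $ r))"
    unfolding ldot_def by (rule sum_norm_le) (simp add: norm_mult)
  also have "\<dots> \<le> L2_set (\<lambda>r. real_of_int (k $ r)) UNIV * L2_set (\<lambda>r. norm (c $ r)) UNIV"
    using L2_set_mult_ineq[of "\<lambda>r. real_of_int (k $ r)" "\<lambda>r. norm (c $ r)" UNIV] by simp
  also have "\<dots> = lnorm k * norm c"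
    by (simp add: lnorm_def norm_vec_def L2_set_def)
  finally show ?thesis .
qed

lemma ldot_diff: "ldot (k - h) c = ldot k c - ldot h c"
  for c :: "complex ^ 'd::finite"
  by (simp add: ldot_def left_diff_distrib sum_subtractf)

lemma ldot_minus: "ldot (- h) c = - ldot h c"
  for c :: "complex ^ 'd::finite"
  using ldot_diff[of 0 h c] by (simp add: ldot_def)

lemma ldot_0 [simp]: "ldot 0 c = 0"
  by (simp add: ldot_def)

lemma fcoeff_nth: "fcoeff v k $ r = (v $ r) (fourier_basis (- k))"
  by (simp add: fcoeff_def)

lemma H0_real_distribution: "v \<in> H0 n \<Longrightarrow> real_distribution (v $ r)"
  by (simp add: H0_def vector_field_def)

text \<open>The square root of the summand of the squared norm of order one. It vanishes at the origin, so that
  sums may run over the whole lattice, on which shifts and reflections act.\<close>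

definition sobolev_term :: "'d::finite vfield \<Rightarrow> int ^ 'd \<Rightarrow> real" where
  "sobolev_term v k = lnorm k * norm (fcoeff v k)"

lemma sobolev_term_square:
  "k \<noteq> 0 \<Longrightarrow> lnorm k powr (2 * 1) * (norm (fcoeff v k))\<^sup>2 = (sobolev_term v k)\<^sup>2"
  using lnorm_ge_1[of k] by (simp add: sobolev_term_def power_mult_distrib powr_numeral)

lemma H0_1_summable:
  assumes "v \<in> H0 1"
  shows "(\<lambda>k. (sobolev_term v k)\<^sup>2) summable_on UNIV"
proof -
  have "(\<lambda>k. lnorm k powr (2 * 1) * (norm (fcoeff v k))\<^sup>2) summable_on (UNIV - {0})"
    using assms by (simp add: H0_def)
  then show ?thesis
    by (rule summable_on_cong_neutral[THEN iffD1, rotated -1])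
      (auto simp: sobolev_term_square[simplified] sobolev_term_def)
qed

lemma Hnorm_1_square: "(Hnorm 1 v)\<^sup>2 = (\<Sum>\<^sub>\<infinity>k. (sobolev_term v k)\<^sup>2)"
proof -
  have "(\<Sum>\<^sub>\<infinity>k\<in>UNIV - {0}. lnorm k powr (2 * 1) * (norm (fcoeff v k))\<^sup>2) = (\<Sum>\<^sub>\<infinity>k. (sobolev_term v k)\<^sup>2)"
    by (rule infsum_cong_neutral) (auto simp: sobolev_term_square[simplified] sobolev_term_def)
  moreover have "0 \<le> (\<Sum>\<^sub>\<infinity>k. (sobolev_term v k)\<^sup>2)" by (intro infsum_nonneg) simp
  ultimately show ?thesis by (simp add: Hnorm_def)
qed

lemma Hnorm_nonneg: "0 \<le> Hnorm n v"
  unfolding Hnorm_def by (intro real_sqrt_ge_zero infsum_nonneg) simp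

lemma norm_fcoeff_le_sobolev_term:
  assumes "v \<in> H0 n"
  shows "norm (fcoeff v k) \<le> sobolev_term v k"
proof (cases "k = 0")
  case True
  then show ?thesis using assms by (simp add: H0_def sobolev_term_def)
next
  case False
  then show ?thesis
    using mult_right_mono[OF lnorm_ge_1[of k], of "norm (fcoeff v k)"] by (simp add: sobolev_term_def)
qed

lemma H0_1_component_summable:
  assumes v: "v \<in> H0 1"
  shows "(\<lambda>k. (norm ((v $ r) (fourier_basis (- k))))\<^sup>2) summable_on UNIV"
proof (rule summable_on_comparison_test[OF H0_1_summable[OF v]])
  show "(norm ((v $ r) (fourier_basis (- k))))\<^sup>2 \<le> (sobolev_term v k)\<^sup>2" for k
    using Finite_Cartesian_Product.norm_nth_le[of "fcoeff v k" r] norm_fcoeff_le_sobolev_term[OF v, of k]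
    by (intro power_mono) (auto simp: fcoeff_nth)
qed simp

lemma H0_1_partial_summable:
  assumes w: "w \<in> H0 1"
  shows "(\<lambda>k. (norm (dist_partial s (w $ r) (fourier_basis (- k))))\<^sup>2) summable_on UNIV"
proof (rule summable_on_comparison_test[OF H0_1_summable[OF w]])
  show "(norm (dist_partial s (w $ r) (fourier_basis (- k))))\<^sup>2 \<le> (sobolev_term w k)\<^sup>2" for k
  proof (rule power_mono)
    have "norm (dist_partial s (w $ r) (fourier_basis (- k))) =
        \<bar>real_of_int (k $ s)\<bar> * norm (fcoeff w k $ r)"
      using dist_partial_fourier_basis[OF H0_real_distribution[OF w]]
      by (simp add: norm_mult fcoeff_nth)
    also have "\<dots> \<le> sobolev_term w k"
      unfolding sobolev_term_def by (intro mult_mono component_le_lnorm Finite_Cartesian_Product.norm_nth_le) auto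
    finally show "norm (dist_partial s (w $ r) (fourier_basis (- k))) \<le> sobolev_term w k" .
  qed simp
qed simp

section \<open>The product\<close>

lemma of_function_cong_AE:
  fixes f g :: "real ^ 'd::finite \<Rightarrow> real"
  assumes f: "integrable torus f" and g: "integrable torus g"
    and ae: "AE x in torus. f x = g x" and \<phi>: "test_fun \<phi>"
  shows "of_function f \<phi> = of_function g \<phi>"
  unfolding of_function_torus
proof (rule integral_cong_AE)
  have "integrable torus (\<lambda>x. complex_of_real (f x))" "integrable torus (\<lambda>x. complex_of_real (g x))"
    using f g by auto
  from this[THEN integrable_mult_test_fun[OF _ \<phi>]]
  show "(\<lambda>x. complex_of_real (f x) * \<phi> x) \<in> borel_measurable torus"
       "(\<lambda>x. complex_of_real (g x) * \<phi> x) \<in> borel_measurable torus" by auto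
  show "AE x in torus. complex_of_real (f x) * \<phi> x = complex_of_real (g x) * \<phi> x"
    using ae by eventually_elim simp
qed

lemma represents_function_of: "represents f u \<Longrightarrow> represents (function_of u) u"
  unfolding function_of_def by (rule someI[where P = "\<lambda>f. represents f u"])

lemma component_represented: "v \<in> H0 1 \<Longrightarrow> represents (function_of (v $ s)) (v $ s)"
  by (rule square_summable_distribution_is_function[OF H0_real_distribution H0_1_component_summable])
    (auto intro: represents_function_of)

lemma partial_represented:
  "w \<in> H0 1 \<Longrightarrow> represents (function_of (dist_partial s (w $ r))) (dist_partial s (w $ r))"
  by (rule square_summable_distribution_is_function[OF
        real_distribution_dist_partial[OF H0_real_distribution] H0_1_partial_summable])
    (auto intro: represents_function_of)

lemma represents_mult_integrable:
  assumes f: "mean_sum c (\<lambda>x. complex_of_real (f x))" and g: "mean_sum d (\<lambda>x. complex_of_real (g x))"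
  shows "integrable torus (\<lambda>x. f x * g x)"
proof -
  have "integrable torus (\<lambda>x. complex_of_real (f x) * complex_of_real (g x))"
    using f g by (intro square_integrable_mult) (auto simp: mean_sum_def)
  then show ?thesis by (simp only: of_real_mult[symmetric] complex_of_real_integrable_eq)
qed

text \<open>Representatives are unique almost everywhere, so any of them may replace the ones chosen in the
  definition of the product.\<close>

lemma advection_represented:
  fixes v w :: "'d::finite vfield"
  assumes v: "v \<in> H0 1" and w: "w \<in> H0 1"
    and f: "\<And>s. represents (f s) (v $ s)" and g: "\<And>s. represents (g s) (dist_partial s (w $ r))"
  shows "integrable torus (\<lambda>x. f s x * g s x)"
    and "represents (\<lambda>x. \<Sum>s\<in>UNIV. f s x * g s x) (advection v w $ r)"
proof -
  let ?F = "\<lambda>s. function_of (v $ s)" and ?G = "\<lambda>s. function_of (dist_partial s (w $ r))"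
  have F: "represents (?F s) (v $ s)" and G: "represents (?G s) (dist_partial s (w $ r))" for s
    using v w by (auto intro: component_represented partial_represented)
  have prod: "integrable torus (\<lambda>x. f x * g x)"
    if "represents f (v $ s)" "represents g (dist_partial s (w $ r))" for f g s
    by (rule represents_mult_integrable)
      (rule represents_mean_sum that H0_1_component_summable[OF v] H0_1_partial_summable[OF w])+
  show fg: "integrable torus (\<lambda>x. f s x * g s x)" for s using f g by (rule prod)
  have "AE x in torus. \<forall>s\<in>UNIV. ?F s x * ?G s x = f s x * g s x"
  proof (rule AE_finite_allI)
    show "AE x in torus. ?F s x * ?G s x = f s x * g s x" for s
      using represents_unique[OF F f, of s] represents_unique[OF G g, of s] by eventually_elim simp
  qed simp
  hence ae: "AE x in torus. (\<Sum>s\<in>UNIV. ?F s x * ?G s x) = (\<Sum>s\<in>UNIV. f s x * g s x)"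
    by eventually_elim (rule sum.cong, auto)
  show "represents (\<lambda>x. \<Sum>s\<in>UNIV. f s x * g s x) (advection v w $ r)"
    unfolding represents_iff
  proof (intro conjI allI impI)
    show fgi: "integrable torus (\<lambda>x. \<Sum>s\<in>UNIV. f s x * g s x)"
      by (intro Bochner_Integration.integrable_sum fg)
    have FGi: "integrable torus (\<lambda>x. \<Sum>s\<in>UNIV. ?F s x * ?G s x)"
      by (intro Bochner_Integration.integrable_sum) (rule prod[OF F G])
    fix \<phi> :: "real ^ 'd \<Rightarrow> complex" assume "test_fun \<phi>"
    then show "(advection v w $ r) \<phi> = of_function (\<lambda>x. \<Sum>s\<in>UNIV. f s x * g s x) \<phi>"
      unfolding advection_def vec_lambda_beta by (rule of_function_cong_AE[OF FGi fgi ae])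
  qed
qed

lemma advection_well_defined_H0:
  fixes v w :: "'d::finite vfield"
  assumes v: "v \<in> H0 1" and w: "w \<in> H0 1"
  shows "advection_well_defined v w"
  unfolding advection_well_defined_def
proof (intro conjI allI impI)
  show "\<exists>f. represents f (v $ s)" for s using component_represented[OF v] by blast
  show "\<exists>g. represents g (dist_partial s (w $ r))" for r s using partial_represented[OF w] by blast
next
  fix r s and f g :: "'d \<Rightarrow> real ^ 'd \<Rightarrow> real"
  assume "\<forall>s. represents (f s) (v $ s)" "\<forall>s. represents (g s) (dist_partial s (w $ r))"
  then show "(\<lambda>x. f s x * g s x) absolutely_integrable_on cell"
    using advection_represented(1)[OF v w, of f g r s] by (simp add: torus_integrable_iff)
next
  fix r and f g :: "'d \<Rightarrow> real ^ 'd \<Rightarrow> real"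
  assume "\<forall>s. represents (f s) (v $ s)" "\<forall>s. represents (g s) (dist_partial s (w $ r))"
  then show "represents (\<lambda>x. \<Sum>s\<in>UNIV. f s x * g s x) (advection v w $ r)"
    using advection_represented(2)[OF v w, of f g r] by simp
qed

text \<open>The convolution formula for the coefficients; its summands are vectors in \<open>\<complex>\<^sup>d\<close>.\<close>

definition advection_term :: "'d::finite vfield \<Rightarrow> 'd vfield \<Rightarrow> int ^ 'd \<Rightarrow> int ^ 'd \<Rightarrow> complex ^ 'd" where
  "advection_term v w k h =
     (complex_of_real (basis_norm TYPE('d)) * \<i> * ldot (k - h) (fcoeff v h)) *s fcoeff w (k - h)"

lemma norm_advection_term_le:
  "norm (advection_term v w k h) \<le>
     basis_norm TYPE('d) * (norm (fcoeff v h) * sobolev_term w (k - h))"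
  for v w :: "'d::finite vfield"
proof -
  have "norm (advection_term v w k h) =
      basis_norm TYPE('d) * (norm (ldot (k - h) (fcoeff v h)) * norm (fcoeff w (k - h)))"
    by (simp add: advection_term_def norm_scale_vec norm_mult)
  also have "\<dots> \<le> basis_norm TYPE('d) * ((lnorm (k - h) * norm (fcoeff v h)) * norm (fcoeff w (k - h)))"
    by (intro mult_left_mono mult_right_mono norm_ldot_le) auto
  finally show ?thesis by (simp add: sobolev_term_def mult_ac)
qed

lemma H0_1_norm_summable: "v \<in> H0 1 \<Longrightarrow> (\<lambda>h. (norm (fcoeff v h))\<^sup>2) summable_on UNIV"
  by (rule summable_on_comparison_test[OF H0_1_summable])
    (auto intro!: power_mono norm_fcoeff_le_sobolev_term)

lemma H0_1_shift_summable: "w \<in> H0 1 \<Longrightarrow> (\<lambda>h. (sobolev_term w (k - h))\<^sup>2) summable_on UNIV"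
  using H0_1_summable[of w] summable_on_reflect[of "\<lambda>h. (sobolev_term w h)\<^sup>2" k] by simp

lemma advection_majorant_summable:
  fixes v w :: "'d::finite vfield"
  assumes v: "v \<in> H0 1" and w: "w \<in> H0 1"
  shows "(\<lambda>h. norm (fcoeff v h) * sobolev_term w (k - h)) summable_on UNIV"
  by (intro square_summable_mult(1) H0_1_norm_summable v H0_1_shift_summable w)
    (auto simp: sobolev_term_def)

lemma advection_term_abs_summable:
  assumes v: "v \<in> H0 1" and w: "w \<in> H0 1"
  shows "(\<lambda>h. norm (advection_term v w k h)) summable_on UNIV"
  by (rule summable_on_comparison_test[OF summable_on_cmult_right[OF advection_majorant_summable[OF v w]]])
    (rule norm_advection_term_le, simp)

lemma fcoeff_advection:
  fixes v w :: "'d::finite vfield"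
  assumes v: "v \<in> H0 1" and w: "w \<in> H0 1"
  shows "(advection_term v w k has_sum fcoeff (advection v w) k) UNIV"
proof -
  let ?b = "complex_of_real (basis_norm TYPE('d))"
  have sum: "(advection_term v w k has_sum infsum (advection_term v w k) UNIV) UNIV"
    using abs_summable_summable[OF advection_term_abs_summable[OF v w]] by (rule has_sum_infsum)
  have "infsum (advection_term v w k) UNIV $ r = fcoeff (advection v w) k $ r" for r
  proof -
    define f g where "f s = function_of (v $ s)" and "g s = function_of (dist_partial s (w $ r))" for s
    have f: "represents (f s) (v $ s)" and g: "represents (g s) (dist_partial s (w $ r))" for s
      unfolding f_def g_def using v w by (auto intro: component_represented partial_represented)
    let ?c = "\<lambda>s k. (v $ s) (fourier_basis (- k))"
    let ?d = "\<lambda>s k. dist_partial s (w $ r) (fourier_basis (- k))"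
    have mf: "mean_sum (?c s) (\<lambda>x. complex_of_real (f s x))" for s
      by (rule represents_mean_sum[OF f H0_1_component_summable[OF v]])
    have mg: "mean_sum (?d s) (\<lambda>x. complex_of_real (g s x))" for s
      by (rule represents_mean_sum[OF g H0_1_partial_summable[OF w]])
    have i: "integrable torus (\<lambda>x. complex_of_real (f s x) * complex_of_real (g s x) * fourier_basis (- k) x)" for s
      using mf mg by (intro integrable_mult_test_fun square_integrable_mult test_fun_fourier_basis)
        (auto simp: mean_sum_def)
    have "((\<lambda>h. \<Sum>s\<in>UNIV. ?b * (?c s h * ?d s (k - h))) has_sum
        (\<Sum>s\<in>UNIV. fourier_coeff (\<lambda>x. complex_of_real (f s x) * complex_of_real (g s x)) k)) UNIV"
      by (intro has_sum_finite_sum fourier_coeff_mult mf mg) simp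
    also have "(\<Sum>s\<in>UNIV. fourier_coeff (\<lambda>x. complex_of_real (f s x) * complex_of_real (g s x)) k) =
        of_function (\<lambda>x. \<Sum>s\<in>UNIV. f s x * g s x) (fourier_basis (- k))"
      unfolding of_function_torus fourier_coeff_def
      using i by (simp add: sum_distrib_right)
    also have "\<dots> = fcoeff (advection v w) k $ r"
      using advection_represented(2)[OF v w f g] by (simp add: represents_iff fcoeff_nth)
    also have "(\<lambda>h. \<Sum>s\<in>UNIV. ?b * (?c s h * ?d s (k - h))) = (\<lambda>h. advection_term v w k h $ r)"
    proof
      fix h
      have "?d s (k - h) = \<i> * of_int ((k - h) $ s) * fcoeff w (k - h) $ r" for s
        by (simp only: dist_partial_fourier_basis[OF H0_real_distribution[OF w]] fcoeff_nth)
      then show "(\<Sum>s\<in>UNIV. ?b * (?c s h * ?d s (k - h))) = advection_term v w k h $ r"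
        by (simp add: advection_term_def ldot_def fcoeff_nth sum_distrib_left sum_distrib_right mult_ac)
    qed
    finally have "((\<lambda>h. advection_term v w k h $ r) has_sum fcoeff (advection v w) k $ r) UNIV" .
    moreover have "((\<lambda>h. advection_term v w k h $ r) has_sum infsum (advection_term v w k) UNIV $ r) UNIV"
      by (rule has_sum_bounded_linear[OF bounded_linear_vec_nth sum])
    ultimately show ?thesis by (rule has_sum_unique[symmetric])
  qed
  hence "infsum (advection_term v w k) UNIV = fcoeff (advection v w) k" by (simp add: vec_eq_iff)
  with sum show ?thesis by simp
qed

lemma norm_fcoeff_advection_le:
  fixes v w :: "'d::finite vfield"
  assumes v: "v \<in> H0 1" and w: "w \<in> H0 1"
  shows "norm (fcoeff (advection v w) k) \<le>
    basis_norm TYPE('d) * (\<Sum>\<^sub>\<infinity>h. norm (fcoeff v h) * sobolev_term w (k - h))"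
proof -
  have "fcoeff (advection v w) k = infsum (advection_term v w k) UNIV"
    using fcoeff_advection[OF v w] by (rule infsumI[symmetric])
  also have "norm \<dots> \<le> (\<Sum>\<^sub>\<infinity>h. norm (advection_term v w k h))"
    by (rule norm_infsum_bound[OF advection_term_abs_summable[OF v w]])
  also have "\<dots> \<le> (\<Sum>\<^sub>\<infinity>h. basis_norm TYPE('d) * (norm (fcoeff v h) * sobolev_term w (k - h)))"
    by (intro infsum_mono advection_term_abs_summable v w norm_advection_term_le
        summable_on_cmult_right advection_majorant_summable)
  also have "\<dots> = basis_norm TYPE('d) * (\<Sum>\<^sub>\<infinity>h. norm (fcoeff v h) * sobolev_term w (k - h))"
    by (rule infsum_cmult_right')
  finally show ?thesis .
qed

text \<open>At \<open>k = 0\<close> every term of the convolution contains the factor \<open>- h \<cdot> v\<^sub>h\<close>, which vanishes for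
  divergence-free \<open>v\<close>.\<close>

lemma fcoeff_advection_0:
  assumes v: "v \<in> HSigma0 1" and w: "w \<in> H0 1"
  shows "fcoeff (advection v w) 0 = 0"
proof -
  have "advection_term v w 0 = (\<lambda>h. 0)"
    using v by (auto simp: advection_term_def HSigma0_def fun_eq_iff ldot_minus)
  moreover have "(advection_term v w 0 has_sum fcoeff (advection v w) 0) UNIV"
    using v w by (intro fcoeff_advection) (auto simp: HSigma0_def)
  ultimately show ?thesis by (metis has_sum_0 has_sum_unique)
qed

lemma vector_field_advection:
  assumes v: "v \<in> H0 1" and w: "w \<in> H0 1"
  shows "vector_field (advection v w)"
  unfolding vector_field_def
proof
  fix r
  let ?F = "\<lambda>s. function_of (v $ s)" and ?G = "\<lambda>s. function_of (dist_partial s (w $ r))"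
  have "represents (\<lambda>x. \<Sum>s\<in>UNIV. ?F s x * ?G s x) (advection v w $ r)"
    by (intro advection_represented(2) component_represented partial_represented v w)
  then show "real_distribution (advection v w $ r)"
    by (simp add: represents_iff real_distribution_of_function advection_def)
qed

lemma H0_I:
  assumes "vector_field u" "fcoeff u 0 = 0" "0 \<le> B"
    and le: "\<And>F. finite F \<Longrightarrow> 0 \<notin> F \<Longrightarrow>
      (\<Sum>k\<in>F. lnorm k powr (2 * n) * (norm (fcoeff u k))\<^sup>2) \<le> B\<^sup>2"
  shows "u \<in> H0 n" "Hnorm n u \<le> B"
proof -
  let ?f = "\<lambda>k. lnorm k powr (2 * n) * (norm (fcoeff u k))\<^sup>2"
  have s: "?f summable_on (UNIV - {0})"
    by (rule nonneg_bdd_above_summable_on) (use le in \<open>auto intro!: bdd_aboveI2\<close>)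
  then show "u \<in> H0 n" using assms by (simp add: H0_def)
  have "infsum ?f (UNIV - {0}) \<le> B\<^sup>2"
    using s by (rule infsum_le_finite_sums) (use le in auto)
  then show "Hnorm n u \<le> B"
    unfolding Hnorm_def using assms(3) by (intro real_le_lsqrt infsum_nonneg) auto
qed

text \<open>By the Cauchy--Schwarz inequality for the convolution. This bound, uniform in \<open>k\<close>, makes the
  projected series converge on test functions.\<close>

lemma fcoeff_advection_bounded:
  fixes v w :: "'d::finite vfield"
  assumes v: "v \<in> H0 1" and w: "w \<in> H0 1"
  obtains B where "\<And>k. norm (fcoeff (advection v w) k) \<le> B"
proof -
  let ?B = "basis_norm TYPE('d) * (sqrt (\<Sum>\<^sub>\<infinity>h. (norm (fcoeff v h))\<^sup>2) * sqrt (\<Sum>\<^sub>\<infinity>h. (sobolev_term w h)\<^sup>2))"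
  have "norm (fcoeff (advection v w) k) \<le> ?B" for k
  proof -
    have "(\<Sum>\<^sub>\<infinity>h. norm (fcoeff v h) * sobolev_term w (k - h)) \<le>
        sqrt (\<Sum>\<^sub>\<infinity>h. (norm (fcoeff v h))\<^sup>2) * sqrt (\<Sum>\<^sub>\<infinity>h. (sobolev_term w (k - h))\<^sup>2)"
      by (intro square_summable_mult(2) H0_1_norm_summable v H0_1_shift_summable w)
        (auto simp: sobolev_term_def)
    also have "(\<Sum>\<^sub>\<infinity>h. (sobolev_term w (k - h))\<^sup>2) = (\<Sum>\<^sub>\<infinity>h. (sobolev_term w h)\<^sup>2)"
      by (rule infsum_reflect)
    finally show ?thesis
      using norm_fcoeff_advection_le[OF v w, of k] mult_left_mono[OF _ less_imp_le[OF basis_norm_pos(1)[where 'd = 'd]]]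
      by (meson order_trans)
  qed
  then show thesis by (rule that)
qed

text \<open>The coefficients are dominated by the convolution of \<open>\<bar>v\<^sub>h\<bar>\<close> with \<open>\<bar>l\<bar> \<bar>w\<^sub>l\<bar>\<close>, to which the
  convolution inequality applies; the bound on the supremum of the kernel absorbs the squared modulus
  of the exponentials.\<close>

theorem advection_estimate:
  fixes v w :: "'d::finite vfield"
  assumes d: "CARD('d) \<ge> 2" and \<omega>: "\<omega> > real CARD('d) / 2 - 1" and K0: "K > 0"
    and K: "1 / (2 * pi) powr (real CARD('d) / 2) *
           sqrt (SUP k \<in> UNIV - {0 :: int ^ 'd}. Kfun \<omega> k) \<le> K"
    and v: "v \<in> HSigma0 1" and w: "w \<in> H0 1"
  shows "advection v w \<in> H0 (- \<omega>)" "Hnorm (- \<omega>) (advection v w) \<le> K * Hnorm 1 v * Hnorm 1 w"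
proof -
  let ?b = "basis_norm TYPE('d)"
  let ?z = "\<lambda>k. \<Sum>\<^sub>\<infinity>h. norm (fcoeff v h) * sobolev_term w (k - h)"
  have v0: "v \<in> H0 1" using v by (simp add: HSigma0_def)
  have \<omega>0: "\<omega> > 0"
  proof -
    have "real CARD('d) \<ge> 2" using d by linarith
    with \<omega> show ?thesis by linarith
  qed
  have Kf: "Kfun \<omega> k \<le> K\<^sup>2 / ?b\<^sup>2" if "k \<noteq> 0" for k :: "int ^ 'd"
    using Kfun_le_of_SUP[OF \<omega>0 \<omega> that _ K] K0 by (simp add: field_simps)
  have B: "0 \<le> K * Hnorm 1 v * Hnorm 1 w" using K0 by (simp add: Hnorm_nonneg)
  have le: "(\<Sum>k\<in>F. lnorm k powr (2 * - \<omega>) * (norm (fcoeff (advection v w) k))\<^sup>2) \<le>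
      (K * Hnorm 1 v * Hnorm 1 w)\<^sup>2" if F: "finite F" "0 \<notin> F" for F :: "(int ^ 'd) set"
  proof -
    have "(\<Sum>k\<in>F. lnorm k powr (2 * - \<omega>) * (norm (fcoeff (advection v w) k))\<^sup>2) \<le>
        (\<Sum>k\<in>F. ?b\<^sup>2 * (lnorm k powr (- \<omega>) * ?z k)\<^sup>2)"
    proof (rule sum_mono)
      fix k :: "int ^ 'd"
      have "lnorm k powr (2 * - \<omega>) = (lnorm k powr (- \<omega>))\<^sup>2"
        by (simp add: power2_eq_square flip: powr_add)
      moreover have "(norm (fcoeff (advection v w) k))\<^sup>2 \<le> (?b * ?z k)\<^sup>2"
        by (intro power_mono norm_fcoeff_advection_le v0 w) simp
      ultimately have "lnorm k powr (2 * - \<omega>) * (norm (fcoeff (advection v w) k))\<^sup>2 \<le>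
          (lnorm k powr (- \<omega>))\<^sup>2 * (?b * ?z k)\<^sup>2"
        by (simp only: mult_left_mono zero_le_power2)
      then show "lnorm k powr (2 * - \<omega>) * (norm (fcoeff (advection v w) k))\<^sup>2 \<le>
          ?b\<^sup>2 * (lnorm k powr (- \<omega>) * ?z k)\<^sup>2"
        by (simp only: power_mult_distrib mult_ac)
    qed
    also have "\<dots> = ?b\<^sup>2 * (\<Sum>k\<in>F. (lnorm k powr (- \<omega>) * ?z k)\<^sup>2)" by (simp add: sum_distrib_left)
    also have "\<dots> \<le> ?b\<^sup>2 * (K\<^sup>2 / ?b\<^sup>2 * (\<Sum>\<^sub>\<infinity>h. (lnorm h * norm (fcoeff v h))\<^sup>2) * (\<Sum>\<^sub>\<infinity>h. (sobolev_term w h)\<^sup>2))"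
      using v0 H0_1_summable[OF v0] H0_1_summable[OF w]
      by (intro mult_left_mono convolution_inequality \<omega>0 \<omega> Kf F) (auto simp: sobolev_term_def H0_def)
    also have "\<dots> = (K * Hnorm 1 v * Hnorm 1 w)\<^sup>2"
      unfolding power_mult_distrib[of _ "Hnorm 1 _"] Hnorm_1_square sobolev_term_def by simp
    finally show ?thesis .
  qed
  show "advection v w \<in> H0 (- \<omega>)" "Hnorm (- \<omega>) (advection v w) \<le> K * Hnorm 1 v * Hnorm 1 w"
    using H0_I[OF vector_field_advection[OF v0 w] fcoeff_advection_0[OF v w] B le] by auto
qed

section \<open>The Leray projection\<close>

lemma lnorm_square: "(lnorm k)\<^sup>2 = (\<Sum>r\<in>UNIV. (real_of_int (k $ r))\<^sup>2)"
  for k :: "int ^ 'd::finite"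
  by (simp add: lnorm_def norm_vec_def L2_set_def sum_nonneg)

lemma ldot_leray_coeff: "ldot k (leray_coeff k c) = 0"
  for c :: "complex ^ 'd::finite"
proof (cases "k = 0")
  case False
  define \<alpha> where "\<alpha> = ldot k c / complex_of_real ((lnorm k)\<^sup>2)"
  have "complex_of_real ((lnorm k)\<^sup>2) \<noteq> 0" using lnorm_ge_1[OF False] by simp
  hence \<alpha>: "\<alpha> * complex_of_real ((lnorm k)\<^sup>2) = ldot k c" by (simp add: \<alpha>_def)
  have "leray_coeff k c $ r = c $ r - \<alpha> * of_int (k $ r)" for r
    using False by (simp add: leray_coeff_def \<alpha>_def)
  hence "ldot k (leray_coeff k c) = ldot k c - \<alpha> * (\<Sum>r\<in>UNIV. (of_int (k $ r))\<^sup>2)"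
    by (simp add: ldot_def right_diff_distrib sum_subtractf sum_distrib_left power2_eq_square mult_ac)
  also have "(\<Sum>r\<in>UNIV. (of_int (k $ r))\<^sup>2) = complex_of_real ((lnorm k)\<^sup>2)"
    unfolding lnorm_square by simp
  finally show ?thesis using \<alpha> by simp
qed simp

lemma cmod_diff_real_multiple:
  "(cmod (z - \<alpha> * complex_of_real x))\<^sup>2 =
    (cmod z)\<^sup>2 - 2 * Re (cnj \<alpha> * (complex_of_real x * z)) + (cmod \<alpha>)\<^sup>2 * x\<^sup>2"
  unfolding cmod_power2 by (simp add: power2_eq_square algebra_simps)

text \<open>Pythagoras: the removed component is orthogonal to what remains.\<close>

lemma norm_leray_coeff_le: "norm (leray_coeff k c) \<le> norm c"
  for c :: "complex ^ 'd::finite"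
proof (cases "k = 0")
  case True
  then show ?thesis by (simp add: leray_coeff_def)
next
  case False
  define \<alpha> where "\<alpha> = ldot k c / complex_of_real ((lnorm k)\<^sup>2)"
  have "complex_of_real ((lnorm k)\<^sup>2) \<noteq> 0" using lnorm_ge_1[OF False] by simp
  hence \<alpha>: "\<alpha> * complex_of_real ((lnorm k)\<^sup>2) = ldot k c" by (simp add: \<alpha>_def)
  have nsq: "(norm x)\<^sup>2 = (\<Sum>r\<in>UNIV. (norm (x $ r))\<^sup>2)" for x :: "complex ^ 'd"
    by (simp add: norm_vec_def L2_set_def sum_nonneg)
  have comp: "(norm (leray_coeff k c $ r))\<^sup>2 =
      (norm (c $ r))\<^sup>2 - 2 * Re (cnj \<alpha> * (of_int (k $ r) * c $ r)) + (norm \<alpha>)\<^sup>2 * (real_of_int (k $ r))\<^sup>2" for r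
  proof -
    have "leray_coeff k c $ r = c $ r - \<alpha> * complex_of_real (real_of_int (k $ r))"
      using False by (simp add: leray_coeff_def \<alpha>_def)
    then show ?thesis using cmod_diff_real_multiple[of "c $ r" \<alpha> "real_of_int (k $ r)"] by simp
  qed
  have "(norm (leray_coeff k c))\<^sup>2 = (norm c)\<^sup>2 - 2 * Re (cnj \<alpha> * ldot k c) + (norm \<alpha>)\<^sup>2 * (lnorm k)\<^sup>2"
    unfolding nsq comp lnorm_square ldot_def
    by (simp add: sum.distrib sum_subtractf sum_distrib_left)
  also have "cnj \<alpha> * ldot k c = complex_of_real ((norm \<alpha>)\<^sup>2 * (lnorm k)\<^sup>2)"
    unfolding \<alpha>[symmetric] of_real_mult complex_norm_square by (simp add: mult_ac)
  finally have "(norm (leray_coeff k c))\<^sup>2 = (norm c)\<^sup>2 - (norm \<alpha>)\<^sup>2 * (lnorm k)\<^sup>2" by simp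
  hence "(norm (leray_coeff k c))\<^sup>2 \<le> (norm c)\<^sup>2" by simp
  then show ?thesis by (rule power2_le_imp_le) simp
qed

text \<open>Reality of a field is a symmetry of its coefficients that the projection respects.\<close>

lemma leray_coeff_minus:
  fixes c c' :: "complex ^ 'd::finite"
  assumes "\<And>r. c' $ r = cnj (c $ r)"
  shows "leray_coeff (- k) c' $ r = cnj (leray_coeff k c $ r)"
proof -
  have "ldot (- k) c' = - cnj (ldot k c)" using assms by (simp add: ldot_def sum_negf)
  then show ?thesis using assms by (simp add: leray_coeff_def)
qed

lemma scaleR_complex_nth: "(a *\<^sub>R c) $ r = complex_of_real a * c $ r"
  for c :: "complex ^ 'd::finite"
  by (simp add: scaleR_conv_of_real[of a "c $ r"])

lemma ldot_linear: "ldot k (a *\<^sub>R c + b *\<^sub>R c') = of_real a * ldot k c + of_real b * ldot k c'"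
  for c c' :: "complex ^ 'd::finite"
  by (simp add: ldot_def scaleR_complex_nth distrib_left sum.distrib sum_distrib_left mult.left_commute
      del: vector_scaleR_component)

lemma leray_coeff_linear:
  "leray_coeff k (a *\<^sub>R c + b *\<^sub>R c') = a *\<^sub>R leray_coeff k c + b *\<^sub>R leray_coeff k c'"
  for c c' :: "complex ^ 'd::finite"
  by (simp add: leray_coeff_def vec_eq_iff scaleR_complex_nth ldot_linear algebra_simps add_divide_distrib
      del: vector_scaleR_component)

text \<open>A series with bounded coefficients defines a distribution, because the coefficients of test
  functions are summable with a bound by finitely many derivatives.\<close>

definition series_distribution :: "(int ^ 'd \<Rightarrow> complex) \<Rightarrow> 'd::finite functional" where
  "series_distribution l = (\<lambda>\<phi>. \<Sum>\<^sub>\<infinity>k. l k * (\<integral>x. fourier_basis k x * \<phi> x \<partial>torus))"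

lemma series_distribution_summable:
  fixes l :: "int ^ 'd::finite \<Rightarrow> complex"
  assumes l: "\<And>k. norm (l k) \<le> B" and B: "0 \<le> B"
  shows "\<exists>C. \<forall>\<phi>. test_fun \<phi> \<longrightarrow> norm (series_distribution l \<phi>) \<le> C * test_norm (CARD('d) + 1) \<phi>"
    and "\<And>\<phi>. test_fun \<phi> \<Longrightarrow> (\<lambda>k. l k * (\<integral>x. fourier_basis k x * \<phi> x \<partial>torus)) summable_on UNIV"
proof -
  define C where "C = (real CARD('d) ^ (CARD('d) + 2) + 1) / basis_norm TYPE('d)"
  let ?t = "test_norm (CARD('d) + 1) :: (real ^ 'd \<Rightarrow> complex) \<Rightarrow> real"
  let ?f = "\<lambda>\<phi> k. l k * (\<integral>x. fourier_basis k x * \<phi> x \<partial>torus)"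
  have le: "norm (?f \<phi> k) \<le> B * C * ?t \<phi> * lattice_weight k" if \<phi>: "test_fun \<phi>" for \<phi> k
  proof -
    have "(\<integral>x. fourier_basis k x * \<phi> x \<partial>torus) = fourier_coeff \<phi> (- k)"
      by (simp add: fourier_coeff_def mult.commute)
    moreover have "lattice_weight (- k) = lattice_weight k" by (simp add: lattice_weight_def)
    ultimately have "norm (\<integral>x. fourier_basis k x * \<phi> x \<partial>torus) \<le> C * ?t \<phi> * lattice_weight k"
      using fourier_coeff_decay[OF \<phi>, of "- k"] by (simp add: C_def)
    hence "norm (?f \<phi> k) \<le> B * (C * ?t \<phi> * lattice_weight k)"
      unfolding norm_mult by (intro mult_mono l B) auto
    then show ?thesis by (simp add: mult_ac)
  qed
  have ab: "(\<lambda>k. norm (?f \<phi> k)) summable_on UNIV" if "test_fun \<phi>" for \<phi>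
    by (rule summable_on_comparison_test[OF summable_on_cmult_right[OF lattice_weight_summable]])
      (rule le[OF that], simp)
  show "?f \<phi> summable_on UNIV" if "test_fun \<phi>" for \<phi>
    using ab[OF that] by (rule abs_summable_summable)
  have "norm (series_distribution l \<phi>) \<le> (B * C * infsum lattice_weight (UNIV :: (int ^ 'd) set)) * ?t \<phi>"
    if \<phi>: "test_fun \<phi>" for \<phi>
  proof -
    have "norm (series_distribution l \<phi>) \<le> (\<Sum>\<^sub>\<infinity>k. norm (?f \<phi> k))"
      unfolding series_distribution_def by (rule norm_infsum_bound[OF ab[OF \<phi>]])
    also have "\<dots> \<le> (\<Sum>\<^sub>\<infinity>k :: int ^ 'd. B * C * ?t \<phi> * lattice_weight k)"
    proof (rule infsum_mono)
      show "(\<lambda>k :: int ^ 'd. B * C * ?t \<phi> * lattice_weight k) summable_on UNIV"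
        by (rule summable_on_cmult_right[OF lattice_weight_summable])
    qed (rule ab[OF \<phi>], rule le[OF \<phi>])
    also have "\<dots> = (B * C * infsum lattice_weight (UNIV :: (int ^ 'd) set)) * ?t \<phi>"
      by (simp add: infsum_cmult_right')
    finally show ?thesis .
  qed
  then show "\<exists>C. \<forall>\<phi>. test_fun \<phi> \<longrightarrow> norm (series_distribution l \<phi>) \<le> C * ?t \<phi>" by blast
qed

text \<open>The reality of the sum comes from pairing the terms of \<open>k\<close> and \<open>-k\<close>.\<close>

lemma real_distribution_series:
  fixes l :: "int ^ 'd::finite \<Rightarrow> complex"
  assumes l: "\<And>k. norm (l k) \<le> B" and sym: "\<And>k. l (- k) = cnj (l k)"
  shows "real_distribution (series_distribution l)"
proof -
  let ?u = "series_distribution l"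
  let ?f = "\<lambda>\<phi> k. l k * (\<integral>x. fourier_basis k x * \<phi> x \<partial>torus)"
  have B: "0 \<le> B" using l[of 0] norm_ge_zero order_trans by blast
  obtain C where "\<forall>\<phi>. test_fun \<phi> \<longrightarrow> norm (?u \<phi>) \<le> C * test_norm (CARD('d) + 1) \<phi>"
    using series_distribution_summable(1)[OF l B] by (rule exE)
  then have C: "norm (?u \<phi>) \<le> C * test_norm (CARD('d) + 1) \<phi>" if "test_fun \<phi>" for \<phi>
    using that by simp
  have s: "?f \<phi> summable_on UNIV" if "test_fun \<phi>" for \<phi>
    using l B that by (rule series_distribution_summable(2))
  have "distribution ?u"
  proof (rule distributionI)
    fix \<phi> \<psi> :: "real ^ 'd \<Rightarrow> complex" assume \<phi>: "test_fun \<phi>" and \<psi>: "test_fun \<psi>"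
    have i: "integrable torus (\<lambda>x. fourier_basis k x * \<phi> x)" if "test_fun \<phi>" for k and \<phi> :: "real ^ 'd \<Rightarrow> complex"
      by (intro integrable_mult_test_fun integrable_test_fun test_fun_fourier_basis that)
    have "?f (\<lambda>x. \<phi> x + \<psi> x) = (\<lambda>k. ?f \<phi> k + ?f \<psi> k)"
      using i[OF \<phi>] i[OF \<psi>] by (simp add: distrib_left)
    then show "?u (\<lambda>x. \<phi> x + \<psi> x) = ?u \<phi> + ?u \<psi>"
      unfolding series_distribution_def using infsum_add[OF s[OF \<phi>] s[OF \<psi>]] by simp
  next
    fix c and \<phi> :: "real ^ 'd \<Rightarrow> complex"
    have "?f (\<lambda>x. c * \<phi> x) = (\<lambda>k. c * ?f \<phi> k)" by (simp add: mult.left_commute[of _ c])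
    then show "?u (\<lambda>x. c * \<phi> x) = c * ?u \<phi>"
      unfolding series_distribution_def by (simp add: infsum_cmult_right')
  qed (rule C)
  moreover have "?u (\<lambda>x. cnj (\<phi> x)) = cnj (?u \<phi>)" for \<phi>
  proof -
    have "?f (\<lambda>x. cnj (\<phi> x)) (- k) = cnj (?f \<phi> k)" for k
      using Bochner_Integration.integral_cnj[of torus "\<lambda>x. fourier_basis k x * \<phi> x"]
      by (simp add: sym cnj_fourier_basis)
    hence "cnj (?u \<phi>) = (\<Sum>\<^sub>\<infinity>k. ?f (\<lambda>x. cnj (\<phi> x)) (0 - k))"
      unfolding series_distribution_def by (simp flip: infsum_cnj)
    also have "\<dots> = ?u (\<lambda>x. cnj (\<phi> x))"
      unfolding series_distribution_def by (rule infsum_reflect)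
    finally show ?thesis by simp
  qed
  ultimately show ?thesis by (simp add: real_distribution_def)
qed

lemma series_distribution_fourier_basis:
  fixes l :: "int ^ 'd::finite \<Rightarrow> complex"
  shows "series_distribution l (fourier_basis (- m)) = l m"
  unfolding series_distribution_def fourier_basis_orthonormal
  by (rule infsumI, rule has_sum_finite_neutralI[where B = "{m}"]) auto

lemma leray_series:
  "leray u $ r = series_distribution (\<lambda>k. leray_coeff k (fcoeff u k) $ r)"
  by (simp add: leray_def series_distribution_def torus_set_integral)

lemma fcoeff_leray: "fcoeff (leray u) k = leray_coeff k (fcoeff u k)"
  by (simp add: vec_eq_iff fcoeff_nth[of "leray u"] leray_series series_distribution_fourier_basis)

lemma norm_leray_coeff_nth_le: "norm (leray_coeff k c $ r) \<le> norm c"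
  for c :: "complex ^ 'd::finite"
  using Finite_Cartesian_Product.norm_nth_le norm_leray_coeff_le by (rule order_trans)

lemma vector_field_leray:
  assumes u: "vector_field u" and B: "\<And>k. norm (fcoeff u k) \<le> B"
  shows "vector_field (leray u)"
  unfolding vector_field_def
proof
  fix r
  show "real_distribution (leray u $ r)"
    unfolding leray_series
  proof (rule real_distribution_series)
    show "norm (leray_coeff k (fcoeff u k) $ r) \<le> B" for k
      using norm_leray_coeff_nth_le B by (rule order_trans)
    have "fcoeff u (- k) $ s = cnj (fcoeff u k $ s)" for k s
      using real_distribution_fourier_basis[of "u $ s" "- k"] u
      by (simp add: fcoeff_nth vector_field_def)
    then show "leray_coeff (- k) (fcoeff u (- k)) $ r = cnj (leray_coeff k (fcoeff u k) $ r)" for k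
      by (rule leray_coeff_minus)
  qed
qed

lemma leray_estimate:
  assumes u: "u \<in> H0 n" and B: "\<And>k. norm (fcoeff u k) \<le> B"
  shows "leray u \<in> HSigma0 n" "Hnorm n (leray u) \<le> Hnorm n u"
proof -
  let ?f = "\<lambda>u k. lnorm k powr (2 * n) * (norm (fcoeff u k))\<^sup>2"
  have s: "?f u summable_on (UNIV - {0})" using u by (simp add: H0_def)
  have le: "?f (leray u) k \<le> ?f u k" for k
    unfolding fcoeff_leray by (intro mult_left_mono power_mono norm_leray_coeff_le) auto
  have s': "?f (leray u) summable_on (UNIV - {0})"
    by (rule summable_on_comparison_test[OF s]) (use le in auto)
  show "leray u \<in> HSigma0 n"
    using s' vector_field_leray[OF _ B] u
    by (auto simp: HSigma0_def H0_def fcoeff_leray ldot_leray_coeff leray_coeff_def[of 0])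
  show "Hnorm n (leray u) \<le> Hnorm n u"
    unfolding Hnorm_def by (intro real_sqrt_le_mono infsum_mono s s' le)
qed

section \<open>Linear combinations\<close>

lemma fcoeff_lin_comb: "fcoeff (lin_comb a v b w) k = a *\<^sub>R fcoeff v k + b *\<^sub>R fcoeff w k"
  by (simp add: vec_eq_iff fcoeff_nth lin_comb_def scaleR_complex_nth del: vector_scaleR_component)

lemma lin_comb_nth:
  "(lin_comb a v b w $ r) = (\<lambda>\<phi>. complex_of_real a * (v $ r) \<phi> + complex_of_real b * (w $ r) \<phi>)"
  by (simp add: lin_comb_def)

lemma vector_field_lin_comb:
  fixes v w :: "'d::finite vfield"
  assumes "vector_field v" "vector_field w"
  shows "vector_field (lin_comb a v b w)"
  unfolding vector_field_def
proof
  fix r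
  have rv: "real_distribution (v $ r)" and rw: "real_distribution (w $ r)"
    using assms by (auto simp: vector_field_def)
  hence dv: "distribution (v $ r)" and dw: "distribution (w $ r)" by (auto simp: real_distribution_def)
  obtain C N where C0: "0 \<le> C" and C: "\<And>\<phi>. test_fun \<phi> \<Longrightarrow> norm ((v $ r) \<phi>) \<le> C * test_norm N \<phi>"
    using distribution_bound[OF dv] by metis
  obtain C' N' where C0': "0 \<le> C'" and C': "\<And>\<phi>. test_fun \<phi> \<Longrightarrow> norm ((w $ r) \<phi>) \<le> C' * test_norm N' \<phi>"
    using distribution_bound[OF dw] by metis
  have mono: "test_norm M \<phi> \<le> test_norm (N + N') \<phi>" if "M \<le> N + N'" "test_fun \<phi>"
    for M and \<phi> :: "real ^ 'd \<Rightarrow> complex"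
    unfolding test_norm_def using that
    by (intro sum_mono2) (auto intro: SUP_partials_nonneg finite_short_lists)
  have "distribution (lin_comb a v b w $ r)"
    unfolding lin_comb_nth
  proof (rule distributionI)
    fix \<phi> :: "real ^ 'd \<Rightarrow> complex" assume \<phi>: "test_fun \<phi>"
    let ?t = "test_norm (N + N') \<phi>"
    have "norm ((v $ r) \<phi>) \<le> C * ?t"
      using C[OF \<phi>] mult_left_mono[OF mono[OF _ \<phi>, of N] C0] by simp
    moreover have "norm ((w $ r) \<phi>) \<le> C' * ?t"
      using C'[OF \<phi>] mult_left_mono[OF mono[OF _ \<phi>, of N'] C0'] by simp
    ultimately have "\<bar>a\<bar> * norm ((v $ r) \<phi>) + \<bar>b\<bar> * norm ((w $ r) \<phi>) \<le> \<bar>a\<bar> * (C * ?t) + \<bar>b\<bar> * (C' * ?t)"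
      by (intro add_mono mult_left_mono) auto
    moreover have "norm (complex_of_real a * (v $ r) \<phi> + complex_of_real b * (w $ r) \<phi>) \<le>
        \<bar>a\<bar> * norm ((v $ r) \<phi>) + \<bar>b\<bar> * norm ((w $ r) \<phi>)"
      by (rule order_trans[OF norm_triangle_ineq]) (simp add: norm_mult)
    ultimately show "norm (complex_of_real a * (v $ r) \<phi> + complex_of_real b * (w $ r) \<phi>) \<le>
        (\<bar>a\<bar> * C + \<bar>b\<bar> * C') * ?t"
      by (simp add: algebra_simps)
  qed (simp_all add: distribution_add[OF dv] distribution_add[OF dw]
      distribution_cmult[OF dv] distribution_cmult[OF dw] algebra_simps)
  moreover have "(lin_comb a v b w $ r) (\<lambda>x. cnj (\<phi> x)) = cnj ((lin_comb a v b w $ r) \<phi>)"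
    if "test_fun \<phi>" for \<phi>
    using rv rw that by (simp add: lin_comb_nth real_distribution_def)
  ultimately show "real_distribution (lin_comb a v b w $ r)"
    by (simp add: real_distribution_def)
qed

lemma norm_lin_comb_square_le:
  fixes x y :: "'a::real_normed_vector"
  shows "(norm (a *\<^sub>R x + b *\<^sub>R y))\<^sup>2 \<le> 2 * a\<^sup>2 * (norm x)\<^sup>2 + 2 * b\<^sup>2 * (norm y)\<^sup>2"
proof -
  have "(norm (a *\<^sub>R x + b *\<^sub>R y))\<^sup>2 \<le> (\<bar>a\<bar> * norm x + \<bar>b\<bar> * norm y)\<^sup>2"
    by (rule power_mono) (use norm_triangle_ineq[of "a *\<^sub>R x" "b *\<^sub>R y"] in auto)
  also have "\<dots> \<le> 2 * (\<bar>a\<bar> * norm x)\<^sup>2 + 2 * (\<bar>b\<bar> * norm y)\<^sup>2"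
    using sum_squares_bound[of "\<bar>a\<bar> * norm x" "\<bar>b\<bar> * norm y"] by (simp add: power2_sum)
  finally show ?thesis by (simp add: power_mult_distrib)
qed

lemma
  fixes v w :: "'d::finite vfield"
  assumes v: "v \<in> H0 n" and w: "w \<in> H0 n"
  shows H0_lin_comb: "lin_comb a v b w \<in> H0 n"
    and Hnorm_lin_comb_le: "(Hnorm n (lin_comb a v b w))\<^sup>2 \<le> 2 * a\<^sup>2 * (Hnorm n v)\<^sup>2 + 2 * b\<^sup>2 * (Hnorm n w)\<^sup>2"
proof -
  let ?f = "\<lambda>u k. lnorm k powr (2 * n) * (norm (fcoeff u k))\<^sup>2" and ?Z = "UNIV - {0 :: int ^ 'd}"
  have sv: "?f v summable_on ?Z" and sw: "?f w summable_on ?Z" using v w by (auto simp: H0_def)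
  have le: "?f (lin_comb a v b w) k \<le> 2 * a\<^sup>2 * ?f v k + 2 * b\<^sup>2 * ?f w k" for k
    using mult_left_mono[OF norm_lin_comb_square_le[of a "fcoeff v k" b "fcoeff w k"], of "lnorm k powr (2 * n)"]
    by (simp add: fcoeff_lin_comb algebra_simps)
  have sb: "(\<lambda>k. 2 * a\<^sup>2 * ?f v k + 2 * b\<^sup>2 * ?f w k) summable_on ?Z"
    by (intro summable_on_add summable_on_cmult_right sv sw)
  have s: "?f (lin_comb a v b w) summable_on ?Z"
    by (rule summable_on_comparison_test[OF sb]) (use le in auto)
  then show "lin_comb a v b w \<in> H0 n"
    using v w by (simp add: H0_def vector_field_lin_comb) (simp add: fcoeff_lin_comb)
  have sq: "(Hnorm n u)\<^sup>2 = infsum (?f u) ?Z" for u :: "'d vfield"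
    by (simp add: Hnorm_def infsum_nonneg)
  have "(Hnorm n (lin_comb a v b w))\<^sup>2 \<le> (\<Sum>\<^sub>\<infinity>k\<in>?Z. 2 * a\<^sup>2 * ?f v k + 2 * b\<^sup>2 * ?f w k)"
    unfolding sq by (intro infsum_mono s sb le)
  also have "\<dots> = 2 * a\<^sup>2 * (Hnorm n v)\<^sup>2 + 2 * b\<^sup>2 * (Hnorm n w)\<^sup>2"
    unfolding sq using sv sw
    by (subst infsum_add) (auto simp: infsum_cmult_right' intro!: summable_on_cmult_right)
  finally show "(Hnorm n (lin_comb a v b w))\<^sup>2 \<le> 2 * a\<^sup>2 * (Hnorm n v)\<^sup>2 + 2 * b\<^sup>2 * (Hnorm n w)\<^sup>2" .
qed

lemma HSigma0_lin_comb: "v \<in> HSigma0 n \<Longrightarrow> w \<in> HSigma0 n \<Longrightarrow> lin_comb a v b w \<in> HSigma0 n"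
  by (auto simp: HSigma0_def H0_lin_comb fcoeff_lin_comb ldot_linear)

lemma represents_lin_comb:
  fixes u u' :: "'d::finite functional"
  assumes f: "represents f u" and g: "represents g u'"
  shows "represents (\<lambda>x. a * f x + b * g x) (\<lambda>\<phi>. complex_of_real a * u \<phi> + complex_of_real b * u' \<phi>)"
  unfolding represents_iff
proof (intro conjI allI impI)
  show "integrable torus (\<lambda>x. a * f x + b * g x)" using f g by (simp add: represents_iff)
  fix \<phi> :: "real ^ 'd \<Rightarrow> complex" assume \<phi>: "test_fun \<phi>"
  have i: "integrable torus (\<lambda>x. complex_of_real (f x) * \<phi> x)" "integrable torus (\<lambda>x. complex_of_real (g x) * \<phi> x)"
    using f g by (auto intro!: integrable_mult_test_fun \<phi> simp: represents_iff)
  have "of_function (\<lambda>x. a * f x + b * g x) \<phi> =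
      (\<integral>x. complex_of_real a * (complex_of_real (f x) * \<phi> x) + complex_of_real b * (complex_of_real (g x) * \<phi> x) \<partial>torus)"
    unfolding of_function_torus by (simp add: algebra_simps)
  also have "\<dots> = complex_of_real a * of_function f \<phi> + complex_of_real b * of_function g \<phi>"
    unfolding of_function_torus using i by simp
  finally show "complex_of_real a * u \<phi> + complex_of_real b * u' \<phi> = of_function (\<lambda>x. a * f x + b * g x) \<phi>"
    using f g \<phi> by (simp add: represents_iff)
qed

lemma represents_eqI: "represents f u \<Longrightarrow> represents f u' \<Longrightarrow> test_fun \<phi> \<Longrightarrow> u \<phi> = u' \<phi>"
  by (simp add: represents_iff)

text \<open>Linear combinations of representatives represent the linear combination.\<close>

lemma advection_lin_comb_left:
  fixes v v' w :: "'d::finite vfield"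
  assumes v: "v \<in> H0 1" and v': "v' \<in> H0 1" and w: "w \<in> H0 1"
  shows "same_field (advection (lin_comb a v b v') w) (lin_comb a (advection v w) b (advection v' w))"
  unfolding same_field_def
proof (intro allI impI)
  fix r and \<phi> :: "real ^ 'd \<Rightarrow> complex" assume \<phi>: "test_fun \<phi>"
  define f f' g where "f s = function_of (v $ s)" and "f' s = function_of (v' $ s)"
    and "g s = function_of (dist_partial s (w $ r))" for s
  have f: "represents (f s) (v $ s)" and f': "represents (f' s) (v' $ s)"
    and g: "represents (g s) (dist_partial s (w $ r))" for s
    unfolding f_def f'_def g_def using v v' w by (auto intro: component_represented partial_represented)
  have r1: "represents (\<lambda>x. \<Sum>s\<in>UNIV. (a * f s x + b * f' s x) * g s x) (advection (lin_comb a v b v') w $ r)"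
    by (rule advection_represented(2)[OF H0_lin_comb[OF v v'] w _ g])
      (unfold lin_comb_nth, intro represents_lin_comb f f')
  have r2: "represents (\<lambda>x. a * (\<Sum>s\<in>UNIV. f s x * g s x) + b * (\<Sum>s\<in>UNIV. f' s x * g s x))
      (lin_comb a (advection v w) b (advection v' w) $ r)"
    unfolding lin_comb_nth
    by (intro represents_lin_comb advection_represented(2) v v' w f f' g)
  have eq: "(\<lambda>x. \<Sum>s\<in>UNIV. (a * f s x + b * f' s x) * g s x) =
      (\<lambda>x. a * (\<Sum>s\<in>UNIV. f s x * g s x) + b * (\<Sum>s\<in>UNIV. f' s x * g s x))"
    by (simp add: sum_distrib_left distrib_right sum.distrib mult.assoc)
  show "(advection (lin_comb a v b v') w $ r) \<phi> = (lin_comb a (advection v w) b (advection v' w) $ r) \<phi>"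
    by (rule represents_eqI[OF r1[unfolded eq] r2 \<phi>])
qed

lemma advection_lin_comb_right:
  fixes v w w' :: "'d::finite vfield"
  assumes v: "v \<in> H0 1" and w: "w \<in> H0 1" and w': "w' \<in> H0 1"
  shows "same_field (advection v (lin_comb a w b w')) (lin_comb a (advection v w) b (advection v w'))"
  unfolding same_field_def
proof (intro allI impI)
  fix r and \<phi> :: "real ^ 'd \<Rightarrow> complex" assume \<phi>: "test_fun \<phi>"
  define f g g' where "f s = function_of (v $ s)" and "g s = function_of (dist_partial s (w $ r))"
    and "g' s = function_of (dist_partial s (w' $ r))" for s
  have f: "represents (f s) (v $ s)" and g: "represents (g s) (dist_partial s (w $ r))"
    and g': "represents (g' s) (dist_partial s (w' $ r))" for s
    unfolding f_def g_def g'_def using v w w' by (auto intro: component_represented partial_represented)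
  have dp: "dist_partial s (lin_comb a w b w' $ r) =
      (\<lambda>\<phi>. complex_of_real a * dist_partial s (w $ r) \<phi> + complex_of_real b * dist_partial s (w' $ r) \<phi>)" for s
    by (simp add: dist_partial_def lin_comb_nth)
  have r1: "represents (\<lambda>x. \<Sum>s\<in>UNIV. f s x * (a * g s x + b * g' s x)) (advection v (lin_comb a w b w') $ r)"
    by (rule advection_represented(2)[OF v H0_lin_comb[OF w w'] f])
      (unfold dp, intro represents_lin_comb g g')
  have r2: "represents (\<lambda>x. a * (\<Sum>s\<in>UNIV. f s x * g s x) + b * (\<Sum>s\<in>UNIV. f s x * g' s x))
      (lin_comb a (advection v w) b (advection v w') $ r)"
    unfolding lin_comb_nth
    by (intro represents_lin_comb advection_represented(2) v w w' f g g')
  have eq: "(\<lambda>x. \<Sum>s\<in>UNIV. f s x * (a * g s x + b * g' s x)) =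
      (\<lambda>x. a * (\<Sum>s\<in>UNIV. f s x * g s x) + b * (\<Sum>s\<in>UNIV. f s x * g' s x))"
    by (simp add: sum_distrib_left distrib_left sum.distrib mult.left_commute)
  show "(advection v (lin_comb a w b w') $ r) \<phi> = (lin_comb a (advection v w) b (advection v w') $ r) \<phi>"
    by (rule represents_eqI[OF r1[unfolded eq] r2 \<phi>])
qed

lemma same_field_fcoeff: "same_field u u' \<Longrightarrow> fcoeff u k = fcoeff u' k"
  by (simp add: same_field_def vec_eq_iff fcoeff_nth)

lemma series_distribution_linear:
  fixes l m :: "int ^ 'd::finite \<Rightarrow> complex"
  assumes l: "\<And>k. norm (l k) \<le> B" and m: "\<And>k. norm (m k) \<le> B'" and \<phi>: "test_fun \<phi>"
  shows "series_distribution (\<lambda>k. a * l k + b * m k) \<phi> =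
    a * series_distribution l \<phi> + b * series_distribution m \<phi>"
proof -
  have s: "(\<lambda>k. l k * (\<integral>x. fourier_basis k x * \<phi> x \<partial>torus)) summable_on UNIV"
    if "\<And>k. norm (l k) \<le> B" for l and B
  proof -
    have "0 \<le> B" using that[of 0] norm_ge_zero order_trans by blast
    with that show ?thesis using \<phi> by (rule series_distribution_summable(2))
  qed
  show ?thesis
    unfolding series_distribution_def
    using infsum_add[OF summable_on_cmult_right[OF s[OF l], of a] summable_on_cmult_right[OF s[OF m], of b]]
    by (simp add: infsum_cmult_right' distrib_right mult.assoc)
qed

lemma ns_bilinear_nth: "(ns_bilinear v w $ r) \<phi> = - (leray (advection v w) $ r) \<phi>"
  by (simp add: ns_bilinear_def)

text \<open>Only the coefficients enter the projection, so linear relations between products on test functions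
  carry over to the projected products.\<close>

lemma ns_bilinear_lin_comb:
  fixes x :: "'d::finite vfield"
  assumes eq: "same_field (advection x y) (lin_comb a (advection x1 y1) b (advection x2 y2))"
    and in1: "x1 \<in> H0 1" "y1 \<in> H0 1" and in2: "x2 \<in> H0 1" "y2 \<in> H0 1"
  shows "same_field (ns_bilinear x y) (lin_comb a (ns_bilinear x1 y1) b (ns_bilinear x2 y2))"
  unfolding same_field_def
proof (intro allI impI)
  fix r and \<phi> :: "real ^ 'd \<Rightarrow> complex" assume \<phi>: "test_fun \<phi>"
  obtain B1 where B1: "\<And>k. norm (fcoeff (advection x1 y1) k) \<le> B1"
    using fcoeff_advection_bounded[OF in1] by metis
  obtain B2 where B2: "\<And>k. norm (fcoeff (advection x2 y2) k) \<le> B2"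
    using fcoeff_advection_bounded[OF in2] by metis
  have "leray_coeff k (fcoeff (advection x y) k) $ r =
      complex_of_real a * leray_coeff k (fcoeff (advection x1 y1) k) $ r +
      complex_of_real b * leray_coeff k (fcoeff (advection x2 y2) k) $ r" for k
    unfolding same_field_fcoeff[OF eq] fcoeff_lin_comb leray_coeff_linear
    by (simp add: scaleR_complex_nth del: vector_scaleR_component)
  then have "(leray (advection x y) $ r) \<phi> =
      complex_of_real a * (leray (advection x1 y1) $ r) \<phi> + complex_of_real b * (leray (advection x2 y2) $ r) \<phi>"
    unfolding leray_series
    by (simp add: series_distribution_linear[OF
          order_trans[OF norm_leray_coeff_nth_le B1] order_trans[OF norm_leray_coeff_nth_le B2] \<phi>])
  then show "(ns_bilinear x y $ r) \<phi> = (lin_comb a (ns_bilinear x1 y1) b (ns_bilinear x2 y2) $ r) \<phi>"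
    by (simp add: lin_comb_nth ns_bilinear_nth)
qed

section \<open>Boundedness, bilinearity and continuity\<close>

lemma Hnorm_cong: "(\<And>k. norm (fcoeff u k) = norm (fcoeff u' k)) \<Longrightarrow> Hnorm n u = Hnorm n u'"
  by (simp add: Hnorm_def)

lemma HSigma0_H0: "v \<in> HSigma0 n \<Longrightarrow> v \<in> H0 n"
  by (simp add: HSigma0_def)

lemma fcoeff_ns_bilinear: "fcoeff (ns_bilinear v w) k = - fcoeff (leray (advection v w)) k"
  by (simp add: vec_eq_iff fcoeff_nth ns_bilinear_nth)

lemma ns_bilinear_eq_lin_comb:
  "ns_bilinear v w = lin_comb (- 1) (leray (advection v w)) 0 (leray (advection v w))"
  by (simp add: vec_eq_iff lin_comb_nth ns_bilinear_nth fun_eq_iff)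

theorem leray_advection_estimate:
  fixes v w :: "'d::finite vfield"
  assumes "CARD('d) \<ge> 2" "\<omega> > real CARD('d) / 2 - 1" "K > 0"
    and "1 / (2 * pi) powr (real CARD('d) / 2) *
           sqrt (SUP k \<in> UNIV - {0 :: int ^ 'd}. Kfun \<omega> k) \<le> K"
    and v: "v \<in> HSigma0 1" and w: "w \<in> H0 1"
  shows "leray (advection v w) \<in> HSigma0 (- \<omega>)"
    and "Hnorm (- \<omega>) (leray (advection v w)) \<le> K * Hnorm 1 v * Hnorm 1 w"
    and "ns_bilinear v w \<in> HSigma0 (- \<omega>)"
    and "Hnorm (- \<omega>) (ns_bilinear v w) \<le> K * Hnorm 1 v * Hnorm 1 w"
proof -
  note est = advection_estimate[OF assms]
  obtain B where B: "\<And>k. norm (fcoeff (advection v w) k) \<le> B"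
    using fcoeff_advection_bounded[OF HSigma0_H0[OF v] w] by metis
  show L: "leray (advection v w) \<in> HSigma0 (- \<omega>)" by (rule leray_estimate(1)[OF est(1) B])
  show N: "Hnorm (- \<omega>) (leray (advection v w)) \<le> K * Hnorm 1 v * Hnorm 1 w"
    using leray_estimate(2)[OF est(1) B] est(2) by (rule order_trans)
  show "ns_bilinear v w \<in> HSigma0 (- \<omega>)"
    unfolding ns_bilinear_eq_lin_comb by (rule HSigma0_lin_comb[OF L L])
  have "Hnorm (- \<omega>) (ns_bilinear v w) = Hnorm (- \<omega>) (leray (advection v w))"
    by (rule Hnorm_cong) (simp add: fcoeff_ns_bilinear)
  with N show "Hnorm (- \<omega>) (ns_bilinear v w) \<le> K * Hnorm 1 v * Hnorm 1 w" by simp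
qed

lemma ns_bilinear_linear_left:
  assumes "v \<in> HSigma0 1" "v' \<in> HSigma0 1" "w \<in> HSigma0 1"
  shows "same_field (ns_bilinear (lin_comb a v b v') w) (lin_comb a (ns_bilinear v w) b (ns_bilinear v' w))"
  using assms by (intro ns_bilinear_lin_comb advection_lin_comb_left HSigma0_H0)

lemma ns_bilinear_linear_right:
  assumes "v \<in> HSigma0 1" "w \<in> HSigma0 1" "w' \<in> HSigma0 1"
  shows "same_field (ns_bilinear v (lin_comb a w b w')) (lin_comb a (ns_bilinear v w) b (ns_bilinear v w'))"
  using assms by (intro ns_bilinear_lin_comb advection_lin_comb_right HSigma0_H0)

text \<open>With \<open>B\<close> for the bilinear map, write \<open>B(v', w') - B(v, w) = B(v' - v, w') + B(v, w' - w)\<close> and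
  bound \<open>w'\<close> by \<open>w\<close> and the increment. All squares are estimated by
  \<open>(x + y)\<^sup>2 \<le> 2x\<^sup>2 + 2y\<^sup>2\<close>, which explains the constants.\<close>

lemma ns_bilinear_increment:
  fixes v w v' w' :: "'d::finite vfield"
  assumes hyps: "CARD('d) \<ge> 2" "\<omega> > real CARD('d) / 2 - 1" "K > 0"
      "1 / (2 * pi) powr (real CARD('d) / 2) *
           sqrt (SUP k \<in> UNIV - {0 :: int ^ 'd}. Kfun \<omega> k) \<le> K"
    and v: "v \<in> HSigma0 1" and w: "w \<in> HSigma0 1" and v': "v' \<in> HSigma0 1" and w': "w' \<in> HSigma0 1"
    and \<delta>: "0 < \<delta>" "\<delta> \<le> 1"
    and dv_le: "Hnorm 1 (lin_comb 1 v' (- 1) v) < \<delta>" and dw_le: "Hnorm 1 (lin_comb 1 w' (- 1) w) < \<delta>"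
  shows "(Hnorm (- \<omega>) (lin_comb 1 (ns_bilinear v' w') (- 1) (ns_bilinear v w)))\<^sup>2 \<le>
    2 * K\<^sup>2 * (2 + 2 * (Hnorm 1 w)\<^sup>2 + (Hnorm 1 v)\<^sup>2) * \<delta>\<^sup>2"
proof -
  let ?dv = "lin_comb 1 v' (- 1) v" and ?dw = "lin_comb 1 w' (- 1) w"
  let ?P = "ns_bilinear ?dv w'" and ?Q = "ns_bilinear v ?dw"
  have dv: "?dv \<in> HSigma0 1" and dw: "?dw \<in> HSigma0 1" using v v' w w' by (auto intro: HSigma0_lin_comb)
  have "fcoeff (lin_comb 1 (ns_bilinear v' w') (- 1) (ns_bilinear v w)) k = fcoeff (lin_comb 1 ?P 1 ?Q) k" for k
    using same_field_fcoeff[OF ns_bilinear_linear_left[OF v' v w', of 1 "- 1"], of k]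
      same_field_fcoeff[OF ns_bilinear_linear_right[OF v w' w, of 1 "- 1"], of k]
    by (simp add: fcoeff_lin_comb)
  hence "Hnorm (- \<omega>) (lin_comb 1 (ns_bilinear v' w') (- 1) (ns_bilinear v w)) = Hnorm (- \<omega>) (lin_comb 1 ?P 1 ?Q)"
    by (intro Hnorm_cong) simp
  also have "(Hnorm (- \<omega>) (lin_comb 1 ?P 1 ?Q))\<^sup>2 \<le> 2 * (Hnorm (- \<omega>) ?P)\<^sup>2 + 2 * (Hnorm (- \<omega>) ?Q)\<^sup>2"
    using Hnorm_lin_comb_le[of ?P "- \<omega>" ?Q 1 1]
      leray_advection_estimate(3)[OF hyps dv HSigma0_H0[OF w']]
      leray_advection_estimate(3)[OF hyps v HSigma0_H0[OF dw]]
    by (simp add: HSigma0_H0)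
  also have "(Hnorm (- \<omega>) ?P)\<^sup>2 \<le> K\<^sup>2 * \<delta>\<^sup>2 * (2 + 2 * (Hnorm 1 w)\<^sup>2)"
  proof -
    have d1: "(Hnorm 1 ?dw)\<^sup>2 \<le> 1"
      using dw_le \<delta> Hnorm_nonneg[of 1 ?dw] by (simp add: power_le_one)
    have "fcoeff w' k = fcoeff (lin_comb 1 ?dw 1 w) k" for k by (simp add: fcoeff_lin_comb)
    hence "Hnorm 1 w' = Hnorm 1 (lin_comb 1 ?dw 1 w)" by (intro Hnorm_cong) simp
    hence "(Hnorm 1 w')\<^sup>2 \<le> 2 * (Hnorm 1 ?dw)\<^sup>2 + 2 * (Hnorm 1 w)\<^sup>2"
      using Hnorm_lin_comb_le[OF HSigma0_H0[OF dw] HSigma0_H0[OF w], of 1 1] by simp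
    hence w'_le: "(Hnorm 1 w')\<^sup>2 \<le> 2 + 2 * (Hnorm 1 w)\<^sup>2" using d1 by linarith
    have "(Hnorm (- \<omega>) ?P)\<^sup>2 \<le> (K * Hnorm 1 ?dv * Hnorm 1 w')\<^sup>2"
      by (intro power_mono leray_advection_estimate(4)[OF hyps dv HSigma0_H0[OF w']] Hnorm_nonneg)
    also have "\<dots> = K\<^sup>2 * (Hnorm 1 ?dv)\<^sup>2 * (Hnorm 1 w')\<^sup>2" by (simp add: power_mult_distrib)
    also have "\<dots> \<le> K\<^sup>2 * \<delta>\<^sup>2 * (2 + 2 * (Hnorm 1 w)\<^sup>2)"
      using dv_le hyps(3) by (intro mult_mono power_mono w'_le) (auto simp: Hnorm_nonneg)
    finally show ?thesis .
  qed
  also have "(Hnorm (- \<omega>) ?Q)\<^sup>2 \<le> K\<^sup>2 * (Hnorm 1 v)\<^sup>2 * \<delta>\<^sup>2"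
  proof -
    have "(Hnorm (- \<omega>) ?Q)\<^sup>2 \<le> (K * Hnorm 1 v * Hnorm 1 ?dw)\<^sup>2"
      by (intro power_mono leray_advection_estimate(4)[OF hyps v HSigma0_H0[OF dw]] Hnorm_nonneg)
    also have "\<dots> = K\<^sup>2 * (Hnorm 1 v)\<^sup>2 * (Hnorm 1 ?dw)\<^sup>2" by (simp add: power_mult_distrib)
    also have "\<dots> \<le> K\<^sup>2 * (Hnorm 1 v)\<^sup>2 * \<delta>\<^sup>2"
      using dw_le by (intro mult_left_mono power_mono) (auto simp: Hnorm_nonneg)
    finally show ?thesis .
  qed
  finally show ?thesis by (simp add: algebra_simps)
qed

lemma ns_bilinear_continuous:
  fixes v w :: "'d::finite vfield"
  assumes hyps: "CARD('d) \<ge> 2" "\<omega> > real CARD('d) / 2 - 1" "K > 0"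
      "1 / (2 * pi) powr (real CARD('d) / 2) *
           sqrt (SUP k \<in> UNIV - {0 :: int ^ 'd}. Kfun \<omega> k) \<le> K"
    and v: "v \<in> HSigma0 1" and w: "w \<in> HSigma0 1" and \<epsilon>: "\<epsilon> > 0"
  shows "\<exists>\<delta> > 0. \<forall>v' \<in> HSigma0 1. \<forall>w' \<in> HSigma0 1.
          Hnorm 1 (lin_comb 1 v' (- 1) v) < \<delta> \<longrightarrow> Hnorm 1 (lin_comb 1 w' (- 1) w) < \<delta> \<longrightarrow>
          Hnorm (- \<omega>) (lin_comb 1 (ns_bilinear v' w') (- 1) (ns_bilinear v w)) < \<epsilon>"
proof -
  define M where "M = 2 * K\<^sup>2 * (2 + 2 * (Hnorm 1 w)\<^sup>2 + (Hnorm 1 v)\<^sup>2)"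
  have M: "M > 0"
    unfolding M_def using \<open>K > 0\<close> by (intro mult_pos_pos add_pos_nonneg) auto
  \<comment> \<open>The half leaves room for the strict inequality.\<close>
  define \<delta> where "\<delta> = min 1 (\<epsilon> / (2 * sqrt M))"
  have \<delta>: "0 < \<delta>" "\<delta> \<le> 1" using M \<epsilon> by (auto simp: \<delta>_def)
  have "M * \<delta>\<^sup>2 < \<epsilon>\<^sup>2"
  proof -
    have "M * \<delta>\<^sup>2 \<le> M * (\<epsilon> / (2 * sqrt M))\<^sup>2"
      using M \<delta> by (intro mult_left_mono power_mono) (auto simp: \<delta>_def)
    also have "\<dots> = \<epsilon>\<^sup>2 / 4" using M by (simp add: power_divide power_mult_distrib)
    also have "\<dots> < \<epsilon>\<^sup>2" using \<epsilon> by simp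
    finally show ?thesis .
  qed
  note small = this
  have "Hnorm (- \<omega>) (lin_comb 1 (ns_bilinear v' w') (- 1) (ns_bilinear v w)) < \<epsilon>"
    if "v' \<in> HSigma0 1" "w' \<in> HSigma0 1"
      "Hnorm 1 (lin_comb 1 v' (- 1) v) < \<delta>" "Hnorm 1 (lin_comb 1 w' (- 1) w) < \<delta>" for v' w'
  proof (rule power_less_imp_less_base)
    show "(Hnorm (- \<omega>) (lin_comb 1 (ns_bilinear v' w') (- 1) (ns_bilinear v w)))\<^sup>2 < \<epsilon>\<^sup>2"
      using ns_bilinear_increment[OF hyps v w that(1,2) \<delta> that(3,4)] small unfolding M_def
      by (rule le_less_trans)
  qed (use \<epsilon> in simp)
  with \<delta>(1) show ?thesis by blast
qed

theorem proposition5p2: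
  fixes \<omega> K :: real
  assumes "CARD('d::finite) \<ge> 2"
    and "\<omega> > real CARD('d) / 2 - 1"
    and "K > 0"
    and "1 / (2 * pi) powr (real CARD('d) / 2) *
           sqrt (SUP k \<in> UNIV - {0 :: int ^ 'd}. Kfun \<omega> k) \<le> K"
  shows
    "(\<forall>v \<in> HSigma0 1 :: 'd::finite vfield set. \<forall>w \<in> H0 1.
        advection_well_defined v w \<and>
        advection v w \<in> H0 (- \<omega>) \<and>
        Hnorm (- \<omega>) (advection v w) \<le> K * Hnorm 1 v * Hnorm 1 w \<and>
        leray (advection v w) \<in> HSigma0 (- \<omega>) \<and>
        Hnorm (- \<omega>) (leray (advection v w)) \<le> K * Hnorm 1 v * Hnorm 1 w) \<and>
     (\<forall>v \<in> HSigma0 1 :: 'd::finite vfield set. \<forall>w \<in> HSigma0 1.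
        ns_bilinear v w \<in> HSigma0 (- \<omega>) \<and>
        Hnorm (- \<omega>) (ns_bilinear v w) \<le> K * Hnorm 1 v * Hnorm 1 w) \<and>
     (\<forall>v \<in> HSigma0 1 :: 'd::finite vfield set. \<forall>v' \<in> HSigma0 1. \<forall>w \<in> HSigma0 1. \<forall>a b.
        same_field (ns_bilinear (lin_comb a v b v') w)
                   (lin_comb a (ns_bilinear v w) b (ns_bilinear v' w)) \<and>
        same_field (ns_bilinear w (lin_comb a v b v'))
                   (lin_comb a (ns_bilinear w v) b (ns_bilinear w v'))) \<and>
     (\<forall>v \<in> HSigma0 1 :: 'd::finite vfield set. \<forall>w \<in> HSigma0 1. \<forall>\<epsilon> > 0. \<exists>\<delta> > 0.
        \<forall>v' \<in> HSigma0 1. \<forall>w' \<in> HSigma0 1.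
          Hnorm 1 (lin_comb 1 v' (- 1) v) < \<delta> \<longrightarrow> Hnorm 1 (lin_comb 1 w' (- 1) w) < \<delta> \<longrightarrow>
          Hnorm (- \<omega>) (lin_comb 1 (ns_bilinear v' w') (- 1) (ns_bilinear v w)) < \<epsilon>)"
proof (intro conjI ballI allI impI)
  fix v w :: "'d vfield" assume v: "v \<in> HSigma0 1" and w: "w \<in> H0 1"
  show "advection_well_defined v w" using HSigma0_H0[OF v] w by (rule advection_well_defined_H0)
  show "advection v w \<in> H0 (- \<omega>)" "Hnorm (- \<omega>) (advection v w) \<le> K * Hnorm 1 v * Hnorm 1 w"
    by (rule advection_estimate[OF assms v w])+
  show "leray (advection v w) \<in> HSigma0 (- \<omega>)"
    "Hnorm (- \<omega>) (leray (advection v w)) \<le> K * Hnorm 1 v * Hnorm 1 w"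
    by (rule leray_advection_estimate[OF assms v w])+
next
  fix v w :: "'d vfield" assume v: "v \<in> HSigma0 1" and w: "w \<in> HSigma0 1"
  show "ns_bilinear v w \<in> HSigma0 (- \<omega>)"
    "Hnorm (- \<omega>) (ns_bilinear v w) \<le> K * Hnorm 1 v * Hnorm 1 w"
    by (rule leray_advection_estimate[OF assms v HSigma0_H0[OF w]])+
next
  fix v v' w :: "'d vfield" and a b :: real
  assume "v \<in> HSigma0 1" "v' \<in> HSigma0 1" "w \<in> HSigma0 1"
  then show "same_field (ns_bilinear (lin_comb a v b v') w) (lin_comb a (ns_bilinear v w) b (ns_bilinear v' w))"
    and "same_field (ns_bilinear w (lin_comb a v b v')) (lin_comb a (ns_bilinear w v) b (ns_bilinear w v'))"
    by (simp_all add: ns_bilinear_linear_left ns_bilinear_linear_right)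
next
  fix v w :: "'d vfield" and \<epsilon> :: real
  assume "v \<in> HSigma0 1" "w \<in> HSigma0 1" "\<epsilon> > 0"
  then show "\<exists>\<delta> > 0. \<forall>v' \<in> HSigma0 1. \<forall>w' \<in> HSigma0 1.
          Hnorm 1 (lin_comb 1 v' (- 1) v) < \<delta> \<longrightarrow> Hnorm 1 (lin_comb 1 w' (- 1) w) < \<delta> \<longrightarrow>
          Hnorm (- \<omega>) (lin_comb 1 (ns_bilinear v' w') (- 1) (ns_bilinear v w)) < \<epsilon>"
    by (rule ns_bilinear_continuous[OF assms])
qed

end
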